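(* Every Laurent polynomial $p\in\mathbb C[x^{\pm1},y^{\pm1}]$ of effective rank two with unimodular support satisfying $\mu(p)\mid p^N$ for some integer $N>0$ has maximum-likelihood degree one. The converse is false, even for a positive polynomial with full lattice-point support in a smooth polygon: there is a Laurent polynomial $p$ with positive coefficients, whose support is the set of all lattice points of a smooth lattice polygon, which has maximum-likelihood degree one but for which $\mu(p)$ divides no power $p^N$, $N>0$.
   Context: For $a\in\mathbb Z^2$ let $\chi^a$ denote the monomial with exponent $a$. For $p=\sum_{a\in\mathcal A}c_a\chi^a$ with all $c_a\ne0$, $\mathcal A=\operatorname{supp}(p)$; $p$ has effective rank two if $\mathcal A-\mathcal A$ spans $\mathbb R^2$. Choose $m_0\in\mathcal A$, put $\widehat p=\chi^{-m_0}p$, $\Theta_1=x\partial_x$, $\Theta_2=y\partial_y$ and $\mu(p)=\widehat p^{\,3}\det(\Theta_i(\Theta_j\widehat p/\widehat p))_{i,j=1,2}$, a Laurent polynomial defined up to a Laurent monomial unit; divisibility is in $\mathbb C[x^{\pm1},y^{\pm1}]$. The support is unimodular if at every vertex $v$ of $\operatorname{conv}(\mathcal A)$ the differences $a-v$, with $a$ the support points nearest to $v$ (other than $v$) on the edges incident to $v$, form a $\mathbb Z$-basis of $\mathbb Z^2$. A lattice polygon is smooth if at each vertex the primitive edge directions form a $\mathbb Z$-basis of $\mathbb Z^2$. The maximum-likelihood degree of $p$ is the algebraic degree of the rational map $$\mathcal L_p(x,y)=\Bigl(\frac{x\partial_xp}{p},\frac{y\partial_yp}{p}\Bigr);$$ it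 equals one exactly when $\mathcal L_p$ is birational. *)

theory Defs
  imports
    "HOL-Analysis.Analysis"
    "HOL-Library.Poly_Mapping"
    "HOL-Computational_Algebra.Computational_Algebra"
begin

text \<open>
  The ring of complex Laurent polynomials in two variables is the group algebra of the lattice of
  exponents; \<^term>\<open>Poly_Mapping.keys p\<close> is the support of \<open>p\<close> and divisibility is \<open>dvd\<close> in this ring.
\<close>
type_synonym laurent = "(int \<times> int) \<Rightarrow>\<^sub>0 complex"

definition chi :: "int \<times> int \<Rightarrow> laurent" where
  "chi a = Poly_Mapping.single a 1"

text \<open>The field of rational functions; \<open>x\<close> is the inner and \<open>y\<close> the outer polynomial variable.\<close>
type_synonym ratfun = "complex poly poly fract"

definition ratC :: "complex \<Rightarrow> ratfun" where
  "ratC c = to_fract [:[:c:]:]"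

definition ratX :: ratfun where
  "ratX = to_fract [:[:0, 1:]:]"

definition ratY :: ratfun where
  "ratY = to_fract [:0, 1:]"

definition ratfun_of :: "laurent \<Rightarrow> ratfun" where
  "ratfun_of p =
    (\<Sum>a\<in>Poly_Mapping.keys p. ratC (Poly_Mapping.lookup p a) * ratX powi fst a * ratY powi snd a)"

lemma map_poly_pderiv_add:
  "map_poly pderiv (f + g) = map_poly pderiv f + map_poly pderiv (g :: complex poly poly)"
  by (rule poly_eqI) (simp add: coeff_map_poly pderiv_add)

lemma pderiv_sum_poly: "pderiv (\<Sum>i\<in>I. f i) = (\<Sum>i\<in>I. pderiv (f i :: complex poly))"
  by (induction I rule: infinite_finite_induct) (simp_all add: pderiv_add)

lemma map_poly_pderiv_mult:
  "map_poly pderiv (f * g) = map_poly pderiv f * g + f * map_poly pderiv (g :: complex poly poly)"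
proof (rule poly_eqI)
  fix n
  have "pderiv (\<Sum>i\<le>n. coeff f i * coeff g (n - i)) =
      (\<Sum>i\<le>n. pderiv (coeff f i) * coeff g (n - i) + coeff f i * pderiv (coeff g (n - i)))"
    by (simp add: pderiv_sum_poly pderiv_mult algebra_simps)
  then show "coeff (map_poly pderiv (f * g)) n =
      coeff (map_poly pderiv f * g + f * map_poly pderiv g) n"
    by (simp add: coeff_map_poly coeff_mult sum.distrib)
qed

text \<open>Extension of a derivation to the fraction field by the quotient rule.\<close>
definition fract_deriv :: "('a \<Rightarrow> 'a) \<Rightarrow> 'a :: idom fract \<Rightarrow> 'a fract" where
  "fract_deriv D q = (THE r. \<exists>a b. b \<noteq> 0 \<and> q = Fraction_Field.Fract a b \<and>
    r = Fraction_Field.Fract (D a * b - a * D b) (b * b))"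

lemma fract_deriv_Fract:
  fixes a b :: "'a :: idom"
  assumes D: "\<And>f g. D (f * g) = D f * g + f * D g" and b: "b \<noteq> 0"
  shows "fract_deriv D (Fraction_Field.Fract a b) =
    Fraction_Field.Fract (D a * b - a * D b) (b * b)"
  unfolding fract_deriv_def
proof (rule the_equality)
  show "\<exists>a' b'. b' \<noteq> 0 \<and> Fraction_Field.Fract a b = Fraction_Field.Fract a' b' \<and>
      Fraction_Field.Fract (D a * b - a * D b) (b * b) =
      Fraction_Field.Fract (D a' * b' - a' * D b') (b' * b')"
    using b by blast
next
  fix r
  assume "\<exists>a' b'. b' \<noteq> 0 \<and> Fraction_Field.Fract a b = Fraction_Field.Fract a' b' \<and>
      r = Fraction_Field.Fract (D a' * b' - a' * D b') (b' * b')"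
  then obtain c d where d: "d \<noteq> 0"
    and eq: "Fraction_Field.Fract a b = Fraction_Field.Fract c d"
    and r: "r = Fraction_Field.Fract (D c * d - c * D d) (d * d)"
    by blast
  have ad: "a * d = c * b"
    using eq b d by (simp add: eq_fract)
  then have "D a * d + a * D d = D c * b + c * D b"
    using D[of a d] D[of c b] by simp
  with ad have "(D c * d - c * D d) * (b * b) = (D a * b - a * D b) * (d * d)"
    by algebra
  then show "r = Fraction_Field.Fract (D a * b - a * D b) (b * b)"
    unfolding r using b d by (simp add: eq_fract)
qed

lemma fract_deriv_mult:
  fixes u v :: "'a :: idom fract"
  assumes D: "\<And>f g. D (f * g) = D f * g + f * D g"
  shows "fract_deriv D (u * v) = fract_deriv D u * v + u * fract_deriv D v"
proof -
  obtain a b where u: "u = Fraction_Field.Fract a b" and b: "b \<noteq> 0" by (cases u)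
  obtain c d where v: "v = Fraction_Field.Fract c d" and d: "d \<noteq> 0" by (cases v)
  show ?thesis
    using b d by (simp add: u v fract_deriv_Fract[OF D] eq_fract D algebra_simps)
qed

lemma fract_deriv_add:
  fixes u v :: "'a :: idom fract"
  assumes D: "\<And>f g. D (f * g) = D f * g + f * D g" and A: "\<And>f g. D (f + g) = D f + D g"
  shows "fract_deriv D (u + v) = fract_deriv D u + fract_deriv D v"
proof -
  obtain a b where u: "u = Fraction_Field.Fract a b" and b: "b \<noteq> 0" by (cases u)
  obtain c d where v: "v = Fraction_Field.Fract c d" and d: "d \<noteq> 0" by (cases v)
  show ?thesis
    using b d by (simp add: u v fract_deriv_Fract[OF D] eq_fract D A algebra_simps)
qed

definition rat_dx :: "ratfun \<Rightarrow> ratfun" where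
  "rat_dx = fract_deriv (map_poly pderiv)"

definition rat_dy :: "ratfun \<Rightarrow> ratfun" where
  "rat_dy = fract_deriv pderiv"

definition Theta1 :: "ratfun \<Rightarrow> ratfun" where
  "Theta1 f = ratX * rat_dx f"

definition Theta2 :: "ratfun \<Rightarrow> ratfun" where
  "Theta2 f = ratY * rat_dy f"

definition mu_ratfun :: "ratfun \<Rightarrow> ratfun" where
  "mu_ratfun f =
    f ^ 3 * (Theta1 (Theta1 f / f) * Theta2 (Theta2 f / f) - Theta1 (Theta2 f / f) * Theta2 (Theta1 f / f))"

text \<open>
  \<open>m0\<close> is the chosen support point.  That the rational function on the right is a Laurent polynomial,
  and that it is one in a unique way, is \<open>ratfun_of_mu\<close> and \<open>inj_ratfun_of\<close> below.
\<close>
definition mu :: "int \<times> int \<Rightarrow> laurent \<Rightarrow> laurent" where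
  "mu m0 p = (THE m. ratfun_of m = mu_ratfun (ratfun_of (chi (- m0) * p)))"

definition is_derivation :: "('a :: field \<Rightarrow> 'a) \<Rightarrow> bool" where
  "is_derivation T \<longleftrightarrow> (\<forall>u v. T (u + v) = T u + T v) \<and> (\<forall>u v. T (u * v) = T u * v + u * T v)"

lemma derivation_add: "is_derivation T \<Longrightarrow> T (u + v) = T u + T v"
  and derivation_mult: "is_derivation T \<Longrightarrow> T (u * v) = T u * v + u * T v"
  by (simp_all add: is_derivation_def)

lemma derivation_0: "is_derivation T \<Longrightarrow> T 0 = 0"
  by (metis add.right_neutral add_left_imp_eq derivation_add)

lemma derivation_1: "is_derivation T \<Longrightarrow> T 1 = 0"
  by (metis add.right_neutral add_left_imp_eq derivation_mult mult.left_neutral mult.right_neutral)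

lemma derivation_sum: "is_derivation T \<Longrightarrow> T (\<Sum>i\<in>I. f i) = (\<Sum>i\<in>I. T (f i))"
  by (induction I rule: infinite_finite_induct) (simp_all add: derivation_0 derivation_add)

lemma derivation_divide:
  assumes T: "is_derivation T" and "v \<noteq> 0"
  shows "T (u / v) = (T u * v - u * T v) / v ^ 2"
proof -
  have "T u = T (u / v) * v + (u / v) * T v"
    using derivation_mult[OF T, of "u / v" v] assms(2) by simp
  with assms(2) show ?thesis by (simp add: field_simps power2_eq_square)
qed

lemma derivation_power:
  "is_derivation T \<Longrightarrow> T (u ^ n) * u = of_nat n * u ^ n * T u"
  by (induction n) (simp_all add: derivation_1 derivation_mult algebra_simps)

lemma derivation_power_int:
  assumes T: "is_derivation T" and u: "u \<noteq> 0"
  shows "T (u powi k) = of_int k * u powi k * (T u / u)"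
proof (cases "k \<ge> 0")
  case True
  then obtain n where "k = int n" using nonneg_int_cases by blast
  with derivation_power[OF T, of u n] u show ?thesis by (simp add: field_simps)
next
  case False
  then obtain n where k: "k = - int n" by (metis int_cases2 of_nat_0_le_iff)
  have "T (u powi k) = T (1 / u ^ n)"
    by (simp add: k power_int_minus field_simps)
  also have "\<dots> = - T (u ^ n) / (u ^ n) ^ 2"
    using u by (simp add: derivation_divide[OF T] derivation_1[OF T])
  also have "T (u ^ n) = of_nat n * u ^ n * T u / u"
    using derivation_power[OF T, of u n] u by (simp add: field_simps)
  finally show ?thesis
    using u by (simp add: k power_int_minus field_simps power2_eq_square)
qed

lemma Theta1_derivation: "is_derivation Theta1"
  by (simp add: is_derivation_def Theta1_def rat_dx_def fract_deriv_add fract_deriv_mult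
      map_poly_pderiv_add map_poly_pderiv_mult algebra_simps)

lemma Theta2_derivation: "is_derivation Theta2"
  by (simp add: is_derivation_def Theta2_def rat_dy_def fract_deriv_add fract_deriv_mult
      pderiv_add pderiv_mult algebra_simps)

lemma ratX_nonzero [simp]: "ratX \<noteq> 0" and ratY_nonzero [simp]: "ratY \<noteq> 0"
  by (simp_all add: ratX_def ratY_def)

lemma map_poly_pderiv_1 [simp]: "map_poly pderiv (1 :: complex poly poly) = 0"
  by (rule poly_eqI) (simp add: coeff_map_poly coeff_1)

lemma Theta_generators:
  "Theta1 (ratC c) = 0" "Theta1 ratX = ratX" "Theta1 ratY = 0"
  "Theta2 (ratC c) = 0" "Theta2 ratX = 0" "Theta2 ratY = ratY"
  by (simp_all add: Theta1_def Theta2_def ratC_def ratX_def ratY_def rat_dx_def rat_dy_def to_fract_def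
      fract_deriv_Fract map_poly_pderiv_mult pderiv_mult map_poly_pCons pderiv_pCons
      flip: One_fract_def Zero_fract_def one_pCons)

lemma ratC_hom:
  "ratC (c + d) = ratC c + ratC d" "ratC (c * d) = ratC c * ratC d" "ratC 0 = 0" "ratC 1 = 1"
  by (simp_all add: ratC_def flip: to_fract_add to_fract_mult one_pCons)

definition ratmon :: "int \<times> int \<Rightarrow> complex \<Rightarrow> ratfun" where
  "ratmon a c = ratC c * ratX powi fst a * ratY powi snd a"

lemma ratmon_mult: "ratmon (a + b) (c * d) = ratmon a c * ratmon b d"
  by (simp add: ratmon_def ratC_hom power_int_add)

lemma ratmon_add: "ratmon a (c + d) = ratmon a c + ratmon a d"
  by (simp add: ratmon_def ratC_hom algebra_simps)

lemma ratmon_0 [simp]: "ratmon a 0 = 0"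
  by (simp add: ratmon_def ratC_hom)

lemma of_int_ratfun: "of_int k = ratC (of_int k)"
proof -
  have "of_nat n = ratC (of_nat n)" for n
    by (induction n) (simp_all add: ratC_hom)
  moreover have "ratC (- c) = - ratC c" for c
    by (simp add: ratC_def flip: to_fract_uminus)
  ultimately show ?thesis
    by (cases k rule: int_cases2) simp_all
qed

lemma Theta_ratmon:
  "Theta1 (ratmon a c) = ratmon a (of_int (fst a) * c)"
  "Theta2 (ratmon a c) = ratmon a (of_int (snd a) * c)"
  by (simp_all add: ratmon_def derivation_mult[OF Theta1_derivation] derivation_mult[OF Theta2_derivation]
      derivation_power_int[OF Theta1_derivation] derivation_power_int[OF Theta2_derivation]
      Theta_generators of_int_ratfun ratC_hom algebra_simps)

lemma ratfun_of_superset: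
  assumes "finite S" "Poly_Mapping.keys p \<subseteq> S"
  shows "ratfun_of p = (\<Sum>a\<in>S. ratmon a (Poly_Mapping.lookup p a))"
  unfolding ratfun_of_def ratmon_def[symmetric]
  using assms by (intro sum.mono_neutral_left) (auto simp: in_keys_iff)

lemma ratfun_of_single: "ratfun_of (Poly_Mapping.single a c) = ratmon a c"
  using ratfun_of_superset[of "{a}" "Poly_Mapping.single a c"] by (auto split: if_splits)

lemma ratfun_of_add: "ratfun_of (p + q) = ratfun_of p + ratfun_of q"
proof -
  let ?S = "Poly_Mapping.keys p \<union> Poly_Mapping.keys q"
  have "ratfun_of (p + q) = (\<Sum>a\<in>?S. ratmon a (Poly_Mapping.lookup (p + q) a))"
    by (rule ratfun_of_superset) (use Poly_Mapping.keys_add[of p q] in auto)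
  also have "\<dots> = ratfun_of p + ratfun_of q"
    by (simp add: ratfun_of_superset[of ?S p] ratfun_of_superset[of ?S q] lookup_add ratmon_add
        sum.distrib)
  finally show ?thesis .
qed

lemma ratfun_of_0 [simp]: "ratfun_of 0 = 0"
  by (simp add: ratfun_of_def)

lemma ratfun_of_diff: "ratfun_of (p - q) = ratfun_of p - ratfun_of q"
  using ratfun_of_add[of "p - q" q] by (simp add: algebra_simps)

lemma ratfun_of_sum: "ratfun_of (\<Sum>i\<in>I. f i) = (\<Sum>i\<in>I. ratfun_of (f i))"
  by (induction I rule: infinite_finite_induct) (simp_all add: ratfun_of_add)

lemma laurent_expansion:
  "(p :: laurent) = (\<Sum>a\<in>Poly_Mapping.keys p. Poly_Mapping.single a (Poly_Mapping.lookup p a))"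
proof (rule poly_mapping_eqI)
  fix k
  have "Poly_Mapping.lookup (\<Sum>a\<in>Poly_Mapping.keys p. Poly_Mapping.single a (Poly_Mapping.lookup p a)) k
      = (\<Sum>a\<in>Poly_Mapping.keys p. if a = k then Poly_Mapping.lookup p k else 0)"
    unfolding lookup_sum by (intro sum.cong) (auto simp: lookup_single when_def)
  also have "\<dots> = Poly_Mapping.lookup p k"
    by (simp add: in_keys_iff)
  finally show "Poly_Mapping.lookup p k = Poly_Mapping.lookup
      (\<Sum>a\<in>Poly_Mapping.keys p. Poly_Mapping.single a (Poly_Mapping.lookup p a)) k" ..
qed

lemma ratfun_of_mult: "ratfun_of (p * q) = ratfun_of p * ratfun_of q"
proof -
  let ?c = "Poly_Mapping.lookup p" and ?d = "Poly_Mapping.lookup q"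
  let ?P = "Poly_Mapping.keys p" and ?Q = "Poly_Mapping.keys q"
  have "p * q = (\<Sum>a\<in>?P. \<Sum>b\<in>?Q. Poly_Mapping.single a (?c a) * Poly_Mapping.single b (?d b))"
    by (subst laurent_expansion[of p], subst laurent_expansion[of q]) (rule sum_product)
  then have "ratfun_of (p * q) = (\<Sum>a\<in>?P. \<Sum>b\<in>?Q. ratmon a (?c a) * ratmon b (?d b))"
    by (simp add: ratfun_of_sum mult_single ratfun_of_single ratmon_mult)
  also have "\<dots> = ratfun_of p * ratfun_of q"
    by (simp add: ratfun_of_superset[of ?P p] ratfun_of_superset[of ?Q q] sum_product)
  finally show ?thesis .
qed

lemma Theta_ratfun_of:
  "Theta1 (ratfun_of p) \<in> range ratfun_of" "Theta2 (ratfun_of p) \<in> range ratfun_of"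
proof -
  have eq: "ratfun_of p = (\<Sum>a\<in>Poly_Mapping.keys p. ratmon a (Poly_Mapping.lookup p a))"
    by (rule ratfun_of_superset) auto
  have "Theta1 (ratfun_of p) = ratfun_of (\<Sum>a\<in>Poly_Mapping.keys p.
      Poly_Mapping.single a (of_int (fst a) * Poly_Mapping.lookup p a))"
    by (simp add: eq derivation_sum[OF Theta1_derivation] Theta_ratmon ratfun_of_sum ratfun_of_single)
  then show "Theta1 (ratfun_of p) \<in> range ratfun_of" by blast
  have "Theta2 (ratfun_of p) = ratfun_of (\<Sum>a\<in>Poly_Mapping.keys p.
      Poly_Mapping.single a (of_int (snd a) * Poly_Mapping.lookup p a))"
    by (simp add: eq derivation_sum[OF Theta2_derivation] Theta_ratmon ratfun_of_sum ratfun_of_single)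
  then show "Theta2 (ratfun_of p) \<in> range ratfun_of" by blast
qed

lemma mu_ratfun_Laurent: "mu_ratfun (ratfun_of p) \<in> range ratfun_of"
proof (cases "ratfun_of p = 0")
  case True
  then have "mu_ratfun (ratfun_of p) = ratfun_of 0" by (simp add: mu_ratfun_def)
  then show ?thesis by blast
next
  case False
  define f where "f = ratfun_of p"
  obtain q1 where q1: "Theta1 f = ratfun_of q1" using Theta_ratfun_of(1)[of p] f_def by auto
  obtain q2 where q2: "Theta2 f = ratfun_of q2" using Theta_ratfun_of(2)[of p] f_def by auto
  obtain q11 where q11: "Theta1 (Theta1 f) = ratfun_of q11" using Theta_ratfun_of(1)[of q1] q1 by auto
  obtain q12 where q12: "Theta1 (Theta2 f) = ratfun_of q12" using Theta_ratfun_of(1)[of q2] q2 by auto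
  obtain q21 where q21: "Theta2 (Theta1 f) = ratfun_of q21" using Theta_ratfun_of(2)[of q1] q1 by auto
  obtain q22 where q22: "Theta2 (Theta2 f) = ratfun_of q22" using Theta_ratfun_of(2)[of q2] q2 by auto
  define A B C E where "A = Theta1 (Theta1 f)" and "B = Theta1 (Theta2 f)"
    and "C = Theta2 (Theta1 f)" and "E = Theta2 (Theta2 f)"
  define g h where "g = Theta1 f" and "h = Theta2 f"
  have f0: "f \<noteq> 0" using False f_def by simp
  note d = derivation_divide[OF Theta1_derivation f0] derivation_divide[OF Theta2_derivation f0]
  have "mu_ratfun f = f ^ 3 * ((A * f - g * g) / f ^ 2 * ((E * f - h * h) / f ^ 2) -
      (B * f - h * g) / f ^ 2 * ((C * f - g * h) / f ^ 2))"
    by (simp add: mu_ratfun_def d A_def B_def C_def E_def g_def h_def)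
  also have "\<dots> = f ^ 3 * (((A * f - g * g) * (E * f - h * h) - (B * f - h * g) * (C * f - g * h)) / f ^ 4)"
    by (simp flip: power_add add: diff_divide_distrib[symmetric])
  also have "(A * f - g * g) * (E * f - h * h) - (B * f - h * g) * (C * f - g * h) =
      f * (f * (A * E - B * C) - (A * h * h + E * g * g - B * g * h - C * g * h))"
    by algebra
  also have "f ^ 3 * (f * (f * (A * E - B * C) - (A * h * h + E * g * g - B * g * h - C * g * h)) / f ^ 4) =
      f * (A * E - B * C) - (A * h * h + E * g * g - B * g * h - C * g * h)"
    using f0 by (simp add: power_def numeral_eq_Suc)
  also have "\<dots> = ratfun_of (p * (q11 * q22 - q12 * q21) -
      (q11 * q2 * q2 + q22 * q1 * q1 - q12 * q1 * q2 - q21 * q1 * q2))"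
    unfolding A_def B_def C_def E_def g_def h_def q1 q2 q11[unfolded q1] q12[unfolded q2]
      q21[unfolded q1] q22[unfolded q2]
    by (simp add: f_def ratfun_of_diff ratfun_of_add ratfun_of_mult)
  finally show ?thesis unfolding f_def by blast
qed

lemma inj_ratfun_of: "inj ratfun_of"
proof (rule injI)
  fix p q assume eq: "ratfun_of p = ratfun_of q"
  define r where "r = p - q"
  let ?K = "Poly_Mapping.keys r" and ?c = "Poly_Mapping.lookup r"
  define N where "N = (\<Sum>a\<in>?K. \<bar>fst a\<bar> + \<bar>snd a\<bar>)"
  have N: "fst a + N \<ge> 0" "snd a + N \<ge> 0" if "a \<in> ?K" for a
  proof -
    have "\<bar>fst a\<bar> + \<bar>snd a\<bar> \<le> N"
      unfolding N_def using that by (intro member_le_sum) auto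
    then show "fst a + N \<ge> 0" "snd a + N \<ge> 0" by linarith+
  qed
  define F where "F = (\<Sum>a\<in>?K. Polynomial.monom (Polynomial.monom (?c a) (nat (fst a + N))) (nat (snd a + N)))"
  have mon: "to_fract (Polynomial.monom (Polynomial.monom c i) j) = ratC c * ratX ^ i * ratY ^ j" for c i j
  proof -
    have "Polynomial.monom (Polynomial.monom c i) j = [:[:c:]:] * [:[:0, 1:]:] ^ i * [:0, 1:] ^ j"
      by (simp add: monom_altdef poly_const_pow smult_smult ac_simps)
    moreover have "to_fract (u ^ n) = to_fract u ^ n" for u :: "complex poly poly" and n
      by (induction n) simp_all
    ultimately show ?thesis by (simp only: to_fract_mult ratC_def ratX_def ratY_def)
  qed
  have tsum: "to_fract (\<Sum>i\<in>I. f i) = (\<Sum>i\<in>I. to_fract (f i))" for I :: "(int \<times> int) set" and f :: "_ \<Rightarrow> complex poly poly"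
    by (induction I rule: infinite_finite_induct) simp_all
  have "to_fract F = (\<Sum>a\<in>?K. ratC (?c a) * ratX powi (fst a + N) * ratY powi (snd a + N))"
    unfolding F_def tsum mon using N by (intro sum.cong refl) (simp add: power_int_def)
  also have "\<dots> = ratfun_of r * ratX powi N * ratY powi N"
    by (simp add: ratfun_of_def sum_distrib_right sum_distrib_left power_int_add ac_simps)
  also have "ratfun_of r = 0"
    using eq by (simp add: r_def ratfun_of_diff)
  finally have F0: "F = 0" by simp
  have "?c a = 0" for a
  proof (rule ccontr)
    assume c: "?c a \<noteq> 0"
    then have a: "a \<in> ?K" by (simp add: in_keys_iff)
    have "coeff (coeff F (nat (snd a + N))) (nat (fst a + N)) = (\<Sum>b\<in>?K. if b = a then ?c a else 0)"
      unfolding F_def coeff_sum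
    proof (intro sum.cong refl)
      fix b assume b: "b \<in> ?K"
      have "nat (snd b + N) = nat (snd a + N) \<and> nat (fst b + N) = nat (fst a + N) \<longleftrightarrow> b = a"
        using N[OF a] N[OF b] by (auto simp: prod_eq_iff)
      then show "coeff (coeff (Polynomial.monom (Polynomial.monom (?c b) (nat (fst b + N)))
          (nat (snd b + N))) (nat (snd a + N))) (nat (fst a + N)) = (if b = a then ?c a else 0)"
        by auto
    qed
    with F0 c a show False by simp
  qed
  then have "r = 0" by (intro poly_mapping_eqI) simp
  then show "p = q" by (simp add: r_def)
qed

lemma ratfun_of_mu: "ratfun_of (mu m0 p) = mu_ratfun (ratfun_of (chi (- m0) * p))"
proof -
  obtain m where m: "mu_ratfun (ratfun_of (chi (- m0) * p)) = ratfun_of m"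
    using mu_ratfun_Laurent[of "chi (- m0) * p"] by auto
  then have "mu m0 p = m"
    unfolding mu_def by (intro the_equality) (auto dest: injD[OF inj_ratfun_of])
  with m show ?thesis by simp
qed

definition real_pt :: "int \<times> int \<Rightarrow> real \<times> real" where
  "real_pt a = (real_of_int (fst a), real_of_int (snd a))"

definition effective_rank_two :: "laurent \<Rightarrow> bool" where
  "effective_rank_two p \<longleftrightarrow>
    span {real_pt (a - b) | a b. a \<in> Poly_Mapping.keys p \<and> b \<in> Poly_Mapping.keys p} = UNIV"

definition zscale :: "int \<Rightarrow> int \<times> int \<Rightarrow> int \<times> int" where
  "zscale k a = (k * fst a, k * snd a)"

global_interpretation Zmod: module zscale
  by unfold_locales (auto simp: zscale_def algebra_simps)

definition is_Z_basis :: "(int \<times> int) set \<Rightarrow> bool" where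
  "is_Z_basis B \<longleftrightarrow> \<not> Zmod.dependent B \<and> Zmod.span B = UNIV"

definition nearest_on_edge ::
    "(int \<times> int) set \<Rightarrow> (real \<times> real) set \<Rightarrow> int \<times> int \<Rightarrow> int \<times> int \<Rightarrow> bool" where
  "nearest_on_edge A e v a \<longleftrightarrow> a \<in> A \<and> a \<noteq> v \<and> real_pt a \<in> e \<and>
    (\<forall>b\<in>A. b \<noteq> v \<and> real_pt b \<in> e \<longrightarrow> dist (real_pt v) (real_pt a) \<le> dist (real_pt v) (real_pt b))"

text \<open>The vertices of the convex hull of a finite set of lattice points are again in that set.\<close>
definition unimodular_support :: "laurent \<Rightarrow> bool" where
  "unimodular_support p \<longleftrightarrow>
    (let A = Poly_Mapping.keys p; P = convex hull (real_pt ` A) in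
      \<forall>v\<in>A. real_pt v extreme_point_of P \<longrightarrow>
        is_Z_basis {a - v | a e. e edge_of P \<and> real_pt v \<in> e \<and> nearest_on_edge A e v a})"

definition lattice_polygon :: "(real \<times> real) set \<Rightarrow> bool" where
  "lattice_polygon P \<longleftrightarrow> (\<exists>V. finite V \<and> P = convex hull (real_pt ` V)) \<and> aff_dim P = 2"

definition primitive_edge_directions :: "(real \<times> real) set \<Rightarrow> real \<times> real \<Rightarrow> (int \<times> int) set" where
  "primitive_edge_directions P v =
    {u. coprime (fst u) (snd u) \<and>
        (\<exists>e t. e edge_of P \<and> v \<in> e \<and> t > 0 \<and> v + t *\<^sub>R real_pt u \<in> e)}"

definition smooth_polygon :: "(real \<times> real) set \<Rightarrow> bool" where
  "smooth_polygon P \<longleftrightarrow> lattice_polygon P \<and>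
    (\<forall>v. v extreme_point_of P \<longrightarrow> is_Z_basis (primitive_edge_directions P v))"

definition positive_coefficients :: "laurent \<Rightarrow> bool" where
  "positive_coefficients p \<longleftrightarrow>
    (\<forall>a\<in>Poly_Mapping.keys p. Poly_Mapping.lookup p a \<in> \<real> \<and> 0 < Re (Poly_Mapping.lookup p a))"

text \<open>
  The pullback of rational functions along the rational map \<open>(f, g)\<close> of the plane to itself, as a
  homomorphism of fields over the complex numbers.  It exists iff the map is dominant, and is then unique.
\<close>
definition is_pullback :: "ratfun \<Rightarrow> ratfun \<Rightarrow> (ratfun \<Rightarrow> ratfun) \<Rightarrow> bool" where
  "is_pullback f g \<phi> \<longleftrightarrow>
    (\<forall>h k. \<phi> (h + k) = \<phi> h + \<phi> k) \<and> (\<forall>h k. \<phi> (h * k) = \<phi> h * \<phi> k) \<and>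
    (\<forall>c. \<phi> (ratC c) = ratC c) \<and> \<phi> ratX = f \<and> \<phi> ratY = g"

text \<open>
  The degree of a dominant rational map is the degree of the extension of function fields given by
  the pullback, i.e. the dimension of the function field of the source as a vector space on which
  the function field of the target acts through the pullback.  Other maps get degree 0.
\<close>
definition rational_map_degree :: "ratfun \<Rightarrow> ratfun \<Rightarrow> nat" where
  "rational_map_degree f g =
    (if \<exists>\<phi>. is_pullback f g \<phi>
     then vector_space.dim (\<lambda>h k. (THE \<phi>. is_pullback f g \<phi>) h * k) (UNIV :: ratfun set)
     else 0)"

definition ml_degree :: "laurent \<Rightarrow> nat" where
  "ml_degree p = rational_map_degree
    (Theta1 (ratfun_of p) / ratfun_of p) (Theta2 (ratfun_of p) / ratfun_of p)"

end

theory Submission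
  imports Defs "HOL-Computational_Algebra.Field_as_Ring"
begin

text \<open>
  At a vertex of a unimodular support, monomial coordinates turn \<open>p\<close> into a polynomial \<open>P\<close> in \<open>x, y\<close>
  with nonzero constant and linear coefficients, and \<open>mu\<close> into the polynomial
  \<open>mu_poly P = P\<^sup>3 det (\<Theta>\<^sub>i \<Theta>\<^sub>j log P)\<close>, all of whose prime factors except \<open>x\<close> and \<open>y\<close> divide \<open>P\<close>.
  Restricting to the edge \<open>y = 0\<close>, whose polynomial has degree \<open>l\<close>, this forces
  \<open>P(x, 0) = c (x - z)\<^sup>l\<close> and \<open>P\<^sub>y(x, 0) = c' (x - z)\<^bsup>l - d\<^esup>\<close>, where \<open>(-d, 1)\<close> is the direction
  of the next edge.  A prime factor \<open>f\<close> of multiplicity \<open>m\<close> in \<open>P\<close> has multiplicity \<open>3m - 3\<close> in \<open>mu_poly P\<close>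
  unless its logarithmic Gauss map is constant, which for a factor meeting the edge means \<open>f = x - z\<close> up to a
  unit.  Comparing orders at \<open>z\<close> gives \<open>2 + d = 3a\<close> if \<open>x - z\<close> does not divide \<open>P\<close>, with \<open>a > 0\<close> the
  order at \<open>z\<close>, on the edge, of the product of the distinct prime factors of \<open>P\<close>, and \<open>d = 3a\<close>, where \<open>a \<ge> 0\<close> now
  omits the factor \<open>x - z\<close>, if both \<open>x - z\<close> and \<open>y - z'\<close> divide \<open>P\<close>.  Convexity then leaves
  only powers of an affine linear form and products \<open>(x - z)\<^sup>k (y - z')\<^sup>l\<close>, for which the
  logarithmic gradient is birational.

  For the converse, \<open>p = (1 + x) (1 + x + y)\<close> has a birational logarithmic gradient, but \<open>mu\<close> vanishes at
  \<open>(1, -4)\<close>, where \<open>p = -4\<close>.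
\<close>

section \<open>Euler operators and logarithmic Hessians of bivariate polynomials\<close>

text \<open>Since mu is p^3 times the Jacobian determinant of the logarithmic gradient, the
  hypothesis says that this map has no critical points in the torus off the curve p = 0. One edge
  sees enough of this: \<open>mu_poly P\<close> vanishes on y = 0, and its y-coefficient has order
  (l - d) + 2 (l - 1) at z, the first summand from \<open>coeff P 1\<close> and the second from the
  logarithmic Hessian of \<open>coeff P 0\<close>. The prime factors of P through (z, 0) account for
  the same order as 3l - 3a, or as 3l - 2 - 3a when x - z is among them; equating gives the
  relations for d. Now let the two edges at the vertex have lengths l, l' and numbers d, d'. If d
  and d' are positive, the far ends of the edges give d l' <= l and d' l <= l', so d = d' = 1;
  otherwise d = d' = 0. At these extreme values a single prime factor carries the whole edge
  polynomial. A birational map can still have critical points, because it can contract a curve. The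
  logarithmic gradient of (1 + x) (1 + x + y) contracts 2 + 2x + y = 0 to the point (0, 2), and 2 +
  2x + y is the factor of mu that does not divide p.\<close>

type_synonym bipoly = "complex poly poly"

definition theta_x :: "bipoly \<Rightarrow> bipoly" where
  "theta_x P = [:[:0, 1:]:] * map_poly pderiv P"

definition theta_y :: "bipoly \<Rightarrow> bipoly" where
  "theta_y P = [:0, 1:] * pderiv P"

lemma coeff_theta_x: "coeff (theta_x P) n = [:0, 1:] * pderiv (coeff P n)"
  by (simp add: theta_x_def coeff_map_poly)

lemma coeff_theta_y: "coeff (theta_y P) n = of_nat n * coeff P n"
  by (cases n) (simp_all add: theta_y_def coeff_pCons coeff_pderiv)

lemma theta_x_add: "theta_x (P + Q) = theta_x P + theta_x Q"
  by (simp add: theta_x_def map_poly_pderiv_add smult_add_right)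

lemma theta_y_add: "theta_y (P + Q) = theta_y P + theta_y Q"
  by (simp add: theta_y_def pderiv_add algebra_simps)

lemma theta_x_mult: "theta_x (P * Q) = theta_x P * Q + P * theta_x Q"
  by (simp add: theta_x_def map_poly_pderiv_mult algebra_simps)

lemma theta_y_mult: "theta_y (P * Q) = theta_y P * Q + P * theta_y Q"
  by (simp add: theta_y_def pderiv_mult algebra_simps)

lemma theta_x_diff: "theta_x (P - Q) = theta_x P - theta_x Q" and theta_y_diff: "theta_y (P - Q) = theta_y P - theta_y Q"
  by (rule poly_eqI; simp add: coeff_theta_x coeff_theta_y pderiv_diff algebra_simps)+

lemma theta_y_theta_x: "theta_y (theta_x P) = theta_x (theta_y P)"
  by (rule poly_eqI) (simp add: coeff_theta_x coeff_theta_y pderiv_mult of_nat_poly pderiv_smult)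

lemma theta_x_const [simp]: "theta_x [:c:] = [:[:0, 1:] * pderiv c:]"
  by (rule poly_eqI) (simp add: coeff_theta_x coeff_pCons split: nat.split)

lemma theta_y_const [simp]: "theta_y [:c:] = 0"
  by (simp add: theta_y_def pderiv_pCons)

lemma theta_x_0 [simp]: "theta_x 0 = 0" and theta_y_0 [simp]: "theta_y 0 = 0"
  by (simp_all add: theta_x_def theta_y_def)

lemma theta_x_1 [simp]: "theta_x 1 = 0" and theta_y_1 [simp]: "theta_y 1 = 0"
  by (simp_all add: theta_x_def theta_y_def)

text \<open>The entries of the Hessian of log P in the Euler derivatives, multiplied by P^2.\<close>

definition log_hess11 :: "bipoly \<Rightarrow> bipoly" where
  "log_hess11 P = P * theta_x (theta_x P) - theta_x P * theta_x P"
definition log_hess12 :: "bipoly \<Rightarrow> bipoly" where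
  "log_hess12 P = P * theta_x (theta_y P) - theta_x P * theta_y P"
definition log_hess22 :: "bipoly \<Rightarrow> bipoly" where
  "log_hess22 P = P * theta_y (theta_y P) - theta_y P * theta_y P"

lemmas log_hess_defs = log_hess11_def log_hess12_def log_hess22_def

text \<open>Minus the determinant of the Hessian bordered by the gradient. Modulo P it measures how
  the logarithmic Gauss map varies along the curve P = 0.\<close>

definition bordered_hess :: "bipoly \<Rightarrow> bipoly" where
  "bordered_hess P = theta_x (theta_x P) * (theta_y P)\<^sup>2 + theta_y (theta_y P) * (theta_x P)\<^sup>2 - 2 * theta_x (theta_y P) * theta_x P * theta_y P"

definition mu_poly :: "bipoly \<Rightarrow> bipoly" where
  "mu_poly P = P * (theta_x (theta_x P) * theta_y (theta_y P) - (theta_x (theta_y P))\<^sup>2) - bordered_hess P"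

text \<open>The quartic terms in the first derivatives cancel in the determinant, so one factor P
  splits off. Through this identity the additivity of log P under products reaches
  \<open>mu_poly\<close>.\<close>

lemma mult_mu_poly: "P * mu_poly P = log_hess11 P * log_hess22 P - (log_hess12 P)\<^sup>2"
  unfolding mu_poly_def bordered_hess_def log_hess_defs by algebra

text \<open>This is log (P Q) = log P + log Q, with denominators cleared.\<close>

lemma log_hess_mult:
  "log_hess11 (P * Q) = Q\<^sup>2 * log_hess11 P + P\<^sup>2 * log_hess11 Q"
  "log_hess12 (P * Q) = Q\<^sup>2 * log_hess12 P + P\<^sup>2 * log_hess12 Q"
  "log_hess22 (P * Q) = Q\<^sup>2 * log_hess22 P + P\<^sup>2 * log_hess22 Q"
  unfolding log_hess_defs theta_x_mult theta_y_mult theta_x_add theta_y_add theta_y_theta_x by algebra+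

lemma log_hess_power:
  "log_hess11 (P ^ Suc n) = of_nat (Suc n) * P ^ (2 * n) * log_hess11 P"
  "log_hess12 (P ^ Suc n) = of_nat (Suc n) * P ^ (2 * n) * log_hess12 P"
  "log_hess22 (P ^ Suc n) = of_nat (Suc n) * P ^ (2 * n) * log_hess22 P"
proof (induction n)
  case 0
  { case 1 show ?case by simp next case 2 show ?case by simp next case 3 show ?case by simp }
next
  case (Suc n)
  have *: "(P ^ Suc n)\<^sup>2 = P ^ (2 * Suc n)" "P ^ (2 * Suc n) = P\<^sup>2 * P ^ (2 * n)"
    by (simp_all add: power2_eq_square power_add mult_2)
  { case 1 show ?case
      by (subst power_Suc2, unfold log_hess_mult Suc *) (simp add: algebra_simps)
  next case 2 show ?case
      by (subst power_Suc2, unfold log_hess_mult Suc *) (simp add: algebra_simps)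
  next case 3 show ?case
      by (subst power_Suc2, unfold log_hess_mult Suc *) (simp add: algebra_simps) }
qed

text \<open>The polarization of the determinant, that is, the cross term in det (A + B).\<close>

definition mixed_hess :: "bipoly \<Rightarrow> bipoly \<Rightarrow> bipoly" where
  "mixed_hess f g = log_hess11 f * log_hess22 g + log_hess22 f * log_hess11 g
     - 2 * log_hess12 f * log_hess12 g"

text \<open>Expand the determinant of (n + 1) Hess log f + Hess log g. Only the first summand of the
  bracket lacks an explicit factor f, so a prime f not dividing g has multiplicity exactly 3n unless
  it divides \<open>mu_poly f\<close>.\<close>

lemma mu_poly_power_mult:
  assumes f: "f \<noteq> 0"
  shows "g * mu_poly (f ^ Suc n * g) = f ^ (3 * n) *
    (of_nat (Suc n) ^ 2 * g ^ 4 * mu_poly f + of_nat (Suc n) * g\<^sup>2 * f * mixed_hess f g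
      + f ^ 3 * g * mu_poly g)" (is "?L = f ^ (3 * n) * ?R")
proof -
  define A where "A = f ^ (2 * n)"
  define m :: bipoly where "m = of_nat (Suc n)"
  have A2: "(f ^ Suc n)\<^sup>2 = f\<^sup>2 * A"
    by (simp add: A_def power2_eq_square mult_2 power_add)
  have "f ^ Suc n * ?L = (f ^ Suc n * g) * mu_poly (f ^ Suc n * g)"
    by (simp add: mult_ac)
  also have "\<dots> = (g\<^sup>2 * (m * A * log_hess11 f) + f\<^sup>2 * A * log_hess11 g) *
      (g\<^sup>2 * (m * A * log_hess22 f) + f\<^sup>2 * A * log_hess22 g) -
      (g\<^sup>2 * (m * A * log_hess12 f) + f\<^sup>2 * A * log_hess12 g)\<^sup>2"
    unfolding mult_mu_poly log_hess_mult log_hess_power A2 A_def[symmetric] m_def by simp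
  also have "\<dots> = A\<^sup>2 * (m\<^sup>2 * g ^ 4 * (f * mu_poly f) + m * g\<^sup>2 * f\<^sup>2 * mixed_hess f g
      + f ^ 4 * (g * mu_poly g))"
    unfolding mult_mu_poly mixed_hess_def by algebra
  also have "\<dots> = A\<^sup>2 * f * ?R"
    unfolding m_def by algebra
  also have "A\<^sup>2 * f = f ^ Suc n * f ^ (3 * n)"
    by (simp add: A_def flip: power_mult power_add power_Suc) (simp add: algebra_simps)
  finally show ?thesis using f by (simp add: mult.assoc)
qed

section \<open>Logarithmic Hessians in one variable\<close>

lemma poly_single_root:
  fixes q :: "complex poly"
  assumes "q \<noteq> 0" and roots: "\<And>\<zeta>. poly q \<zeta> = 0 \<Longrightarrow> \<zeta> = z"
  obtains c where "c \<noteq> 0" "q = smult c ([:-z, 1:] ^ degree q)"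
proof -
  obtain h where q: "q = [:-z, 1:] ^ order z q * h" and h: "\<not> [:-z, 1:] dvd h"
    using order_decomp[OF assms(1)] by blast
  have hz: "poly h z \<noteq> 0" using h by (simp add: poly_eq_0_iff_dvd)
  have "poly h \<zeta> \<noteq> 0" for \<zeta>
  proof
    assume "poly h \<zeta> = 0"
    then have "poly q \<zeta> = 0" by (subst q) simp
    with roots hz \<open>poly h \<zeta> = 0\<close> show False by auto
  qed
  then have "constant (poly h)" using fundamental_theorem_of_algebra by blast
  then have "degree h = 0" by (simp add: constant_degree)
  then obtain c where c: "h = [:c:]" using degree_eq_zeroE by blast
  then have c0: "c \<noteq> 0" using hz by auto
  have q': "q = smult c ([:-z, 1:] ^ order z q)" by (subst q) (simp add: c)
  have "degree q = degree (smult c ([:-z, 1:] ^ order z q))" using q' by (rule arg_cong)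
  also have "\<dots> = order z q" using c0 by (simp add: degree_linear_power)
  finally have deg: "degree q = order z q" .
  have "q = smult c ([:-z, 1:] ^ degree q)" unfolding deg by (rule q')
  with c0 show ?thesis by (rule that)
qed

definition theta :: "complex poly \<Rightarrow> complex poly" where
  "theta c = [:0, 1:] * pderiv c"

text \<open>In lowest terms q'/q = S/R with R squarefree, and applying the Euler derivative to x S/R
  gives x W / R^2. At a nonzero root zeta of q only the term - zeta S R' of W survives, and it is
  nonzero because R has simple roots and is coprime to S.\<close>

lemma log_hess_univ:
  fixes q :: "complex poly"
  assumes "pderiv q \<noteq> 0"
  obtains g R S W where "q = g * R" "pderiv q = g * S"
    "W = R * S + [:0, 1:] * (R * pderiv S - S * pderiv R)"
    "q * theta (theta q) - (theta q)\<^sup>2 = [:0, 1:] * (g\<^sup>2 * W)"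
    "\<And>\<zeta>. poly q \<zeta> = 0 \<Longrightarrow> \<zeta> \<noteq> 0 \<Longrightarrow> poly W \<zeta> \<noteq> 0" "\<And>\<zeta>. poly R \<zeta> = 0 \<longleftrightarrow> poly q \<zeta> = 0"
proof -
  define g where "g = gcd q (pderiv q)"
  obtain R where R: "q = g * R" unfolding g_def by (meson dvdE gcd_dvd1)
  obtain S where S: "pderiv q = g * S" unfolding g_def by (meson dvdE gcd_dvd2)
  define r s where "r = fst (bezout_coefficients q (pderiv q))"
    and "s = snd (bezout_coefficients q (pderiv q))"
  have rs: "g = r * q + s * pderiv q"
    unfolding g_def r_def s_def by (simp add: bezout_coefficients_fst_snd)
  have g0: "g \<noteq> 0" using assms by (auto simp: g_def)
  have dec: "rsquarefree R \<and> (\<forall>a. poly R a = 0 \<longleftrightarrow> poly q a = 0)"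
    by (rule poly_squarefree_decomp[OF assms R[unfolded mult.commute[of g]] S[unfolded mult.commute[of g]] rs])
  have "g * 1 = r * (g * R) + s * (g * S)" unfolding R[symmetric] S[symmetric] mult_1_right by (rule rs)
  also have "\<dots> = g * (r * R + s * S)" by (simp add: algebra_simps)
  finally have bez: "r * R + s * S = 1" using g0 by (metis mult_cancel_left)
  define W where "W = R * S + [:0, 1:] * (R * pderiv S - S * pderiv R)"
  have e: "pderiv g * R = g * S - g * pderiv R"
    using S R by (simp add: pderiv_mult algebra_simps)
  have "q * theta (theta q) - (theta q)\<^sup>2 =
     [:0,1:] * (q * (pderiv q + [:0,1:] * pderiv (pderiv q)) - [:0,1:] * (pderiv q)\<^sup>2)"
    by (simp add: theta_def pderiv_mult pderiv_pCons power2_eq_square algebra_simps del: mult_pCons_left mult_pCons_right flip: one_pCons)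
  also have "q * (pderiv q + [:0,1:] * pderiv (pderiv q)) - [:0,1:] * (pderiv q)\<^sup>2 = 
     g * (R * (g * S) + [:0,1:] * (S * (pderiv g * R) + g * R * pderiv S) - [:0,1:] * g * S\<^sup>2)"
    unfolding S by (subst R) (simp add: pderiv_mult power2_eq_square algebra_simps del: mult_pCons_left mult_pCons_right)
  also have "\<dots> = g\<^sup>2 * W"
    unfolding e W_def by (simp add: power2_eq_square algebra_simps del: mult_pCons_left mult_pCons_right)
  finally have main: "q * theta (theta q) - (theta q)\<^sup>2 = [:0, 1:] * (g\<^sup>2 * W)" .
  have "poly W \<zeta> \<noteq> 0" if "poly q \<zeta> = 0" "\<zeta> \<noteq> 0" for \<zeta>
  proof -
    have R0: "poly R \<zeta> = 0" using dec that by blast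
    then have "poly (pderiv R) \<zeta> \<noteq> 0" using dec by (meson rsquarefree_roots)
    moreover have "poly S \<zeta> \<noteq> 0" using arg_cong[OF bez, of "\<lambda>p. poly p \<zeta>"] R0 by auto
    ultimately show ?thesis using R0 that by (simp add: W_def)
  qed
  moreover have "poly R \<zeta> = 0 \<longleftrightarrow> poly q \<zeta> = 0" for \<zeta> using dec by blast
  ultimately show ?thesis by (rule that[OF R S W_def main])
qed

text \<open>The second logarithmic Euler derivative vanishes only for monomials, which a nonzero
  root excludes.\<close>

lemma log_hess_univ_nonzero:
  fixes q :: "complex poly"
  assumes "q \<noteq> 0" "poly q \<zeta> = 0" "\<zeta> \<noteq> 0"
  shows "q * theta (theta q) - (theta q)\<^sup>2 \<noteq> 0"
proof -
  have "pderiv q \<noteq> 0"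
  proof
    assume "pderiv q = 0"
    then have "degree q = 0" by (simp add: pderiv_eq_0_iff)
    then obtain c where "q = [:c:]" using degree_eq_zeroE by blast
    with assms(1,2) show False by simp
  qed
  then show ?thesis
  proof (rule log_hess_univ)
    fix g R S W
    assume gR: "q = g * R" and eq: "q * theta (theta q) - (theta q)\<^sup>2 = [:0, 1:] * (g\<^sup>2 * W)"
      and W: "\<And>\<zeta>. poly q \<zeta> = 0 \<Longrightarrow> \<zeta> \<noteq> 0 \<Longrightarrow> poly W \<zeta> \<noteq> 0"
    have "g \<noteq> 0" using gR assms(1) by auto
    moreover have "W \<noteq> 0" using W[OF assms(2,3)] by auto
    ultimately show ?thesis unfolding eq by simp
  qed
qed

text \<open>The hypotheses leave no root for W, so W is a constant w. With u = x S it is the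
  Wronskian u' R - u R'; differentiating gives u'' R = u R'', hence R divides w R''. By degrees R''
  = 0, so R is linear and q has only one root.\<close>

lemma log_hess_univ_single_root:
  fixes q Q :: "complex poly"
  assumes deg: "degree q > 0" and q0: "poly q 0 \<noteq> 0" and Q0: "poly Q 0 \<noteq> 0"
    and Q: "q * theta (theta q) - (theta q)\<^sup>2 = [:0, 1:] * Q"
    and roots: "\<And>\<zeta>. \<zeta> \<noteq> 0 \<Longrightarrow> poly Q \<zeta> = 0 \<Longrightarrow> poly q \<zeta> = 0"
  obtains z c where "z \<noteq> 0" "c \<noteq> 0" "q = smult c ([:-z, 1:] ^ degree q)"
    "order z Q = 2 * (degree q - 1)"
proof -
  have pq: "pderiv q \<noteq> 0" using deg by (simp add: pderiv_eq_0_iff)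
  obtain g R S W where gR: "q = g * R" and gS: "pderiv q = g * S"
    and W: "W = R * S + [:0, 1:] * (R * pderiv S - S * pderiv R)"
    and eq: "q * theta (theta q) - (theta q)\<^sup>2 = [:0, 1:] * (g\<^sup>2 * W)"
    and W0: "\<And>\<zeta>. poly q \<zeta> = 0 \<Longrightarrow> \<zeta> \<noteq> 0 \<Longrightarrow> poly W \<zeta> \<noteq> 0"
    and Rq: "\<And>\<zeta>. poly R \<zeta> = 0 \<longleftrightarrow> poly q \<zeta> = 0"
    by (rule log_hess_univ[OF pq]) (rule that)
  have Qe: "Q = g\<^sup>2 * W" using Q eq by simp
  have "poly W \<zeta> \<noteq> 0" for \<zeta>
  proof
    assume *: "poly W \<zeta> = 0"
    then have "poly Q \<zeta> = 0" by (simp add: Qe)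
    with Q0 have "\<zeta> \<noteq> 0" by auto
    with roots \<open>poly Q \<zeta> = 0\<close> W0 * show False by blast
  qed
  then have "constant (poly W)" using fundamental_theorem_of_algebra by blast
  then have dW: "degree W = 0" by (simp add: constant_degree)
  then obtain w where w: "W = [:w:]" using degree_eq_zeroE by blast
  have w0: "w \<noteq> 0" using \<open>\<And>\<zeta>. poly W \<zeta> \<noteq> 0\<close> w by auto
  define u where "u = [:0, 1:] * S"
  have uW: "pderiv u * R - u * pderiv R = [:w:]"
    unfolding w[symmetric] W u_def
    by (simp add: pderiv_mult pderiv_pCons algebra_simps del: mult_pCons_left mult_pCons_right flip: one_pCons)
  have "pderiv (pderiv u) * R - u * pderiv (pderiv R) = pderiv (pderiv u * R - u * pderiv R)"
    by (simp add: pderiv_diff pderiv_mult)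
  also have "\<dots> = 0" unfolding uW by (simp add: pderiv_pCons)
  finally have u2: "u * pderiv (pderiv R) = pderiv (pderiv u) * R" by simp
  have "[:w:] * pderiv (pderiv R) = (pderiv u * R - u * pderiv R) * pderiv (pderiv R)"
    by (simp only: uW)
  also have "\<dots> = pderiv u * R * pderiv (pderiv R) - pderiv R * (u * pderiv (pderiv R))"
    by (simp add: algebra_simps)
  also have "\<dots> = R * (pderiv u * pderiv (pderiv R) - pderiv R * pderiv (pderiv u))"
    by (simp add: u2 right_diff_distrib mult.left_commute)
  finally have "smult w (pderiv (pderiv R)) = R * (pderiv u * pderiv (pderiv R) - pderiv R * pderiv (pderiv u))"
    by simp
  then have "R dvd smult w (pderiv (pderiv R))" by (rule dvdI)
  then have Rd: "R dvd pderiv (pderiv R)" using w0 by (simp add: dvd_smult_iff)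
  have R0: "R \<noteq> 0" using gR deg by auto
  have "pderiv (pderiv R) = 0"
  proof (rule ccontr)
    assume n: "pderiv (pderiv R) \<noteq> 0"
    then have "degree R \<le> degree (pderiv (pderiv R))" using Rd by (simp add: dvd_imp_degree_le)
    moreover have "degree R \<noteq> 0" using n by (metis pderiv_eq_0_iff pderiv_0)
    ultimately show False by (simp add: degree_pderiv)
  qed
  then have dR: "degree R \<le> 1" by (simp add: pderiv_eq_0_iff degree_pderiv)
  obtain z where z: "poly q z = 0"
    using fundamental_theorem_of_algebra[of q] deg constant_degree[of q] by auto
  then have z0: "z \<noteq> 0" using q0 by auto
  have Rz: "poly R z = 0" using z Rq by simp
  then obtain R' where R': "R = [:-z, 1:] * R'" by (auto simp: poly_eq_0_iff_dvd)
  have "R' \<noteq> 0" using R' R0 by auto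
  then have dR': "degree R = Suc (degree R')" unfolding R' by (subst degree_mult_eq) auto
  then have "degree R' = 0" using dR by simp
  then obtain c' where "R' = [:c':]" using degree_eq_zeroE by blast
  then have "poly R \<zeta> = 0 \<Longrightarrow> \<zeta> = z" for \<zeta> using R' R0 by auto
  then have only: "poly q \<zeta> = 0 \<Longrightarrow> \<zeta> = z" for \<zeta> using Rq by blast
  have q00: "q \<noteq> 0" using deg by auto
  obtain c where c: "c \<noteq> 0" "q = smult c ([:-z, 1:] ^ degree q)"
    using poly_single_root[OF q00 only] by blast
  have g0: "g \<noteq> 0" using gR q00 by auto
  have "poly g \<zeta> = 0 \<Longrightarrow> \<zeta> = z" for \<zeta> using only gR by auto
  then obtain b where b: "b \<noteq> 0" "g = smult b ([:-z, 1:] ^ degree g)"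
    using poly_single_root[OF g0] by blast
  have dg: "degree g = degree q - 1"
    using gR g0 R0 dR' \<open>degree R' = 0\<close> by (simp add: degree_mult_eq)
  have "order z g = degree g" by (subst b(2)) (simp add: order_smult b(1) order_power_n_n)
  moreover have "order z W = 0" using w w0 by (simp add: order_0I)
  moreover have "g\<^sup>2 * W \<noteq> 0" using g0 w0 w by simp
  ultimately have "order z Q = 2 * (degree q - 1)"
    unfolding Qe by (simp add: order_mult power2_eq_square dg)
  then show ?thesis by (rule that[OF z0 c])
qed

section \<open>The bordered Hessian of a prime polynomial\<close>

text \<open>A Bezout identity over the fraction field of the coefficients, with denominators
  cleared. A nonconstant element of least degree in the ideal of f and g would divide constant
  multiples of both, which the primality of f excludes.\<close>

lemma prime_elem_coprime_combination:
  fixes f g :: "'a :: idom poly"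
  assumes f: "prime_elem f" and deg: "degree f > 0" and fg: "\<not> f dvd g"
  obtains a b h where "a * f + b * g = [:h:]" "h \<noteq> 0"
proof -
  define I where "I = {a * f + b * g | a b. True}"
  have I_f: "f \<in> I" and I_g: "g \<in> I"
    unfolding I_def mem_Collect_eq
    by (rule exI[of _ 1], rule exI[of _ 0], simp) (rule exI[of _ 0], rule exI[of _ 1], simp)
  have I_lin: "r * u - w * s \<in> I" if "u \<in> I" "w \<in> I" for u w r s
  proof -
    from that obtain a b a' b' where "u = a * f + b * g" "w = a' * f + b' * g" by (auto simp: I_def)
    then have "r * u - w * s = (r * a - a' * s) * f + (r * b - b' * s) * g"
      by (simp add: algebra_simps)
    then show ?thesis by (auto simp: I_def)
  qed
  have f0: "f \<noteq> 0" using f by auto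
  define w where "w = arg_min degree (\<lambda>u. u \<in> I \<and> u \<noteq> 0)"
  have w: "w \<in> I" "w \<noteq> 0" and min: "\<And>u. u \<in> I \<Longrightarrow> u \<noteq> 0 \<Longrightarrow> degree w \<le> degree u"
    using arg_min_nat_lemma[of "\<lambda>u. u \<in> I \<and> u \<noteq> 0" f degree] I_f f0 unfolding w_def by auto
  \<comment> \<open>Pseudo-remainders by \<open>w\<close> stay in the ideal and have smaller degree,
    so minimality makes them zero.\<close>
  have ps: "\<exists>l s. l \<noteq> 0 \<and> smult l u = w * s" if u: "u \<in> I" for u
  proof -
    obtain l s where l: "l \<noteq> 0" "smult l u = w * s + pseudo_mod u w"
      using pseudo_mod(1)[OF w(2)] by blast
    have "pseudo_mod u w = [:l:] * u - w * s" using l by simp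
    then have "pseudo_mod u w \<in> I" using I_lin[OF u w(1)] by metis
    then have "pseudo_mod u w = 0" using pseudo_mod(2)[OF w(2), of u] min by fastforce
    then show ?thesis using l by auto
  qed
  have "degree w = 0"
  proof (rule ccontr)
    assume dw: "degree w \<noteq> 0"
    obtain l s where ls: "l \<noteq> 0" "smult l f = w * s" using ps I_f by blast
    obtain l' s' where ls': "l' \<noteq> 0" "smult l' g = w * s'" using ps I_g by blast
    have "f dvd w * s" by (metis ls(2) dvd_smult dvd_refl)
    then consider "f dvd w" | "f dvd s" using f by (meson prime_elem_dvd_mult_iff)
    then show False
    proof cases
      case 1
      then have "f dvd [:l':] * g" using ls' by (simp add: dvd_mult2)
      then have "f dvd [:l':]" using f fg by (meson prime_elem_dvd_mult_iff)
      then have "degree f \<le> 0" using ls' dvd_imp_degree_le[of f "[:l':]"] by simp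
      then show False using deg by simp
    next
      case 2
      then obtain t where "s = f * t" by blast
      then have "f * [:l:] = f * (w * t)" using ls by (simp add: algebra_simps)
      then have "[:l:] = w * t" using f0 by (metis mult_cancel_left)
      then have "w dvd [:l:]" by simp
      then have "degree w \<le> 0" using ls dvd_imp_degree_le[of w "[:l:]"] by simp
      then show False using dw by simp
    qed
  qed
  then obtain h where "w = [:h:]" using degree_eq_zeroE by blast
  moreover from this w have "h \<noteq> 0" by auto
  moreover from calculation(1) w(1) obtain a b where "a * f + b * g = [:h:]" unfolding I_def by auto
  ultimately show ?thesis using that by blast
qed

text \<open>With E the evaluation at a point of a curve and D a tangent field of the curve, this
  says that u has contact of order greater than n with the curve at that point.\<close>

primrec jet_vanishes :: "('a \<Rightarrow> 'a) \<Rightarrow> ('a \<Rightarrow> 'b :: zero) \<Rightarrow> nat \<Rightarrow> 'a \<Rightarrow> bool" where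
  "jet_vanishes D E 0 u \<longleftrightarrow> E u = 0"
| "jet_vanishes D E (Suc n) u \<longleftrightarrow> E u = 0 \<and> jet_vanishes D E n (D u)"

locale derivation_at_point =
  fixes D :: "'a :: comm_ring_1 \<Rightarrow> 'a" and E :: "'a \<Rightarrow> 'b :: idom"
  assumes D_add: "D (u + v) = D u + D v" and D_mult: "D (u * v) = D u * v + u * D v"
    and E_add: "E (u + v) = E u + E v" and E_mult: "E (u * v) = E u * E v"
begin

abbreviation "J \<equiv> jet_vanishes D E"

lemma J_Suc: "J (Suc n) u \<Longrightarrow> J n u"
  by (induction n arbitrary: u) auto

lemma J_add: "J n u \<Longrightarrow> J n v \<Longrightarrow> J n (u + v)"
  by (induction n arbitrary: u v) (auto simp: D_add E_add)

lemma J_mult: "J n u \<Longrightarrow> J n (u * v)"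
proof (induction n arbitrary: u v)
  case (Suc n)
  then show ?case using J_Suc[OF Suc.prems] by (auto simp: D_mult E_mult intro!: J_add)
qed (simp add: E_mult)

text \<open>A factor that is invertible at the point does not affect the order of contact: by
  Leibniz a D u = D (a u) - u D a, and u is handled one order lower.\<close>

lemma J_cancel: "J n (a * u) \<Longrightarrow> E a \<noteq> 0 \<Longrightarrow> J n u"
proof (induction n arbitrary: u)
  case (Suc n)
  have u: "J n u" using Suc J_Suc by blast
  have "J n (D (a * u) + u * (- D a))" using Suc.prems u by (intro J_add J_mult) auto
  then have "J n (a * D u)" by (simp add: D_mult mult.commute)
  with Suc show ?case by (simp add: E_mult)
qed (simp add: E_mult)

end

lemma poly_poly_const: "poly (poly (u :: bipoly) [:y:]) x = poly (map_poly (\<lambda>c. poly c x) u) y"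
  by (induction u) (simp_all add: map_poly_pCons)

lemma exists_non_root:
  fixes p :: "complex poly" assumes "p \<noteq> 0" obtains x where "poly p x \<noteq> 0"
  using assms poly_roots_finite[of p] infinite_UNIV_char_0 by (metis (no_types, lifting) Collect_cong UNIV_def poly_all_0_iff_0)

text \<open>
  If \<open>f\<close> divided its bordered Hessian, its logarithmic Gauss map \<open>theta_x f / theta_y f\<close> would be constant
  along the curve \<open>f = 0\<close>.  The argument takes a point of the curve where \<open>theta_y f\<close> does not vanish and
  shows that all derivatives along the curve of \<open>theta_x f - lam * theta_y f\<close> vanish there; an eliminant in \<open>x\<close>
  of this function and \<open>f\<close> would then vanish to infinite order.
\<close>
lemma not_dvd_bordered_hess:
  assumes f: "prime_elem f" and deg: "degree f > 0"
    and c0: "degree (coeff f 0) > 0" "poly (coeff f 0) 0 \<noteq> 0"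
  shows "\<not> f dvd bordered_hess f"
proof
  assume "f dvd bordered_hess f"
  then obtain z where z: "bordered_hess f = f * z" by blast
  have f0: "f \<noteq> 0" using f by auto
  have nu: "\<not> f dvd 1" using f by (simp add: prime_elem_not_unit)
  have "\<not> f dvd [:0, 1:]"
  proof
    assume "f dvd [:0, 1:]"
    then obtain k where k: "[:0, 1:] = f * k" by blast
    have "coeff f 0 * coeff k 0 = 0" using arg_cong[OF k, of "\<lambda>u. coeff u 0"] by (simp add: coeff_mult)
    then have "coeff k 0 = 0" using c0 by auto
    then obtain k' where "k = [:0, 1:] * k'" by (cases k) auto
    then have "[:0, 1:] * (f * k') = [:0, 1:] * 1" using k by (simp add: algebra_simps)
    then have "f * k' = 1" by (metis mult_cancel_left pCons_eq_0_iff zero_neq_one)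
    then show False using nu by (metis dvd_triv_left)
  qed
  moreover have "\<not> f dvd pderiv f"
  proof
    assume "f dvd pderiv f"
    moreover have "pderiv f \<noteq> 0" using deg by (simp add: pderiv_eq_0_iff)
    ultimately have "degree f \<le> degree (pderiv f)" by (simp add: dvd_imp_degree_le)
    then show False using deg by (simp add: degree_pderiv)
  qed
  ultimately have "\<not> f dvd theta_y f" unfolding theta_y_def using f by (meson prime_elem_dvd_mult_iff)
  then obtain a b h where abh: "a * f + b * theta_y f = [:h:]" "h \<noteq> 0"
    using prime_elem_coprime_combination[OF f deg] by metis
  \<comment> \<open>The eliminant h keeps \<open>theta_y f\<close> nonzero at every point of the
    curve above x, the leading coefficient guarantees that there is such a point, and x different
    from 0 makes D act nontrivially on functions of x.\<close>
  have "h * lead_coeff f * coeff f 0 * [:0, 1:] \<noteq> 0" using abh f0 c0 by auto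
  then obtain x where "poly (h * lead_coeff f * coeff f 0 * [:0, 1:]) x \<noteq> 0"
    using exists_non_root by blast
  then have x: "poly h x \<noteq> 0" "poly (lead_coeff f) x \<noteq> 0" "poly (coeff f 0) x \<noteq> 0" "x \<noteq> 0" by auto
  let ?F = "map_poly (\<lambda>c. poly c x) f"
  have "coeff ?F (degree f) \<noteq> 0" using x by (simp add: coeff_map_poly)
  then have "degree ?F > 0" using deg by (metis le_degree gr0I le_zero_eq less_numeral_extra(3))
  then obtain y where y: "poly ?F y = 0"
    using fundamental_theorem_of_algebra[of ?F] constant_degree[of ?F] by auto
  define E where "E = (\<lambda>u :: bipoly. poly (poly u [:y:]) x)"
  have E_hom: "E (u + v) = E u + E v" "E (u * v) = E u * E v" "E [:c:] = poly c x" "E 0 = 0" for u v c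
    by (simp_all add: E_def)
  have Ef: "E f = 0" using y by (simp add: E_def poly_poly_const)
  have Ef2: "E (theta_y f) \<noteq> 0" using arg_cong[OF abh(1), of E] Ef x by (auto simp: E_hom)
  define lam where "lam = E (theta_x f) / E (theta_y f)"
  define g where "g = theta_x f - [:[:lam:]:] * theta_y f"
  have Eg: "E g = 0"
  proof -
    have "theta_x f = g + [:[:lam:]:] * theta_y f" by (simp add: g_def)
    then have "E (theta_x f) = E g + lam * E (theta_y f)" by (metis E_hom(1,2,3) poly_pCons poly_0 mult_zero_right add.right_neutral)
    then show ?thesis using Ef2 by (simp add: lam_def)
  qed
  \<comment> \<open>The Hamiltonian field of f in logarithmic coordinates. It is tangent to the
    curve, because D f = 0 identically.\<close>
  define D where "D = (\<lambda>u. theta_y f * theta_x u - theta_x f * theta_y u)"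
  interpret derivation_at_point D E
    by standard (simp_all add: E_hom D_def theta_x_add theta_y_add theta_x_mult theta_y_mult algebra_simps)
  have J0: "J n 0" for n by (induction n) (simp_all add: E_hom D_def)
  have Jf: "J n f" for n
    by (cases n) (use J0 Ef in \<open>simp_all add: D_def\<close>)
  \<comment> \<open>If f divides its bordered Hessian, then modulo f the function g satisfies a
    linear first-order equation along D. Its value at the point is 0, so all its derivatives there
    vanish.\<close>
  have key: "theta_y f * D g = g * D (theta_y f) + f * z"
  proof -
    have "theta_x g = theta_x (theta_x f) - [:[:lam:]:] * theta_x (theta_y f)" "theta_y g = theta_x (theta_y f) - [:[:lam:]:] * theta_y (theta_y f)"
      unfolding g_def theta_x_diff theta_y_diff theta_x_mult theta_y_mult theta_x_const theta_y_const theta_y_theta_x by (simp_all add: pderiv_pCons)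
    moreover have "b * (b * (c - L * d) - a * (d - L * e)) =
      (a - L * b) * (b * d - a * e) + (c * b\<^sup>2 + e * a\<^sup>2 - 2 * d * a * b)" for a b c d e L :: bipoly
      by algebra
    ultimately show ?thesis unfolding D_def z[symmetric] bordered_hess_def
      by (simp only: g_def)
  qed
  have Jg: "J n g" for n
  proof (induction n)
    case (Suc n)
    have "J n (theta_y f * D g)" unfolding key by (intro J_add J_mult Suc Jf)
    then show ?case using J_cancel Ef2 Eg by simp
  qed (simp add: Eg)
  \<comment> \<open>On y = 0 a quotient k would satisfy x f0' = f0 k0. Equality of degrees makes k0
    a nonzero constant, and x = 0 then contradicts f0(0) being nonzero.\<close>
  have "\<not> f dvd g"
  proof
    assume "f dvd g"
    then obtain k where "g = f * k" by blast
    then have "coeff (theta_x f - [:[:lam:]:] * theta_y f) 0 = coeff f 0 * coeff k 0" 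
      by (simp add: g_def coeff_mult)
    then have k: "[:0, 1:] * pderiv (coeff f 0) = coeff f 0 * coeff k 0"
      by (simp add: coeff_theta_x coeff_theta_y)
    have "pderiv (coeff f 0) \<noteq> 0" using c0 by (simp add: pderiv_eq_0_iff)
    then have "[:0, 1:] * pderiv (coeff f 0) \<noteq> 0" and "degree ([:0, 1:] * pderiv (coeff f 0)) = degree (coeff f 0)"
      using c0 by (simp_all add: degree_mult_eq degree_pderiv del: mult_pCons_left)
    then have "coeff f 0 * coeff k 0 \<noteq> 0" "degree (coeff f 0 * coeff k 0) = degree (coeff f 0)"
      unfolding k by simp_all
    then have "coeff k 0 \<noteq> 0" "degree (coeff k 0) = 0" by (auto simp: degree_mult_eq)
    then obtain \<kappa> where "coeff k 0 = [:\<kappa>:]" "\<kappa> \<noteq> 0" by (metis degree_eq_zeroE pCons_0_0)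
    with arg_cong[OF k, of "\<lambda>u. poly u 0"] c0 show False by simp
  qed
  then obtain a' b' h' where h': "a' * f + b' * g = [:h':]" "h' \<noteq> 0"
    using prime_elem_coprime_combination[OF f deg] by metis
  have "J n [:h':]" for n
    unfolding h'(1)[symmetric] using J_mult[OF Jf] J_mult[OF Jg] by (metis J_add mult.commute)
  \<comment> \<open>On functions of x alone, D is differentiation times a factor invertible at the
    point, so \<open>degree u\<close> applications expose a nonzero constant.\<close>
  moreover have "\<not> J (degree u) [:u:]" if "u \<noteq> 0" for u
    using that
  proof (induction "degree u" arbitrary: u)
    case 0
    then show ?case by (metis E_hom(3) degree_eq_zeroE jet_vanishes.simps(1) mult_zero_right pCons_0_0 poly_0 poly_pCons add.right_neutral)
  next
    case (Suc n)
    have "D [:u:] = (theta_y f * [:[:0, 1:]:]) * [:pderiv u:]" by (simp add: D_def)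
    moreover have "E (theta_y f * [:[:0, 1:]:]) \<noteq> 0" using Ef2 x by (simp add: E_hom del: mult_pCons_right mult_pCons_left)
    moreover have "pderiv u \<noteq> 0" using Suc.hyps(2) by (simp add: pderiv_eq_0_iff)
    moreover have "degree (pderiv u) = n" using Suc.hyps(2) by (simp add: degree_pderiv)
    ultimately show ?case using Suc.hyps(1)[of "pderiv u"] J_cancel unfolding Suc.hyps(2)[symmetric]
      by (metis jet_vanishes.simps(2))
  qed
  ultimately show False using h' by blast
qed

section \<open>Multiplicities of prime factors in the Hessian\<close>

lemma coeff_01_mult:
  "coeff (A * B) 0 = coeff A 0 * coeff B 0"
  "coeff (A * B) (Suc 0) = coeff A 0 * coeff B (Suc 0) + coeff A (Suc 0) * coeff (B :: 'a :: comm_ring_1 poly) 0"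
  by (simp_all add: coeff_mult)

lemma coeff_theta: "coeff (theta_x P) n = theta (coeff P n)"
  by (simp add: coeff_theta_x theta_def)

lemma theta_0 [simp]: "theta 0 = 0"
  by (simp add: theta_def)

text \<open>Every term of \<open>mu_poly P\<close> contains a \<open>theta_y\<close> and so vanishes
  on the edge. What remains to first order in y is the one-variable logarithmic Hessian of the edge
  polynomial, weighted by the next coefficient.\<close>

lemma coeff_mu_poly:
  "coeff (mu_poly P) 0 = 0"
  "coeff (mu_poly P) (Suc 0) = coeff P (Suc 0) * (coeff P 0 * theta (theta (coeff P 0)) - (theta (coeff P 0))\<^sup>2)"
  by (simp_all add: mu_poly_def bordered_hess_def power2_eq_square coeff_01_mult coeff_theta coeff_theta_y
      algebra_simps)

lemma pCons0_dvd_iff: "[:0, 1:] dvd (u :: 'a :: comm_ring_1 poly) \<longleftrightarrow> coeff u 0 = 0"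
proof
  assume "coeff u 0 = 0"
  then obtain v where "u = [:0, 1:] * v" by (cases u) auto
  then show "[:0, 1:] dvd u" by (rule dvdI)
qed (auto elim!: dvdE simp: coeff_01_mult)

lemma prime_elem_X: "prime_elem ([:0, 1:] :: 'a :: idom poly)"
proof (rule prime_elemI)
  show "\<not> [:0, 1 :: 'a:] dvd 1" by (simp add: pCons0_dvd_iff)
qed (auto simp: pCons0_dvd_iff coeff_01_mult)

lemma sum_mset_eq_sum_count:
  fixes h :: "'a \<Rightarrow> nat"
  assumes "finite S" "set_mset M \<subseteq> S"
  shows "(\<Sum>x\<in>#M. h x) = (\<Sum>x\<in>S. count M x * h x)"
  using assms(2)
proof (induction M)
  case (add y M)
  have "(\<Sum>x\<in>S. count (add_mset y M) x * h x) = (\<Sum>x\<in>S. count M x * h x + (if x = y then h x else 0))"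
    by (intro sum.cong) auto
  with add assms(1) show ?case by (simp add: sum.distrib)
qed simp

text \<open>Restriction to y = 0 is multiplicative and the order at z is additive. The set S is
  arbitrary so that two factorizations can be compared over one index set.\<close>

lemma order_coeff_0_prime_factorization:
  fixes u :: bipoly
  assumes "coeff u 0 \<noteq> 0" "finite S" "prime_factors u \<subseteq> S"
  shows "order z (coeff u 0) = (\<Sum>f\<in>S. count (prime_factorization u) f * order z (coeff f 0))"
proof -
  have "order z (coeff u 0) = (\<Sum>f\<in>#prime_factorization u. order z (coeff f 0))"
    using assms(1)
  proof (induction u rule: prime_divisors_induct)
    case (unit u)
    from unit(1) obtain w where w: "1 = u * w" ..
    have "coeff u 0 * coeff w 0 = coeff (1 :: bipoly) 0" unfolding w coeff_01_mult ..
    then have "coeff u 0 * coeff w 0 = 1" by simp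
    then have "is_unit (coeff u 0)" by (metis dvd_triv_left)
    then have "degree (coeff u 0) = 0" using unit(2) by (simp add: is_unit_iff_degree)
    then obtain c where "coeff u 0 = [:c:]" using degree_eq_zeroE by blast
    then have "order z (coeff u 0) = 0" using unit by (auto intro: order_0I)
    with unit show ?case by (simp add: prime_factorization_unit)
  next
    case (factor p u)
    then have "u \<noteq> 0" "coeff p 0 * coeff u 0 \<noteq> 0" "coeff u 0 \<noteq> 0" by (auto simp: coeff_01_mult)
    with factor show ?case by (simp add: prime_factorization_times_prime coeff_01_mult order_mult)
  qed simp
  also have "\<dots> = (\<Sum>f\<in>S. count (prime_factorization u) f * order z (coeff f 0))"
    by (rule sum_mset_eq_sum_count) (use assms in auto)
  finally show ?thesis .
qed

lemma prime_elem_multiplicity_eqI: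
  fixes x :: "'a :: factorial_semiring"
  assumes "prime_elem p" "g * x = p ^ n * w" "\<not> p dvd g" "\<not> p dvd w"
  shows "multiplicity p x = n"
proof (cases "g * x = 0")
  case True then show ?thesis using assms by auto
next
  case False
  then have "multiplicity p (g * x) = multiplicity p x"
    using assms by (subst prime_elem_multiplicity_mult_distrib) (auto simp: not_dvd_imp_multiplicity_0)
  moreover have "multiplicity p (p ^ n * w) = n"
    using assms False by (subst prime_elem_multiplicity_mult_distrib) (auto simp: not_dvd_imp_multiplicity_0)
  ultimately show ?thesis using assms by simp
qed

lemma prime_elem_not_dvd_of_nat:
  assumes "prime_elem (f :: bipoly)" shows "\<not> f dvd of_nat (Suc n)"
proof
  assume "f dvd of_nat (Suc n)"
  moreover have "of_nat (Suc n) * [:[:1 / of_nat (Suc n):]:] = (1 :: bipoly)"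
    by (simp add: of_nat_poly flip: one_pCons del: of_nat_Suc)
  then have "of_nat (Suc n) dvd (1 :: bipoly)" by (metis dvd_triv_left)
  ultimately show False using assms by (meson dvd_trans prime_elem_not_unit)
qed

text \<open>Modulo f the bracket of \<open>mu_poly_power_mult\<close> is a unit multiple of g^4
  \<open>mu_poly f\<close>, and \<open>mu_poly f\<close> is congruent to
  \<open>- bordered_hess f\<close>.\<close>

lemma multiplicity_mu_poly:
  assumes f: "prime_elem f" and deg: "degree f > 0" "degree (coeff f 0) > 0" "poly (coeff f 0) 0 \<noteq> 0"
    and fP: "f dvd P" and P: "P \<noteq> 0"
  shows "multiplicity f (mu_poly P) = 3 * (multiplicity f P - 1)"
proof -
  obtain g where g: "P = f ^ multiplicity f P * g" "\<not> f dvd g"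
    using multiplicity_decompose'[OF P prime_elem_not_unit[OF f]] by blast
  have "multiplicity f P > 0" using f fP P by (simp add: prime_multiplicity_gt_zero_iff)
  then obtain n where n: "multiplicity f P = Suc n" using gr0_implies_Suc by blast
  have f0: "f \<noteq> 0" using f by auto
  define w where "w = of_nat (Suc n) ^ 2 * g ^ 4 * mu_poly f + of_nat (Suc n) * g\<^sup>2 * f * mixed_hess f g
      + f ^ 3 * g * mu_poly g"
  have "\<not> f dvd mu_poly f"
  proof
    assume "f dvd mu_poly f"
    then have "f dvd f * (theta_x (theta_x f) * theta_y (theta_y f) - (theta_x (theta_y f))\<^sup>2) - mu_poly f"
      by (intro dvd_diff dvd_triv_left)
    then show False using not_dvd_bordered_hess[OF f deg] by (simp add: mu_poly_def)
  qed
  moreover have "\<not> f dvd of_nat (Suc n) ^ 2"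
    using prime_elem_not_dvd_of_nat[OF f] prime_elem_dvd_power[OF f] by blast
  ultimately have "\<not> f dvd of_nat (Suc n) ^ 2 * g ^ 4 * mu_poly f"
    using f g(2) by (metis prime_elem_dvd_mult_iff prime_elem_dvd_power)
  moreover have "w = of_nat (Suc n) ^ 2 * g ^ 4 * mu_poly f + f * (of_nat (Suc n) * g\<^sup>2 * mixed_hess f g
      + f ^ 2 * g * mu_poly g)" unfolding w_def by algebra
  ultimately have "\<not> f dvd w" by (simp add: dvd_add_left_iff)
  moreover have "g * mu_poly P = f ^ (3 * n) * w"
    using mu_poly_power_mult[OF f0, of g n] g(1) unfolding n w_def by simp
  ultimately show ?thesis using prime_elem_multiplicity_eqI[OF f] g(2) n by simp
qed

lemma map_poly_eval_hom:
  fixes u v :: bipoly and z :: complex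
  defines "e \<equiv> map_poly (\<lambda>c. poly c z)"
  shows "e (u + v) = e u + e v" "e (u * v) = e u * e v" "e (u - v) = e u - e v" "e (theta_y u) = theta (e u)"
    "e [:c:] = [:poly c z:]"
proof -
  show 1: "e (u + v) = e u + e v" "e (u - v) = e u - e v"
    by (rule poly_eqI; simp add: e_def coeff_map_poly)+
  show "e (u * v) = e u * e v"
    by (rule poly_eqI) (simp add: e_def coeff_map_poly coeff_mult poly_sum)
  show "e (theta_y u) = theta (e u)"
    by (rule poly_eqI) (simp add: e_def coeff_map_poly coeff_theta_y theta_def coeff_pCons coeff_pderiv split: nat.split)
  show "e [:c:] = [:poly c z:]" by (simp add: e_def map_poly_pCons)
qed

abbreviation xlin :: "complex \<Rightarrow> bipoly" where "xlin z \<equiv> [:[:-z, 1:]:]"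
abbreviation ylin :: "complex \<Rightarrow> bipoly" where "ylin z \<equiv> [:[:-z:], 1:]"

lemma prime_elem_xlin: "prime_elem (xlin z)"
  by (simp add: prime_elem_const_poly_iff prime_elem_linear_field_poly)

lemma xlin_dvd_iff: "xlin z dvd u \<longleftrightarrow> map_poly (\<lambda>c. poly c z) u = 0"
  unfolding const_poly_dvd_iff poly_eq_iff by (simp add: coeff_map_poly poly_eq_0_iff_dvd)

text \<open>For f = x - z the term \<open>mu_poly f\<close> is 0, and the mixed term contributes one
  more factor f. No second one appears: on the line x = z the mixed term contains the one-variable
  logarithmic Hessian of g(z, y), which has the nonzero root z' and hence is not a monomial.\<close>

lemma multiplicity_xlin_mu_poly:
  assumes z: "z \<noteq> 0" "z' \<noteq> 0" and dvd: "xlin z dvd P" "ylin z' dvd P" and P: "P \<noteq> 0"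
  shows "multiplicity (xlin z) (mu_poly P) = 3 * multiplicity (xlin z) P - 2"
proof -
  define f where "f = xlin z"
  have f: "prime_elem f" unfolding f_def by (rule prime_elem_xlin)
  then have f0: "f \<noteq> 0" by auto
  obtain g where g: "P = f ^ multiplicity f P * g" "\<not> f dvd g"
    using multiplicity_decompose'[OF P prime_elem_not_unit[OF f]] by blast
  have "multiplicity f P > 0" using f dvd P by (simp add: prime_multiplicity_gt_zero_iff f_def)
  then obtain n where n: "multiplicity f P = Suc n" using gr0_implies_Suc by blast
  have t: "theta_x f = [:[:0, 1:]:]" "theta_y f = 0" "theta_x (theta_x f) = [:[:0, 1:]:]" 
    by (simp_all add: f_def pderiv_pCons)
  have mu: "mu_poly f = 0" by (simp add: mu_poly_def bordered_hess_def t)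
  have mix: "mixed_hess f g = log_hess11 f * log_hess22 g"
    by (simp add: mixed_hess_def log_hess12_def log_hess22_def t)
  define w where "w = of_nat (Suc n) * g\<^sup>2 * (log_hess11 f * log_hess22 g) + f ^ 2 * g * mu_poly g"
  have eq: "g * mu_poly P = f ^ Suc (3 * n) * w"
    using mu_poly_power_mult[OF f0, of g n] g(1)[unfolded n] unfolding mu mix w_def
    by (simp add: algebra_simps power3_eq_cube power2_eq_square)
  define e where "e = map_poly (\<lambda>c. poly c z)"
  have fe: "f dvd u \<longleftrightarrow> e u = 0" for u unfolding f_def e_def by (rule xlin_dvd_iff)
  note e_hom = map_poly_eval_hom[where z = z, folded e_def]
  have "poly (e g) z' = 0"
  proof -
    have "poly P [:z':] = 0" using dvd(2) by auto
    moreover have "poly P [:z':] = [:-z, 1:] ^ multiplicity f P * poly g [:z':]"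
      by (subst g(1)) (simp add: f_def)
    ultimately have "poly g [:z':] = 0" by simp
    then show ?thesis by (simp add: e_def flip: poly_poly_const)
  qed
  moreover have "e g \<noteq> 0" using g(2) fe by simp
  ultimately have "e g * theta (theta (e g)) - (theta (e g))\<^sup>2 \<noteq> 0"
    using log_hess_univ_nonzero z by blast
  then have "\<not> f dvd log_hess22 g" unfolding fe log_hess22_def e_hom by (simp add: power2_eq_square)
  moreover have "\<not> f dvd log_hess11 f" unfolding log_hess11_def t fe e_hom using z fe[of f] by simp
  moreover have "\<not> f dvd of_nat (Suc n)" using prime_elem_not_dvd_of_nat[OF f] .
  ultimately have "\<not> f dvd of_nat (Suc n) * g\<^sup>2 * (log_hess11 f * log_hess22 g)"
    using f g(2) by (meson prime_elem_dvd_mult_iff prime_elem_dvd_power)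
  moreover have "w = of_nat (Suc n) * g\<^sup>2 * (log_hess11 f * log_hess22 g) + f * (f * g * mu_poly g)"
    unfolding w_def by algebra
  ultimately have "\<not> f dvd w" by (simp add: dvd_add_left_iff)
  then show ?thesis using prime_elem_multiplicity_eqI[OF f eq g(2)] n unfolding f_def by simp
qed

lemma map_poly_ring_hom:
  fixes h :: "'a :: comm_ring_1 \<Rightarrow> 'b :: comm_ring_1"
  assumes "\<And>a b. h (a + b) = h a + h b" "\<And>a b. h (a * b) = h a * h b"
  shows "map_poly h (p + q) = map_poly h p + map_poly h q"
    "map_poly h (p * q) = map_poly h p * map_poly h q" "h 0 = 0"
proof -
  show h0: "h 0 = 0" using assms(1)[of 0 0] by simp
  have hsum: "h (\<Sum>i\<in>I. f i) = (\<Sum>i\<in>I. h (f i))" for f and I :: "nat set"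
    by (induction I rule: infinite_finite_induct) (simp_all add: h0 assms)
  show "map_poly h (p + q) = map_poly h p + map_poly h q"
    by (rule poly_eqI) (simp add: coeff_map_poly h0 assms)
  show "map_poly h (p * q) = map_poly h p * map_poly h q"
    by (rule poly_eqI) (simp add: coeff_map_poly h0 assms coeff_mult hsum)
qed

section \<open>Analysis of one edge\<close>

text \<open>The order at z of the y-coefficient of \<open>mu_poly P\<close> is computed twice, from
  \<open>coeff_mu_poly\<close> and from the prime factors. The equality cases are stated separately,
  since they are the ones that exhibit a divisor of P of full size.\<close>

lemma edge_analysis:
  fixes P :: bipoly
  defines "q \<equiv> coeff P 0" and "r \<equiv> coeff P (Suc 0)"
  assumes q0: "poly q 0 \<noteq> 0" and deg: "degree q > 0" and q1: "coeff q (Suc 0) \<noteq> 0" and r0: "poly r 0 \<noteq> 0"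
    and mu_dvd: "mu_poly P dvd P ^ N * [:[:0, 1:]:] ^ i * [:0, 1:] ^ j"
  obtains z c where "z \<noteq> 0" "c \<noteq> 0" "q = smult c ([:-z, 1:] ^ degree q)"
    "\<not> xlin z dvd P \<Longrightarrow> degree r < degree q"
    "\<not> xlin z dvd P \<Longrightarrow> Suc (degree r) = degree q \<Longrightarrow> \<exists>f. prime_elem f \<and> f ^ degree q dvd P"
    "\<And>z'. xlin z dvd P \<Longrightarrow> ylin z' dvd P \<Longrightarrow> z' \<noteq> 0 \<Longrightarrow> degree r \<le> degree q"
    "\<And>z'. xlin z dvd P \<Longrightarrow> ylin z' dvd P \<Longrightarrow> z' \<noteq> 0 \<Longrightarrow> degree r = degree q \<Longrightarrow> xlin z ^ degree q dvd P"
proof -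
  have P0: "P \<noteq> 0" and qn: "q \<noteq> 0" and rn: "r \<noteq> 0" using q0 r0 by (auto simp: q_def r_def)
  define L where "L = q * theta (theta q) - (theta q)\<^sup>2"
  \<comment> \<open>The logarithmic Hessian always has a factor x; its cofactor \<open>Q\<close>
    takes the nonzero value q(0) q'(0) at 0.\<close>
  define Q where "Q = q * (pderiv q + [:0,1:] * pderiv (pderiv q)) - [:0,1:] * (pderiv q)\<^sup>2"
  have LQ: "L = [:0, 1:] * Q"
    unfolding L_def Q_def theta_def pderiv_mult
    by (simp add: pderiv_pCons power2_eq_square algebra_simps del: mult_pCons_left mult_pCons_right flip: one_pCons)
  have Q0: "poly Q 0 \<noteq> 0"
    using q0 q1 by (simp add: Q_def poly_0_coeff_0 coeff_pderiv coeff_01_mult)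
  \<comment> \<open>After one factor y is removed, the restriction to the edge is x r Q, which is
    nonzero.\<close>
  obtain U where U: "mu_poly P = [:0, 1:] * U"
    using pCons0_dvd_iff[of "mu_poly P"] coeff_mu_poly(1) by blast
  have cU: "coeff U 0 = [:0, 1:] * (r * Q)"
  proof -
    have "coeff U 0 = coeff (mu_poly P) (Suc 0)" unfolding U by simp
    also have "\<dots> = r * L" by (simp add: coeff_mu_poly q_def r_def L_def)
    finally show ?thesis by (simp add: LQ algebra_simps)
  qed
  have Qn: "Q \<noteq> 0" using Q0 by auto
  have cU0: "coeff U 0 \<noteq> 0" using rn Qn unfolding cU by simp
  have y: "prime_elem ([:0, 1:] :: bipoly)" by (rule prime_elem_X)
  have "U dvd P ^ N * [:[:0, 1:]:] ^ i * [:0, 1:] ^ j"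
    using mu_dvd U by (metis dvd_mult_right)
  moreover have "coprime U ([:0, 1:] ^ j)"
    using prime_elem_imp_coprime[OF y, of U] cU0 by (simp add: pCons0_dvd_iff coprime_commute)
  ultimately have U_dvd: "U dvd P ^ N * [:[:0, 1:]:] ^ i" by (simp add: coprime_dvd_mult_left_iff)
  then obtain w where "P ^ N * [:[:0, 1:]:] ^ i = U * w" ..
  from arg_cong[OF this, of "\<lambda>u. coeff u 0"]
  have wq: "q ^ N * [:0, 1:] ^ i = coeff U 0 * coeff w 0"
    by (simp only: coeff_01_mult coeff_0_power coeff_pCons_0 q_def)
  have roots: "poly q \<zeta> = 0" if "\<zeta> \<noteq> 0" "poly (r * Q) \<zeta> = 0" for \<zeta>
  proof -
    have "poly q \<zeta> ^ N * \<zeta> ^ i = 0"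
      using arg_cong[OF wq, of "\<lambda>u. poly u \<zeta>"] that unfolding cU by simp
    then show ?thesis using that by simp
  qed
  obtain z c where z: "z \<noteq> 0" and c: "c \<noteq> 0" and qz: "q = smult c ([:-z, 1:] ^ degree q)"
    and oQ: "order z Q = 2 * (degree q - 1)"
    by (rule log_hess_univ_single_root[OF deg q0 Q0 LQ[unfolded L_def]]) (use roots in auto)
  have only: "\<zeta> = z" if "poly q \<zeta> = 0" for \<zeta>
    using that by (subst (asm) qz) (auto simp: c)
  have oq: "order z q = degree q"
    by (subst qz) (simp add: order_smult c order_power_n_n)
  have "\<zeta> = z" if "poly r \<zeta> = 0" for \<zeta>
    using only roots[of \<zeta>] that r0 by (cases "\<zeta> = 0") auto
  then obtain b where b: "b \<noteq> 0" "r = smult b ([:-z, 1:] ^ degree r)"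
    by (rule poly_single_root[OF rn])
  have or: "order z r = degree r"
    by (subst b(2)) (simp add: order_smult b(1) order_power_n_n)
  have "order z (coeff U 0) = order z [:0, 1:] + order z (r * Q)"
    using cU0 unfolding cU by (rule order_mult)
  also have "order z [:0, 1:] = 0" using z by (simp add: order_0I)
  also have "order z (r * Q) = degree r + 2 * (degree q - 1)"
    using rn Qn by (simp add: order_mult or oQ)
  finally have oU: "order z (coeff U 0) = degree r + 2 * (degree q - 1)" by simp

  \<comment> \<open>\<open>e f\<close> is the intersection number of the curve f = 0 with the edge
    at (z, 0), and \<open>Z\<close> collects the prime factors passing through that point.\<close>
  define S where "S = prime_factors P \<union> prime_factors U"
  define e where "e = (\<lambda>f :: bipoly. order z (coeff f 0))"
  define Z where "Z = {f \<in> S. e f > 0}"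
  define m where "m = (\<lambda>f. multiplicity f P)"
  define n where "n = (\<lambda>f. multiplicity f (mu_poly P))"
  have fin: "finite S" "finite Z" by (auto simp: S_def Z_def)
  have Un: "U \<noteq> 0" using cU0 by auto
  have Zprime: "prime f" if "f \<in> Z" for f using that by (auto simp: Z_def S_def)
  have Zc: "coeff f 0 \<noteq> 0" if "f \<in> Z" for f
  proof -
    have "f dvd P \<or> f dvd U" using that by (auto simp: Z_def S_def)
    then show ?thesis using cU0 qn by (auto elim!: dvdE simp: coeff_01_mult q_def)
  qed
  \<comment> \<open>A prime factor of \<open>U\<close> that does not divide P would have to divide
    x, which is nonzero at z.\<close>
  have ZP: "f dvd P" if f: "f \<in> Z" for f
  proof (rule ccontr)
    assume nP: "\<not> f dvd P"
    then have "f dvd U" using f by (auto simp: Z_def S_def)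
    then have "f dvd P ^ N * [:[:0, 1:]:] ^ i" using U_dvd dvd_trans by blast
    then have "f dvd [:[:0, 1:]:]"
      using nP Zprime[OF f] by (meson prime_dvd_mult_iff prime_dvd_power)
    then obtain k where "[:[:0, 1:]:] = f * k" ..
    from arg_cong[OF this, of "\<lambda>u. coeff u 0"] have k: "[:0, 1:] = coeff f 0 * coeff k 0"
      by (simp add: coeff_01_mult)
    have "poly (coeff f 0) z = 0" using f by (auto simp: Z_def e_def order_root)
    with arg_cong[OF k, of "\<lambda>u. poly u z"] z show False by simp
  qed
  have Zq: "coeff f 0 dvd q" if "f \<in> Z" for f
    using ZP[OF that] by (auto elim!: dvdE simp: coeff_01_mult q_def)
  have Zr: "poly (coeff f 0) z = 0" "poly (coeff f 0) 0 \<noteq> 0" "degree (coeff f 0) > 0" if f: "f \<in> Z" for f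
  proof -
    show 1: "poly (coeff f 0) z = 0" using f by (auto simp: Z_def e_def order_root)
    show "poly (coeff f 0) 0 \<noteq> 0" using Zq[OF f] q0 by (auto elim!: dvdE)
    show "degree (coeff f 0) > 0"
    proof (rule ccontr)
      assume "\<not> degree (coeff f 0) > 0"
      then obtain a where "coeff f 0 = [:a:]" using degree_eq_zeroE by blast
      then show False using 1 Zc[OF f] by auto
    qed
  qed
  have m1: "m f \<ge> 1" if "f \<in> Z" for f
    using ZP[OF that] Zprime[OF that] P0 by (simp add: m_def Suc_le_eq prime_multiplicity_gt_zero_iff)
  have nU: "multiplicity f U = n f" if f: "f \<in> Z" for f
  proof -
    have "\<not> f dvd [:0, 1:]"
    proof
      assume "f dvd [:0, 1:]"
      then have "[:0, 1:] dvd f"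
        using irreducibleD'[OF prime_elem_imp_irreducible[OF y]] Zprime[OF f] by (meson not_prime_unit)
      then show False using Zc[OF f] by (simp add: pCons0_dvd_iff)
    qed
    then have "multiplicity f [:0, 1:] = 0" by (rule not_dvd_imp_multiplicity_0)
    then show ?thesis unfolding n_def U using Zprime[OF f] Un
      by (subst prime_elem_multiplicity_mult_distrib) auto
  qed
  have sum_q: "degree q = (\<Sum>f\<in>Z. m f * e f)"
  proof -
    have "order z (coeff P 0) = (\<Sum>f\<in>S. count (prime_factorization P) f * e f)"
      unfolding e_def
      by (rule order_coeff_0_prime_factorization) (use qn fin in \<open>auto simp: q_def S_def\<close>)
    then have "degree q = (\<Sum>f\<in>S. count (prime_factorization P) f * e f)"
      unfolding q_def[symmetric] oq .
    also have "\<dots> = (\<Sum>f\<in>Z. count (prime_factorization P) f * e f)"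
      using fin by (intro sum.mono_neutral_right) (auto simp: Z_def)
    also have "\<dots> = (\<Sum>f\<in>Z. m f * e f)"
      by (intro sum.cong) (auto simp: m_def count_prime_factorization_prime Zprime)
    finally show ?thesis .
  qed
  have sum_U: "degree r + 2 * (degree q - 1) = (\<Sum>f\<in>Z. n f * e f)"
  proof -
    have "degree r + 2 * (degree q - 1) = (\<Sum>f\<in>S. count (prime_factorization U) f * e f)"
      unfolding oU[symmetric] e_def
      by (rule order_coeff_0_prime_factorization) (use cU0 fin in \<open>auto simp: S_def\<close>)
    also have "\<dots> = (\<Sum>f\<in>Z. count (prime_factorization U) f * e f)"
      using fin by (intro sum.mono_neutral_right) (auto simp: Z_def)
    also have "\<dots> = (\<Sum>f\<in>Z. n f * e f)"
      by (intro sum.cong) (auto simp: nU count_prime_factorization_prime Zprime)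
    finally show ?thesis .
  qed
  \<comment> \<open>A prime in \<open>Z\<close> without y is associated to x - z, the one factor to
    which \<open>multiplicity_mu_poly\<close> does not apply.\<close>
  have deg0: "xlin z dvd f" if f: "f \<in> Z" and "degree f = 0" for f
  proof -
    obtain a where a: "f = [:a:]" using \<open>degree f = 0\<close> degree_eq_zeroE by blast
    have "poly a z = 0" using Zr(1)[OF f] a by simp
    then show ?thesis unfolding a by (simp add: const_poly_dvd_const_poly_iff poly_eq_0_iff_dvd)
  qed
  \<comment> \<open>Multiplicity 3m - 3, weighted by \<open>e f\<close> and written without
    subtraction on natural numbers.\<close>
  have n3: "n f * e f + 3 * e f = 3 * (m f * e f)" if f: "f \<in> Z" and "degree f > 0" for f
  proof -
    have "n f = 3 * (m f - 1)" unfolding n_def m_def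
      by (rule multiplicity_mu_poly) (use f that Zprime Zr ZP P0 in auto)
    then have "n f + 3 = 3 * m f" using m1[OF f] by simp
    then have "(n f + 3) * e f = 3 * m f * e f" by simp
    then show ?thesis by (simp add: algebra_simps)
  qed
  show ?thesis
  proof (rule that[OF z c qz])
    assume nx: "\<not> xlin z dvd P"
    have dpos: "degree f > 0" if "f \<in> Z" for f
      using deg0[OF that] ZP[OF that] nx dvd_trans by blast
    define E where "E = (\<Sum>f\<in>Z. e f)"
    have "(\<Sum>f\<in>Z. n f * e f) + 3 * E = (\<Sum>f\<in>Z. n f * e f + 3 * e f)"
      by (simp add: E_def sum.distrib sum_distrib_left)
    also have "\<dots> = (\<Sum>f\<in>Z. 3 * (m f * e f))" by (intro sum.cong refl n3 dpos)
    also have "\<dots> = 3 * degree q" by (simp add: sum_q sum_distrib_left)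
    \<comment> \<open>With d = \<open>degree q - degree r\<close> this reads 2 + d = 3 E, and E is
      positive because some factor passes through (z, 0). For d = 1 a single factor meets the edge
      there, transversally, and its multiplicity is \<open>degree q\<close>.\<close>
    finally have main: "degree r + 2 * (degree q - 1) + 3 * E = 3 * degree q" unfolding sum_U .
    have "Z \<noteq> {}" using sum_q deg by auto
    then obtain f where f: "f \<in> Z" by blast
    have ef: "e f > 0" using f by (simp add: Z_def)
    have Ef: "E = e f + (\<Sum>g\<in>Z - {f}. e g)" unfolding E_def using fin f by (simp add: sum.remove)
    then have "E \<ge> 1" using ef by simp
    then show "degree r < degree q" using main deg by linarith
    show "\<exists>f. prime_elem f \<and> f ^ degree q dvd P" if "Suc (degree r) = degree q"
    proof -
      have "E = 1" using main that by linarith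
      then have "(\<Sum>g\<in>Z - {f}. e g) = 0" "e f = 1" using Ef ef by simp_all
      then have "Z - {f} = {}" using fin by (auto simp: Z_def)
      then have "Z = {f}" using f by blast
      then have "degree q = m f" using sum_q \<open>e f = 1\<close> by simp
      then have "f ^ degree q dvd P" by (simp add: m_def multiplicity_dvd)
      then show ?thesis using Zprime[OF f] by (auto simp: prime_def)
    qed
  next
    fix z'
    assume xd: "xlin z dvd P" and yd: "ylin z' dvd P" and z': "z' \<noteq> 0"
    \<comment> \<open>The prime factorization lists normalized primes only, so x - z is replaced by
      its associate there, with the same intersection number.\<close>
    define f where "f = normalize (xlin z)"
    have pf: "prime f" unfolding f_def prime_def using prime_elem_xlin[of z] by simp
    have fP: "f \<in> prime_factors P" using xd P0 pf by (simp add: in_prime_factors_iff f_def)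
    have ef: "e f = 1"
    proof -
      have "f dvd xlin z" "xlin z dvd f" by (simp_all add: f_def)
      then obtain k k' where k: "xlin z = f * k" and k': "f = xlin z * k'" by (meson dvdE)
      have eq: "[:-z, 1:] = coeff f 0 * coeff k 0"
        using arg_cong[OF k, of "\<lambda>u. coeff u 0"] by (simp add: coeff_01_mult)
      have ne: "coeff f 0 * coeff k 0 \<noteq> 0" unfolding eq[symmetric] by simp
      have "order z [:-z, 1:] = 1" using order_power_n_n[of z 1] by simp
      then have "order z (coeff f 0) + order z (coeff k 0) = 1"
        using order_mult[OF ne, of z] by (simp add: eq)
      moreover have "poly (coeff f 0) z = 0"
        by (subst k') (simp add: coeff_01_mult)
      then have "order z (coeff f 0) \<noteq> 0" using ne by (simp add: order_root)
      ultimately show ?thesis by (simp add: e_def)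
    qed
    have fZ: "f \<in> Z" using fP ef by (simp add: Z_def S_def)
    have nf: "n f + 2 = 3 * m f"
      using multiplicity_xlin_mu_poly[OF z z' xd yd P0] m1[OF fZ] by (simp add: n_def m_def f_def)
    have dpos: "degree g > 0" if g: "g \<in> Z - {f}" for g
    proof (rule ccontr)
      assume "\<not> degree g > 0"
      then have "f dvd g" using deg0 g by (simp add: f_def)
      then show False using primes_dvd_imp_eq[OF pf Zprime] g by blast
    qed
    define E where "E = (\<Sum>g\<in>Z - {f}. e g)"
    define A where "A = (\<Sum>g\<in>Z - {f}. n g * e g)"
    define B where "B = (\<Sum>g\<in>Z - {f}. m g * e g)"
    have "A + 3 * E = (\<Sum>g\<in>Z - {f}. n g * e g + 3 * e g)"
      by (simp add: A_def E_def sum.distrib sum_distrib_left)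
    also have "\<dots> = (\<Sum>g\<in>Z - {f}. 3 * (m g * e g))"
      by (rule sum.cong[OF refl n3]) (use dpos in auto)
    finally have AB: "A + 3 * E = 3 * B" by (simp add: B_def sum_distrib_left)
    have "(\<Sum>g\<in>Z. n g * e g) = n f + A" "(\<Sum>g\<in>Z. m g * e g) = m f + B"
      unfolding A_def B_def using fin fZ ef by (simp_all add: sum.remove)
    then have s: "degree r + 2 * (degree q - 1) = n f + A" "degree q = m f + B"
      using sum_U sum_q by simp_all
    \<comment> \<open>The multiplicity 3m - 2 of x - z absorbs the 2 of the other case, which leaves
      d = 3 E. For d = 0 no further factor passes through (z, 0).\<close>
    have main: "degree r + 3 * E = degree q" using s nf AB deg by linarith
    then show "degree r \<le> degree q" by simp
    show "xlin z ^ degree q dvd P" if "degree r = degree q"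
    proof -
      have "E = 0" using main that by simp
      then have "Z - {f} = {}" using fin by (auto simp: Z_def E_def)
      then have "B = 0" by (simp only: B_def sum.empty)
      then show ?thesis unfolding s(2) by (simp add: m_def f_def multiplicity_dvd)
    qed
  qed
qed

section \<open>Classification of the admissible polynomials\<close>

definition swap_vars :: "bipoly \<Rightarrow> bipoly" where
  "swap_vars P = poly (map_poly (map_poly (\<lambda>a. [:a:])) P) [:[:0, 1:]:]"

lemma swap_vars_add: "swap_vars (P + Q) = swap_vars P + swap_vars Q"
  and swap_vars_mult: "swap_vars (P * Q) = swap_vars P * swap_vars Q"
proof -
  have h: "map_poly (\<lambda>a. [:a:]) (c + d) = map_poly (\<lambda>a. [:a:]) c + map_poly (\<lambda>a. [:a:]) d"
    "map_poly (\<lambda>a. [:a:]) (c * d) = map_poly (\<lambda>a. [:a:]) c * map_poly (\<lambda>a. [:a:]) d" for c d :: "complex poly"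
    by (rule map_poly_ring_hom; simp)+
  show "swap_vars (P + Q) = swap_vars P + swap_vars Q" "swap_vars (P * Q) = swap_vars P * swap_vars Q"
    unfolding swap_vars_def map_poly_ring_hom[of "map_poly (\<lambda>a. [:a:]) :: complex poly \<Rightarrow> bipoly", OF h] by simp_all
qed

lemma swap_vars_pCons: "swap_vars (pCons c P) = map_poly (\<lambda>a. [:a:]) c + [:[:0, 1:]:] * swap_vars P"
  by (simp add: swap_vars_def map_poly_pCons)

lemma coeff_swap_vars: "coeff (coeff (swap_vars P) i) j = coeff (coeff P j) i"
proof (induction P arbitrary: j)
  case 0 then show ?case by (simp add: swap_vars_def)
next
  case (pCons c P)
  then show ?case by (cases j) (simp_all add: swap_vars_pCons coeff_map_poly)
qed

lemma bipoly_eqI: "(\<And>i j. coeff (coeff P i) j = coeff (coeff Q i) j) \<Longrightarrow> P = (Q :: bipoly)"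
  by (intro poly_eqI)

lemma swap_vars_swap_vars [simp]: "swap_vars (swap_vars P) = P"
  by (rule bipoly_eqI) (simp add: coeff_swap_vars)

lemma swap_vars_1 [simp]: "swap_vars 1 = 1"
  by (simp add: one_pCons swap_vars_def map_poly_pCons)

lemma swap_vars_power: "swap_vars (P ^ n) = swap_vars P ^ n"
  by (induction n) (simp_all add: swap_vars_mult)

lemma swap_vars_diff: "swap_vars (P - Q) = swap_vars P - swap_vars Q"
  by (rule bipoly_eqI) (simp add: coeff_swap_vars)

lemma swap_vars_lin: "swap_vars (xlin z) = ylin z" "swap_vars (ylin z) = xlin z"
  "swap_vars [:[:0, 1:]:] = [:0, 1:]" "swap_vars [:0, 1:] = [:[:0, 1:]:]"
  by (simp_all add: swap_vars_def map_poly_pCons)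

lemma swap_vars_dvd_iff: "swap_vars P dvd swap_vars Q \<longleftrightarrow> P dvd Q"
  by (metis dvd_def swap_vars_mult swap_vars_swap_vars)

lemma swap_vars_theta: "swap_vars (theta_x P) = theta_y (swap_vars P)" "swap_vars (theta_y P) = theta_x (swap_vars P)"
proof -
  have c: "coeff (coeff (theta_x P) i) j = of_nat j * coeff (coeff P i) j"
    "coeff (coeff (theta_y P) i) j = of_nat i * coeff (coeff P i) j" for P i j
    by (cases j; simp add: coeff_theta_x coeff_theta_y coeff_pCons coeff_pderiv of_nat_poly)+
  show "swap_vars (theta_x P) = theta_y (swap_vars P)" "swap_vars (theta_y P) = theta_x (swap_vars P)"
    by (rule bipoly_eqI, simp add: c coeff_swap_vars)+
qed

lemma swap_vars_mu_poly: "swap_vars (mu_poly P) = mu_poly (swap_vars P)"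
proof -
  have "swap_vars 2 = 2" using swap_vars_add[of 1 1] by simp
  then show ?thesis
    unfolding mu_poly_def bordered_hess_def swap_vars_diff swap_vars_add swap_vars_mult swap_vars_power
      swap_vars_theta theta_y_theta_x by (simp add: algebra_simps)
qed

text \<open>
  Let \<open>d\<close> be the degree of \<open>coeff P 0\<close> minus that of \<open>coeff P 1\<close>.  The condition says that the support
  of \<open>P\<close> lies on the inner side of the second edge at the vertex \<open>(degree (coeff P 0), 0)\<close> if this
  edge has direction \<open>(-d, 1)\<close>.
\<close>
definition edge_bound :: "bipoly \<Rightarrow> bool" where
  "edge_bound P \<longleftrightarrow> (\<forall>s t. coeff (coeff P t) s \<noteq> 0 \<longrightarrow>
     int s + (int (degree (coeff P 0)) - int (degree (coeff P 1))) * int t \<le> int (degree (coeff P 0)))"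

text \<open>If the number d of the other edge is positive, the support has a single point in the row
  of that edge's far end. The coefficient of this power of y is then a nonzero constant, which x - z
  cannot divide.\<close>

lemma not_xlin_dvd:
  assumes "edge_bound (swap_vars P)" "degree (coeff (swap_vars P) 1) < degree (coeff (swap_vars P) 0)"
  shows "\<not> xlin z dvd P"
proof
  let ?l = "degree (coeff (swap_vars P) 0)"
  assume "xlin z dvd P"
  then have "[:-z, 1:] dvd coeff P ?l" by (simp add: const_poly_dvd_iff)
  moreover have "coeff (coeff P ?l) s = 0" if "s > 0" for s
  proof (rule ccontr)
    assume n: "coeff (coeff P ?l) s \<noteq> 0"
    define d where "d = int ?l - int (degree (coeff (swap_vars P) 1))"
    have "int ?l + d * int s \<le> int ?l"
      using assms(1) n unfolding edge_bound_def d_def by (metis coeff_swap_vars)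
    moreover have "d * int s > 0" using assms(2) that by (simp add: d_def)
    ultimately show False by simp
  qed
  then have "degree (coeff P ?l) = 0" by (metis gr0I leading_coeff_0_iff degree_0)
  moreover have "coeff (coeff (swap_vars P) 0) ?l \<noteq> 0" using assms(2) by (metis leading_coeff_0_iff degree_0 not_less_zero)
  then have "coeff P ?l \<noteq> 0" by (auto simp: coeff_swap_vars)
  ultimately show False using dvd_imp_degree_le[of "[:-z, 1:]" "coeff P ?l"] by simp
qed

lemma coprime_xlin_ylin: "coprime (xlin z ^ k) (ylin z' ^ l)"
proof -
  have "\<not> xlin z dvd ylin z'"
  proof
    assume "xlin z dvd ylin z'"
    then have "[:-z, 1:] dvd coeff (ylin z') 1" unfolding const_poly_dvd_iff by blast
    then show False using dvd_imp_degree_le[of "[:-z, 1:]" 1] by simp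
  qed
  then have "coprime (xlin z) (ylin z')" by (rule prime_elem_imp_coprime[OF prime_elem_xlin])
  then show ?thesis by simp
qed


text \<open>The two alternatives are a triangle and a rectangle as Newton polygon. In each, the edge
  analysis yields a divisor that already fills the polygon, so the cofactor is constant.\<close>

lemma mu_poly_dvd_power_classification:
  fixes P :: bipoly
  assumes c00: "coeff (coeff P 0) 0 \<noteq> 0" and c10: "coeff (coeff P 0) 1 \<noteq> 0" and c01: "coeff (coeff P 1) 0 \<noteq> 0"
    and mu_dvd: "mu_poly P dvd P ^ N * [:[:0, 1:]:] ^ i * [:0, 1:] ^ j"
    and bound: "edge_bound P" "edge_bound (swap_vars P)"
  shows "(\<exists>\<alpha> \<beta> \<gamma> c n. \<beta> \<noteq> 0 \<and> \<gamma> \<noteq> 0 \<and> c \<noteq> 0 \<and> n > 0 \<and> P = [:[:c:]:] * [:[:\<alpha>, \<beta>:], [:\<gamma>:]:] ^ n) \<or>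
    (\<exists>z z' c k l. z \<noteq> 0 \<and> z' \<noteq> 0 \<and> c \<noteq> 0 \<and> k > 0 \<and> l > 0 \<and> P = [:[:c:]:] * (xlin z ^ k * ylin z' ^ l))"
proof -
  define q r where "q = coeff P 0" and "r = coeff P 1"
  define P' where "P' = swap_vars P"
  define q' r' where "q' = coeff P' 0" and "r' = coeff P' 1"
  have co: "coeff (coeff P' i) j = coeff (coeff P j) i" for i j by (simp add: P'_def coeff_swap_vars)
  have deg: "degree q > 0" "degree q' > 0"
    using c10 c01 le_degree[of q 1] le_degree[of q' 1] by (auto simp: q_def q'_def co)
  have mu': "mu_poly P' dvd P' ^ N * [:[:0, 1:]:] ^ j * [:0, 1:] ^ i"
    using mu_dvd swap_vars_dvd_iff[of "mu_poly P" "P ^ N * [:[:0, 1:]:] ^ i * [:0, 1:] ^ j"]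
    by (simp add: swap_vars_mu_poly swap_vars_mult swap_vars_power swap_vars_lin P'_def mult_ac
        del: mult_pCons_left mult_pCons_right)
  obtain z c where z: "z \<noteq> 0" and a1: "\<not> xlin z dvd P \<Longrightarrow> degree r < degree q"
    and a2: "\<not> xlin z dvd P \<Longrightarrow> Suc (degree r) = degree q \<Longrightarrow> \<exists>f. prime_elem f \<and> f ^ degree q dvd P"
    and a3: "\<And>z'. xlin z dvd P \<Longrightarrow> ylin z' dvd P \<Longrightarrow> z' \<noteq> 0 \<Longrightarrow> degree r \<le> degree q"
    and a4: "\<And>z'. xlin z dvd P \<Longrightarrow> ylin z' dvd P \<Longrightarrow> z' \<noteq> 0 \<Longrightarrow> degree r = degree q \<Longrightarrow> xlin z ^ degree q dvd P"
    using edge_analysis[of P N i j] c00 c10 c01 deg(1) mu_dvd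
    unfolding q_def r_def poly_0_coeff_0 One_nat_def by metis
  obtain z' c' where z': "z' \<noteq> 0" and b1: "\<not> xlin z' dvd P' \<Longrightarrow> degree r' < degree q'"
    and b3: "\<And>z. xlin z' dvd P' \<Longrightarrow> ylin z dvd P' \<Longrightarrow> z \<noteq> 0 \<Longrightarrow> degree r' \<le> degree q'"
    and b4: "\<And>z. xlin z' dvd P' \<Longrightarrow> ylin z dvd P' \<Longrightarrow> z \<noteq> 0 \<Longrightarrow> degree r' = degree q' \<Longrightarrow> xlin z' ^ degree q' dvd P'"
    using edge_analysis[of P' N j i] c00 c10 c01 deg(2) mu'
    unfolding q'_def r'_def poly_0_coeff_0 One_nat_def co by metis
  have e1: "int s + (int (degree q) - int (degree r)) * int t \<le> int (degree q)" if "coeff (coeff P t) s \<noteq> 0" for s t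
    using bound(1) that by (simp add: edge_bound_def q_def r_def)
  have e2: "int t + (int (degree q') - int (degree r')) * int s \<le> int (degree q')" if "coeff (coeff P t) s \<noteq> 0" for s t
    using bound(2) that by (simp add: edge_bound_def q'_def r'_def co flip: P'_def)
  have nx: "degree r' < degree q' \<Longrightarrow> \<not> xlin z dvd P"
    using not_xlin_dvd[OF bound(2)] by (simp add: q'_def r'_def P'_def)
  have nx': "degree r < degree q \<Longrightarrow> \<not> xlin z' dvd P'"
    using not_xlin_dvd[of P'] bound(1) by (simp add: q_def r_def P'_def)
  have q0: "q \<noteq> 0" "q' \<noteq> 0" using deg by auto
  have P0: "P \<noteq> 0" using c00 by auto
  \<comment> \<open>The far end of the second edge is a support point; testing the first edge's
    bound on it compares the two edge lengths.\<close>
  have top: "coeff (coeff P (degree q')) 0 \<noteq> 0"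
    using q0 unfolding co[symmetric] by (simp flip: q'_def)
  show ?thesis
  proof (cases "xlin z dvd P")
    case False
    then have d1: "degree r < degree q" by (rule a1)
    then have "\<not> xlin z' dvd P'" by (rule nx')
    then have d2: "degree r' < degree q'" by (rule b1)
    define l where "l = degree q'"
    have "(int (degree q) - int (degree r)) * int l \<le> int (degree q)"
      using e1[OF top] by (simp add: l_def)
    moreover have "1 * int l \<le> (int (degree q) - int (degree r)) * int l"
      using d1 by (intro mult_right_mono) auto
    moreover have "(int (degree q') - int (degree r')) * int (degree q) \<le> int l"
      using e2[of 0 "degree q"] q0 by (simp add: l_def flip: q_def)
    moreover have "1 * int (degree q) \<le> (int (degree q') - int (degree r')) * int (degree q)"
      using d2 by (intro mult_right_mono) auto
    ultimately have ql: "degree q = l" and m: "(int (degree q) - int (degree r)) * int l = int l"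
      by linarith+
    then have "int (degree q) - int (degree r) = 1" using deg by (simp add: l_def)
    then have "Suc (degree r) = degree q" by linarith
    then obtain f where f: "prime_elem f" and "f ^ l dvd P" using a2[OF False] ql by auto
    then obtain g where g: "P = f ^ l * g" by blast
    have l0: "l > 0" using deg by (simp add: l_def)
    have "degree P \<le> l"
    proof (rule degree_le, intro allI impI)
      fix t assume "l < t"
      show "coeff P t = 0"
      proof (rule poly_eqI)
        fix s show "coeff (coeff P t) s = coeff 0 s"
          using e1[of t s] \<open>l < t\<close> \<open>int (degree q) - int (degree r) = 1\<close> ql by (cases "coeff (coeff P t) s = 0") auto
      qed
    qed
    moreover have "degree P \<ge> l" using top by (intro le_degree) (auto simp: l_def)
    ultimately have dP: "degree P = l" by simp
    have "degree (coeff P l) = 0"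
    proof (rule ccontr)
      assume n: "degree (coeff P l) \<noteq> 0"
      then have "coeff (coeff P l) (degree (coeff P l)) \<noteq> 0" by (metis degree_0 leading_coeff_0_iff)
      from e1[OF this] n \<open>int (degree q) - int (degree r) = 1\<close> ql show False by simp
    qed
    \<comment> \<open>The top row of the triangle is the point (0, l), so P has a constant leading
      coefficient in y. The same holds for f and g, and l = l deg f + deg g leaves only deg f =
      1.\<close>
    then have lc: "degree (lead_coeff f ^ l * lead_coeff g) = 0"
      using dP g by (metis lead_coeff_mult lead_coeff_power)
    have f0: "f \<noteq> 0" and g0: "g \<noteq> 0" using P0 g l0 by (auto simp: power_0_left)
    have lcf: "degree (lead_coeff f) = 0" and lcg: "degree (lead_coeff g) = 0"
      using lc f0 g0 l0 by (simp_all add: degree_mult_eq degree_power_eq)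
    have dfg: "l = l * degree f + degree g"
      using dP g f0 g0 by (simp add: degree_mult_eq degree_power_eq)
    have "degree f \<noteq> 0"
    proof
      assume "degree f = 0"
      then obtain a where a: "f = [:a:]" using degree_eq_zeroE by blast
      then have "degree a = 0" "a \<noteq> 0" using lcf f0 by auto
      then have "is_unit f" unfolding a by (simp add: is_unit_const_poly_iff is_unit_iff_degree)
      then show False using f prime_elem_not_unit by blast
    qed
    moreover have "degree f \<le> 1"
    proof (rule ccontr)
      assume "\<not> degree f \<le> 1"
      then have "l * 2 \<le> l * degree f" by (intro mult_left_mono) auto
      then show False using dfg l0 by linarith
    qed
    ultimately have df: "degree f = 1" by linarith
    then have dg: "degree g = 0" using dfg by simp
    then obtain b where b: "g = [:b:]" using degree_eq_zeroE by blast
    then have "degree b = 0" using lcg by simp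
    then obtain c where gc: "g = [:[:c:]:]" using b degree_eq_zeroE by blast
    then have c0: "c \<noteq> 0" using g0 by auto
    have "degree (coeff f 1) = 0" "coeff f 1 \<noteq> 0" using lcf df f0 leading_coeff_0_iff[of f] by auto
    then obtain \<gamma> where \<gamma>: "coeff f 1 = [:\<gamma>:]" "\<gamma> \<noteq> 0" using degree_eq_zeroE by (metis pCons_0_0)
    have f1: "f = [:coeff f 0, [:\<gamma>:]:]"
      by (rule poly_eqI) (use df \<gamma> in \<open>auto simp: coeff_pCons coeff_eq_0 split: nat.split\<close>)
    have "q = coeff f 0 ^ l * [:c:]" unfolding q_def g gc coeff_01_mult coeff_0_power by simp
    then have "l = l * degree (coeff f 0)" using ql q0 c0 by (auto simp: degree_power_eq l0)
    then have d0: "degree (coeff f 0) = 1" using l0 by simp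
    define \<alpha> \<beta> where "\<alpha> = coeff (coeff f 0) 0" and "\<beta> = coeff (coeff f 0) 1"
    have f2: "coeff f 0 = [:\<alpha>, \<beta>:]"
      by (rule poly_eqI) (use d0 in \<open>auto simp: \<alpha>_def \<beta>_def coeff_pCons coeff_eq_0 split: nat.split\<close>)
    have "\<beta> \<noteq> 0" using d0 leading_coeff_0_iff[of "coeff f 0"] by (auto simp: \<beta>_def)
    moreover have "P = [:[:c:]:] * [:[:\<alpha>, \<beta>:], [:\<gamma>:]:] ^ l"
      unfolding g gc by (subst f1) (simp only: f2 mult.commute)
    ultimately show ?thesis using \<gamma>(2) c0 l0 by (intro disjI1 exI conjI)
  next
    case xd: True
    \<comment> \<open>Divisibility by x - z bounds d' above by 0, and then in the exchanged
      coordinates also d. The edge analysis gives the reverse bounds, so both vanish.\<close>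
    then have "\<not> degree r' < degree q'" using nx by blast
    then have xd': "xlin z' dvd P'" using b1 by blast
    then have "\<not> degree r < degree q" using nx' by blast
    have yd: "ylin z' dvd P" using xd' swap_vars_dvd_iff[of "ylin z'" P] by (simp add: swap_vars_lin P'_def)
    have yd': "ylin z dvd P'" using xd swap_vars_dvd_iff[of "xlin z" P] by (simp add: swap_vars_lin P'_def)
    have r: "degree r = degree q" using a3[OF xd yd z'] \<open>\<not> degree r < degree q\<close> by simp
    have r': "degree r' = degree q'" using b3[OF xd' yd' z] \<open>\<not> degree r' < degree q'\<close> by simp
    define k l where "k = degree q" and "l = degree q'"
    have "xlin z ^ k dvd P" unfolding k_def by (rule a4[OF xd yd z' r])
    moreover have "ylin z' ^ l dvd P"
      using b4[OF xd' yd' z r'] swap_vars_dvd_iff[of "ylin z' ^ l" P]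
      by (simp add: swap_vars_power swap_vars_lin P'_def l_def)
    ultimately have "xlin z ^ k * ylin z' ^ l dvd P" by (rule divides_mult) (rule coprime_xlin_ylin)
    then obtain g where g: "P = xlin z ^ k * ylin z' ^ l * g" by blast
    have g0: "g \<noteq> 0" using P0 g by auto
    have "degree P \<le> l"
    proof (rule degree_le, intro allI impI)
      fix t assume "l < t"
      show "coeff P t = 0"
      proof (rule poly_eqI)
        fix s show "coeff (coeff P t) s = coeff 0 s"
          using e2[of t s] \<open>l < t\<close> r' by (cases "coeff (coeff P t) s = 0") (auto simp: l_def)
      qed
    qed
    moreover have "degree P = l + degree g"
      unfolding g using g0 by (simp add: degree_mult_eq degree_power_eq del: mult_pCons_left mult_pCons_right)
    ultimately have "degree g = 0" by simp
    then obtain b where b: "g = [:b:]" using degree_eq_zeroE by blast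
    have b0: "b \<noteq> 0" using b g0 by auto
    have "q = [:-z, 1:] ^ k * [:-z':] ^ l * b"
      unfolding q_def g b coeff_01_mult coeff_0_power by simp
    then have "k = degree ([:-z, 1:] ^ k * [:-z':] ^ l * b)" unfolding k_def by (rule arg_cong)
    also have "\<dots> = k + degree b" using b0 z' by (simp add: degree_mult_eq degree_power_eq)
    finally have "k = k + degree b" .
    then obtain c where c: "b = [:c:]" using degree_eq_zeroE by auto
    have P: "P = [:[:c:]:] * (xlin z ^ k * ylin z' ^ l)" unfolding g b c by (simp only: mult_ac)
    have c0: "c \<noteq> 0" using b0 c by auto
    have kl: "k > 0" "l > 0" using deg by (simp_all add: k_def l_def)
    show ?thesis by (rule disjI2) (intro exI conjI, (rule z z' c0 kl P)+)
  qed
qed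

section \<open>Rational maps of degree one\<close>

definition ratfun_eval :: "ratfun \<Rightarrow> ratfun \<Rightarrow> bipoly \<Rightarrow> ratfun" where
  "ratfun_eval X Y P = poly (map_poly (\<lambda>c. poly (map_poly ratC c) X) P) Y"

lemma ratfun_eval_pCons:
  "ratfun_eval X Y (pCons c P) = poly (map_poly ratC c) X + Y * ratfun_eval X Y P" "ratfun_eval X Y 0 = 0"
  by (simp_all add: ratfun_eval_def map_poly_pCons ratC_hom)

lemma ratfun_eval_const: "ratfun_eval X Y [:[:a:]:] = ratC a"
  by (simp add: ratfun_eval_def map_poly_pCons ratC_hom)

lemma ratfun_eval_1 [simp]: "ratfun_eval X Y 1 = 1"
  using ratfun_eval_const[of X Y 1] by (simp add: ratC_hom flip: one_pCons)

lemma ratfun_eval_X [simp]: "ratfun_eval X Y [:[:0, 1:]:] = X"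
  and ratfun_eval_Y [simp]: "ratfun_eval X Y [:0, 1:] = Y"
  by (simp_all add: ratfun_eval_def map_poly_pCons ratC_hom flip: one_pCons)

lemma ratfun_eval_add: "ratfun_eval X Y (P + Q) = ratfun_eval X Y P + ratfun_eval X Y Q"
  and ratfun_eval_mult: "ratfun_eval X Y (P * Q) = ratfun_eval X Y P * ratfun_eval X Y Q"
proof -
  let ?h = "\<lambda>c. poly (map_poly ratC c) X"
  have h: "?h (c + d) = ?h c + ?h d" "?h (c * d) = ?h c * ?h d" for c d
    by (simp_all add: map_poly_ring_hom[of ratC] ratC_hom)
  show "ratfun_eval X Y (P + Q) = ratfun_eval X Y P + ratfun_eval X Y Q"
    "ratfun_eval X Y (P * Q) = ratfun_eval X Y P * ratfun_eval X Y Q"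
    unfolding ratfun_eval_def map_poly_ring_hom[of ?h, OF h] by simp_all
qed

lemma ratfun_eval_power: "ratfun_eval X Y (P ^ n) = ratfun_eval X Y P ^ n"
  by (induction n) (simp_all add: ratfun_eval_mult)

lemma ratfun_eval_diff: "ratfun_eval X Y (P - Q) = ratfun_eval X Y P - ratfun_eval X Y Q"
  using ratfun_eval_add[of X Y "P - Q" Q] by simp

lemma ratfun_eval_sum: "ratfun_eval X Y (\<Sum>i\<in>I. f i) = (\<Sum>i\<in>I. ratfun_eval X Y (f i))"
  by (induction I rule: infinite_finite_induct) (simp_all add: ratfun_eval_pCons ratfun_eval_add)

text \<open>The chain rule for derivations that kill the constants.\<close>

lemma derivation_ratfun_eval:
  assumes T: "is_derivation T" and C: "\<And>c. T (ratC c) = 0"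
  shows "T (ratfun_eval X Y P) =
    ratfun_eval X Y (map_poly pderiv P) * T X + ratfun_eval X Y (pderiv P) * T Y"
proof -
  let ?h = "\<lambda>c. poly (map_poly ratC c) X"
  have h_add: "?h (c + d) = ?h c + ?h d" for c d
    by (simp add: map_poly_ring_hom[of ratC] ratC_hom)
  have const: "T (?h c) = ?h (pderiv c) * T X" for c
    by (induction c) (simp_all add: derivation_0[OF T] derivation_add[OF T] derivation_mult[OF T] C
        map_poly_pCons pderiv_pCons h_add ratC_hom algebra_simps)
  show ?thesis
    by (induction P) (simp_all add: derivation_0[OF T] derivation_add[OF T] derivation_mult[OF T] const
        ratfun_eval_pCons ratfun_eval_add map_poly_pCons pderiv_pCons ratC_hom algebra_simps)
qed

definition jacobian :: "ratfun \<Rightarrow> ratfun \<Rightarrow> ratfun" where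
  "jacobian X Y = Theta1 X * Theta2 Y - Theta1 Y * Theta2 X"

text \<open>Applying both Euler derivations to the relation gives a homogeneous linear system for
  the partial derivatives. Its determinant is \<open>jacobian X Y\<close>, so Cramer's rule
  applies.\<close>

lemma ratfun_eval_partial_zero:
  assumes J: "jacobian X Y \<noteq> 0" and 0: "ratfun_eval X Y P = 0"
  shows "ratfun_eval X Y (map_poly pderiv P) = 0" "ratfun_eval X Y (pderiv P) = 0"
proof -
  let ?a = "ratfun_eval X Y (map_poly pderiv P)" and ?b = "ratfun_eval X Y (pderiv P)"
  have eqs: "?a * Theta1 X + ?b * Theta1 Y = 0" "?a * Theta2 X + ?b * Theta2 Y = 0"
    using derivation_ratfun_eval[OF Theta1_derivation Theta_generators(1), of X Y P]
      derivation_ratfun_eval[OF Theta2_derivation Theta_generators(4), of X Y P] 0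
    by (simp_all add: derivation_0 Theta1_derivation Theta2_derivation)
  have "?a * jacobian X Y = (?a * Theta1 X + ?b * Theta1 Y) * Theta2 Y - (?a * Theta2 X + ?b * Theta2 Y) * Theta1 Y"
    "?b * jacobian X Y = (?a * Theta2 X + ?b * Theta2 Y) * Theta1 X - (?a * Theta1 X + ?b * Theta1 Y) * Theta2 X"
    by (simp_all add: jacobian_def algebra_simps)
  then show "?a = 0" "?b = 0" unfolding eqs using J by simp_all
qed

text \<open>
  A relation of minimal degree between \<open>X\<close> and \<open>Y\<close> has a partial derivative that is a relation of
  smaller degree.
\<close>
lemma ratfun_eval_nonzero:
  assumes J: "jacobian X Y \<noteq> 0" and "P \<noteq> 0"
  shows "ratfun_eval X Y P \<noteq> 0"
proof
  assume "ratfun_eval X Y P = 0"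
  have const: "c = 0" if "ratfun_eval X Y [:c:] = 0" for c
    using that
  proof (induction "degree c" arbitrary: c)
    case 0
    then obtain a where "c = [:a:]" by (metis degree_eq_zeroE)
    with 0 have "ratC a = 0" by (simp add: ratfun_eval_const)
    then show ?case using \<open>c = [:a:]\<close> by (simp add: ratC_def)
  next
    case (Suc n)
    have "ratfun_eval X Y [:pderiv c:] = 0"
      using ratfun_eval_partial_zero(1)[OF J Suc.prems] by (simp add: map_poly_pCons)
    then have "pderiv c = 0" using Suc.hyps(1)[of "pderiv c"] Suc.hyps(2) by (simp add: degree_pderiv)
    then show ?case using Suc.hyps(2) by (simp add: pderiv_eq_0_iff)
  qed
  have "P = 0" using \<open>ratfun_eval X Y P = 0\<close>
  proof (induction "degree P" arbitrary: P)
    case 0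
    then obtain c where "P = [:c:]" by (metis degree_eq_zeroE)
    with 0 const show ?case by simp
  next
    case (Suc n)
    have "ratfun_eval X Y (pderiv P) = 0" using ratfun_eval_partial_zero(2)[OF J Suc.prems] .
    then have "pderiv P = 0" using Suc.hyps(1)[of "pderiv P"] Suc.hyps(2) by (simp add: degree_pderiv)
    then show ?case using Suc.hyps(2) by (simp add: pderiv_eq_0_iff)
  qed
  with assms show False by simp
qed

section \<open>Subfields of the function field and pullbacks\<close>

definition is_subfield :: "ratfun set \<Rightarrow> bool" where
  "is_subfield S \<longleftrightarrow> (\<forall>u\<in>S. \<forall>v\<in>S. u + v \<in> S \<and> u * v \<in> S) \<and> (\<forall>u\<in>S. inverse u \<in> S) \<and> range ratC \<subseteq> S"

lemma is_subfieldD: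
  assumes "is_subfield S"
  shows "u \<in> S \<Longrightarrow> v \<in> S \<Longrightarrow> u + v \<in> S" "u \<in> S \<Longrightarrow> v \<in> S \<Longrightarrow> u * v \<in> S" "u \<in> S \<Longrightarrow> inverse u \<in> S"
    "ratC c \<in> S" "u \<in> S \<Longrightarrow> v \<in> S \<Longrightarrow> u - v \<in> S" "u \<in> S \<Longrightarrow> v \<in> S \<Longrightarrow> u / v \<in> S" "of_int k \<in> S"
    "u \<in> S \<Longrightarrow> u powi k \<in> S" "1 \<in> S"
proof -
  show a: "u \<in> S \<Longrightarrow> v \<in> S \<Longrightarrow> u + v \<in> S" and m: "u \<in> S \<Longrightarrow> v \<in> S \<Longrightarrow> u * v \<in> S"
    and i: "u \<in> S \<Longrightarrow> inverse u \<in> S" and c: "ratC c \<in> S" for u v c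
    using assms by (auto simp: is_subfield_def)
  have n: "- 1 \<in> S" using c[of "of_int (- 1)"] unfolding of_int_ratfun[symmetric] by simp
  show "u \<in> S \<Longrightarrow> v \<in> S \<Longrightarrow> u - v \<in> S" using a[OF _ m[OF n], of u v] by simp
  show "u \<in> S \<Longrightarrow> v \<in> S \<Longrightarrow> u / v \<in> S" using m[OF _ i, of u v] by (simp add: divide_inverse)
  show "of_int k \<in> S" unfolding of_int_ratfun by (rule c)
  show 1: "1 \<in> S" using c[of 1] by (simp add: ratC_hom)
  have p: "u \<in> S \<Longrightarrow> u ^ n \<in> S" for u n by (induction n) (simp_all add: 1 m)
  show "u \<in> S \<Longrightarrow> u powi k \<in> S" by (simp add: power_int_def p i)
qed

lemma is_subfield_UNIV:
  assumes S: "is_subfield S" and XY: "ratX \<in> S" "ratY \<in> S"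
  shows "S = UNIV"
proof -
  have const: "to_fract [:c:] \<in> S" for c
  proof (induction c)
    case 0 then show ?case using is_subfieldD(4)[OF S, of 0] by (simp add: ratC_hom)
  next
    case (pCons a c)
    have "to_fract [:pCons a c:] = ratC a + ratX * to_fract [:c:]"
      by (simp add: ratC_def ratX_def flip: to_fract_add to_fract_mult)
    then show ?case using is_subfieldD[OF S] XY pCons.IH by simp
  qed
  have poly: "to_fract P \<in> S" for P
  proof (induction P)
    case 0 then show ?case using const[of 0] by simp
  next
    case (pCons c P)
    have "to_fract (pCons c P) = to_fract [:c:] + ratY * to_fract P"
      by (simp add: ratY_def flip: to_fract_add to_fract_mult)
    then show ?case using is_subfieldD[OF S] XY pCons.IH const by simp
  qed
  have "q \<in> S" for q
  proof (cases q)
    case (Fract a b)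
    then have "q = to_fract a / to_fract b" by (simp add: to_fract_def)
    then show ?thesis using is_subfieldD(6)[OF S] poly by simp
  qed
  then show ?thesis by blast
qed

text \<open>Injectivity of the substitution lets it extend to fractions; cross-multiplication shows
  that the chosen value is independent of the representative.\<close>

lemma is_pullback_exists:
  assumes nz: "\<And>P. P \<noteq> 0 \<Longrightarrow> ratfun_eval f g P \<noteq> 0"
  shows "\<exists>\<phi>. is_pullback f g \<phi>"
proof -
  let ?e = "ratfun_eval f g"
  define \<phi> where "\<phi> = (\<lambda>q. SOME r. \<exists>a b. b \<noteq> 0 \<and> q = Fraction_Field.Fract a b \<and> r = ?e a / ?e b)"
  have \<phi>: "\<phi> (Fraction_Field.Fract a b) = ?e a / ?e b" if b: "b \<noteq> 0" for a b
    unfolding \<phi>_def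
  proof (rule some_equality)
    show "\<exists>a' b'. b' \<noteq> 0 \<and> Fraction_Field.Fract a b = Fraction_Field.Fract a' b' \<and> ?e a / ?e b = ?e a' / ?e b'"
      using b by blast
  next
    fix r assume "\<exists>a' b'. b' \<noteq> 0 \<and> Fraction_Field.Fract a b = Fraction_Field.Fract a' b' \<and> r = ?e a' / ?e b'"
    then obtain a' b' where b': "b' \<noteq> 0" and eq: "Fraction_Field.Fract a b = Fraction_Field.Fract a' b'"
      and r: "r = ?e a' / ?e b'" by blast
    have "a * b' = a' * b" using eq b b' by (simp add: eq_fract)
    then have "?e a * ?e b' = ?e a' * ?e b" by (simp flip: ratfun_eval_mult)
    then show "r = ?e a / ?e b" unfolding r using nz[OF b] nz[OF b'] by (simp add: field_simps)
  qed
  have "is_pullback f g \<phi>"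
    unfolding is_pullback_def
  proof (intro conjI allI)
    fix h k :: ratfun
    obtain a b where h: "h = Fraction_Field.Fract a b" "b \<noteq> 0" by (cases h)
    obtain c d where k: "k = Fraction_Field.Fract c d" "d \<noteq> 0" by (cases k)
    show "\<phi> (h + k) = \<phi> h + \<phi> k" "\<phi> (h * k) = \<phi> h * \<phi> k"
      using h k nz[OF h(2)] nz[OF k(2)] by (simp_all add: \<phi> ratfun_eval_add ratfun_eval_mult field_simps)
  next
    show "\<phi> (ratC c) = ratC c" for c
      using \<phi>[of 1 "[:[:c:]:]"] by (simp add: ratC_def to_fract_def ratfun_eval_const)
    show "\<phi> ratX = f" using \<phi>[of 1 "[:[:0, 1:]:]"] by (simp add: ratX_def to_fract_def)
    show "\<phi> ratY = g" using \<phi>[of 1 "[:0, 1:]"] by (simp add: ratY_def to_fract_def)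
  qed
  then show ?thesis by blast
qed

lemma is_pullbackD:
  assumes "is_pullback f g \<phi>"
  shows "\<phi> (h + k) = \<phi> h + \<phi> k" "\<phi> (h * k) = \<phi> h * \<phi> k" "\<phi> (ratC c) = ratC c" "\<phi> ratX = f" "\<phi> ratY = g"
    "\<phi> 0 = 0" "\<phi> 1 = 1" "\<phi> (inverse h) = inverse (\<phi> h)"
proof -
  show m: "\<phi> (h * k) = \<phi> h * \<phi> k" and "\<phi> (h + k) = \<phi> h + \<phi> k" "\<phi> (ratC c) = ratC c" "\<phi> ratX = f" "\<phi> ratY = g" for h k c
    using assms by (simp_all add: is_pullback_def)
  then show 0: "\<phi> 0 = 0" and 1: "\<phi> 1 = 1" by (metis ratC_hom(3), metis ratC_hom(4))
  show "\<phi> (inverse h) = inverse (\<phi> h)"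
  proof (cases "h = 0")
    case False
    then have "\<phi> h * \<phi> (inverse h) = 1" using m[of h "inverse h"] 1 by simp
    then show ?thesis by (metis inverse_unique)
  qed (simp add: 0)
qed

text \<open>The Jacobian makes f and g algebraically independent, so a pullback exists. Two
  pullbacks agree on a subfield containing x and y, hence everywhere. The image of the pullback is a
  subfield containing f and g, so \<open>gen\<close> makes it everything and {1} is a basis.\<close>

lemma rational_map_degree_eq_1:
  assumes J: "jacobian f g \<noteq> 0"
    and gen: "\<And>S. is_subfield S \<Longrightarrow> f \<in> S \<Longrightarrow> g \<in> S \<Longrightarrow> ratX \<in> S \<and> ratY \<in> S"
  shows "rational_map_degree f g = 1"
proof -
  obtain \<phi> where \<phi>: "is_pullback f g \<phi>"
    using is_pullback_exists[OF ratfun_eval_nonzero[OF J]] by blast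
  note \<phi>D = is_pullbackD[OF \<phi>]
  have uniq: "\<psi> = \<phi>" if \<psi>: "is_pullback f g \<psi>" for \<psi>
  proof -
    have "is_subfield {u. \<psi> u = \<phi> u}"
      by (auto simp: is_subfield_def \<phi>D is_pullbackD[OF \<psi>])
    then have "{u. \<psi> u = \<phi> u} = UNIV"
      by (rule is_subfield_UNIV) (simp_all add: \<phi>D is_pullbackD[OF \<psi>])
    then show ?thesis by auto
  qed
  have the: "(THE \<phi>. is_pullback f g \<phi>) = \<phi>" using \<phi> uniq by blast
  have "is_subfield (range \<phi>)"
    unfolding is_subfield_def
  proof (intro conjI ballI subsetI)
    fix u v assume "u \<in> range \<phi>" "v \<in> range \<phi>"
    then obtain a b where "u = \<phi> a" "v = \<phi> b" by blast
    then have "u + v = \<phi> (a + b)" "u * v = \<phi> (a * b)" by (simp_all add: \<phi>D)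
    then show "u + v \<in> range \<phi>" "u * v \<in> range \<phi>" by simp_all
  next
    fix u assume "u \<in> range \<phi>"
    then obtain a where "u = \<phi> a" by blast
    then have "inverse u = \<phi> (inverse a)" by (simp add: \<phi>D)
    then show "inverse u \<in> range \<phi>" by simp
  next
    fix u assume "u \<in> range ratC"
    then obtain c where "u = ratC c" by blast
    then have "u = \<phi> (ratC c)" by (simp add: \<phi>D)
    then show "u \<in> range \<phi>" by simp
  qed
  moreover have "f \<in> range \<phi>" "g \<in> range \<phi>" unfolding \<phi>D(4,5)[symmetric] by simp_all
  ultimately have "ratX \<in> range \<phi> \<and> ratY \<in> range \<phi>" "is_subfield (range \<phi>)" using gen by simp_all
  then have surj: "range \<phi> = UNIV" by (intro is_subfield_UNIV) auto
  interpret V: vector_space "\<lambda>h k. \<phi> h * k"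
    by unfold_locales (simp_all add: \<phi>D algebra_simps)
  have "V.dim (UNIV :: ratfun set) = 1"
  proof (rule V.dim_unique)
    show "UNIV \<subseteq> V.span {1}" using surj by (auto simp: V.span_singleton)
    show "V.independent {1 :: ratfun}" by (simp add: V.dependent_single)
  qed auto
  then show ?thesis using \<phi> by (auto simp: rational_map_degree_def the)
qed

section \<open>Monomial coordinates\<close>

abbreviation mon :: "int \<times> int \<Rightarrow> ratfun" where "mon a \<equiv> ratmon a 1"

lemma mon_add: "mon (a + b) = mon a * mon b"
  using ratmon_mult[of a b 1 1] by simp

lemma mon_nonzero [simp]: "mon a \<noteq> 0"
  by (simp add: ratmon_def ratC_hom)

lemma mon_zscale: "mon (zscale k w) = mon w powi k"
  by (simp add: ratmon_def ratC_hom zscale_def power_int_mult_distrib mult.commute flip: power_int_mult)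

lemma ratmon_eq: "ratmon a c = ratC c * mon a"
  by (simp add: ratmon_def ratC_hom)

lemma ratX_ratY_eq_mon: "ratX = mon (1, 0)" "ratY = mon (0, 1)"
  by (simp_all add: ratmon_def ratC_hom)

lemma Theta_mon: "Theta1 (mon a) = of_int (fst a) * mon a" "Theta2 (mon a) = of_int (snd a) * mon a"
  unfolding Theta_ratmon ratmon_eq[of a "of_int _ * 1"] by (simp_all add: of_int_ratfun)

lemma Theta_of_int: "Theta1 (of_int k) = 0" "Theta2 (of_int k) = 0"
  by (simp_all add: of_int_ratfun Theta_generators)

text \<open>Clearing denominators in the definition. The mixed derivatives are kept in both orders;
  for polynomials in monomial coordinates they agree by \<open>theta_y_theta_x\<close>.\<close>

lemma mu_ratfun_expand:
  assumes f0: "f \<noteq> 0"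
  shows "mu_ratfun f = f * (Theta1 (Theta1 f) * Theta2 (Theta2 f) - Theta1 (Theta2 f) * Theta2 (Theta1 f)) -
    (Theta1 (Theta1 f) * (Theta2 f)\<^sup>2 + Theta2 (Theta2 f) * (Theta1 f)\<^sup>2
      - (Theta1 (Theta2 f) + Theta2 (Theta1 f)) * Theta1 f * Theta2 f)"
proof -
  define A B C E where "A = Theta1 (Theta1 f)" and "B = Theta1 (Theta2 f)"
    and "C = Theta2 (Theta1 f)" and "E = Theta2 (Theta2 f)"
  define g h where "g = Theta1 f" and "h = Theta2 f"
  note d = derivation_divide[OF Theta1_derivation f0] derivation_divide[OF Theta2_derivation f0]
  have "mu_ratfun f = f ^ 3 * ((A * f - g * g) / f ^ 2 * ((E * f - h * h) / f ^ 2) -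
      (B * f - h * g) / f ^ 2 * ((C * f - g * h) / f ^ 2))"
    by (simp add: mu_ratfun_def d A_def B_def C_def E_def g_def h_def)
  also have "\<dots> = f ^ 3 * (((A * f - g * g) * (E * f - h * h) - (B * f - h * g) * (C * f - g * h)) / f ^ 4)"
    by (simp flip: power_add add: diff_divide_distrib[symmetric])
  also have "(A * f - g * g) * (E * f - h * h) - (B * f - h * g) * (C * f - g * h) =
      f * (f * (A * E - B * C) - (A * h\<^sup>2 + E * g\<^sup>2 - (B + C) * g * h))"
    by algebra
  also have "f ^ 3 * (f * (f * (A * E - B * C) - (A * h\<^sup>2 + E * g\<^sup>2 - (B + C) * g * h)) / f ^ 4) =
      f * (A * E - B * C) - (A * h\<^sup>2 + E * g\<^sup>2 - (B + C) * g * h)"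
    using f0 by (simp add: power_def numeral_eq_Suc)
  finally show ?thesis unfolding A_def B_def C_def E_def g_def h_def .
qed

lemma Theta_mon_mult_quotient:
  assumes "F \<noteq> 0"
  shows "Theta1 (mon e * F) / (mon e * F) = of_int (fst e) + Theta1 F / F"
    "Theta2 (mon e * F) / (mon e * F) = of_int (snd e) + Theta2 F / F"
  using assms by (simp_all add: derivation_mult[OF Theta1_derivation] derivation_mult[OF Theta2_derivation]
      Theta_mon field_simps)

text \<open>A monomial factor shifts the logarithmic derivatives by integer constants, so only the
  outer cube sees it.\<close>

lemma mu_ratfun_mon_mult:
  assumes "F \<noteq> 0"
  shows "mu_ratfun (mon e * F) = mon e ^ 3 * mu_ratfun F"
  unfolding mu_ratfun_def Theta_mon_mult_quotient[OF assms] derivation_add[OF Theta1_derivation]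
    derivation_add[OF Theta2_derivation] Theta_of_int
  by (simp add: power_mult_distrib mult.assoc)

lemma mu_ratfun_jacobian: "mu_ratfun F = F ^ 3 * jacobian (Theta1 F / F) (Theta2 F / F)"
  by (simp add: mu_ratfun_def jacobian_def)

lemma ratfun_of_chi: "ratfun_of (chi a) = mon a"
  by (simp add: chi_def ratfun_of_single)

lemma ratfun_of_1: "ratfun_of 1 = 1"
proof -
  have "ratfun_of (chi 0) = 1" by (simp add: ratfun_of_chi ratmon_def ratC_hom)
  then show ?thesis by (simp add: chi_def)
qed

lemma ratfun_of_power: "ratfun_of (p ^ n) = ratfun_of p ^ n"
  by (induction n) (simp_all add: ratfun_of_1 ratfun_of_mult)

lemma ratfun_eval_monom:
  "ratfun_eval X Y (Polynomial.monom (Polynomial.monom c i) j) = ratC c * X ^ i * Y ^ j"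
proof -
  have "Polynomial.monom (Polynomial.monom c i) j = [:[:c:]:] * [:[:0, 1:]:] ^ i * [:0, 1:] ^ j"
    by (simp add: monom_altdef poly_const_pow smult_smult ac_simps)
  then show ?thesis by (simp only: ratfun_eval_mult ratfun_eval_power ratfun_eval_const ratfun_eval_X ratfun_eval_Y)
qed

section \<open>Unimodular changes of monomial coordinates\<close>

definition lattice_det :: "int \<times> int \<Rightarrow> int \<times> int \<Rightarrow> int" where
  "lattice_det u w = fst u * snd w - fst w * snd u"

locale lattice_basis =
  fixes w1 w2 :: "int \<times> int"
  assumes det: "(lattice_det w1 w2)\<^sup>2 = 1"
begin

definition X where "X = mon w1"
definition Y where "Y = mon w2"
abbreviation "E \<equiv> ratfun_eval X Y"
abbreviation "pt s t \<equiv> zscale s w1 + zscale t w2"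

lemma pt_eq: "pt (lattice_det w1 w2 * lattice_det u w2) (lattice_det w1 w2 * lattice_det w1 u) = u"
proof -
  obtain a b c d u1 u2 where [simp]: "w1 = (a, c)" "w2 = (b, d)" "u = (u1, u2)" by (metis surj_pair)
  have "(a * d - b * c)\<^sup>2 = 1" using det by (simp add: lattice_det_def)
  then show ?thesis unfolding lattice_det_def zscale_def by (simp, intro conjI; algebra)
qed

lemma pt_inject: "pt s t = pt s' t' \<longleftrightarrow> s = s' \<and> t = t'"
proof -
  obtain a b c d where [simp]: "w1 = (a, c)" "w2 = (b, d)" by (metis surj_pair)
  have d: "(a * d - b * c)\<^sup>2 = 1" using det by (simp add: lattice_det_def)
  have "s = s' \<and> t = t'" if "pt s t = pt s' t'"
  proof -
    have e: "s * a + t * b = s' * a + t' * b" "s * c + t * d = s' * c + t' * d"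
      using that by (simp_all add: zscale_def)
    have "(a * d - b * c) * (s - s') = 0" "(a * d - b * c) * (t - t') = 0" using e by algebra+
    moreover have "a * d - b * c \<noteq> 0" using d by auto
    ultimately show ?thesis by simp
  qed
  then show ?thesis by auto
qed

lemma mon_pt: "mon (pt s t) = X powi s * Y powi t"
  by (simp add: mon_add mon_zscale X_def Y_def)

lemma XY_nonzero [simp]: "X \<noteq> 0" "Y \<noteq> 0"
  by (simp_all add: X_def Y_def)

text \<open>This makes X and Y algebraically independent, so that polynomial identities can be
  checked after applying \<open>E\<close>.\<close>

lemma jacobian_XY: "jacobian X Y \<noteq> 0"
proof -
  have "jacobian X Y = of_int (lattice_det w1 w2) * X * Y"
    by (simp add: jacobian_def X_def Y_def Theta_mon lattice_det_def algebra_simps)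
  moreover have "lattice_det w1 w2 \<noteq> 0" using det by auto
  then have "ratC (of_int (lattice_det w1 w2)) \<noteq> 0" by (simp add: ratC_def)
  ultimately show ?thesis by (simp add: of_int_ratfun)
qed

lemma E_eq_0_iff: "E P = 0 \<longleftrightarrow> P = 0"
  using ratfun_eval_nonzero[OF jacobian_XY] by (auto simp: ratfun_eval_pCons)

lemma E_inject: "E P = E Q \<longleftrightarrow> P = Q"
  using E_eq_0_iff[of "P - Q"] by (simp add: ratfun_eval_diff)

lemma Theta_E:
  "Theta1 (E P) = of_int (fst w1) * E (theta_x P) + of_int (fst w2) * E (theta_y P)"
  "Theta2 (E P) = of_int (snd w1) * E (theta_x P) + of_int (snd w2) * E (theta_y P)"
  unfolding derivation_ratfun_eval[OF Theta1_derivation Theta_generators(1)]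
    derivation_ratfun_eval[OF Theta2_derivation Theta_generators(4)]
    theta_x_def theta_y_def ratfun_eval_mult ratfun_eval_X ratfun_eval_Y
  by (simp_all add: X_def Y_def Theta_mon)

text \<open>A monomial change of coordinates transforms the logarithmic Hessian by congruence with
  its exponent matrix, so the determinant is multiplied by the square of
  \<open>lattice_det w1 w2\<close>, which is 1.\<close>

lemma mu_ratfun_E:
  assumes "P \<noteq> 0"
  shows "mu_ratfun (E P) = E (mu_poly P)"
proof -
  define F u v u1 u2 v2 where "F = E P" and "u = E (theta_x P)" and "v = E (theta_y P)"
    and "u1 = E (theta_x (theta_x P))" and "u2 = E (theta_x (theta_y P))" and "v2 = E (theta_y (theta_y P))"
  define a b c d :: ratfun where "a = of_int (fst w1)" and "b = of_int (fst w2)"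
    and "c = of_int (snd w1)" and "d = of_int (snd w2)"
  have det1: "(a * d - b * c)\<^sup>2 = 1"
    using arg_cong[OF det, of "of_int :: int \<Rightarrow> ratfun"] by (simp add: a_def b_def c_def d_def lattice_det_def)
  have T: "Theta1 F = a * u + b * v" "Theta2 F = c * u + d * v"
    "Theta1 u = a * u1 + b * u2" "Theta1 v = a * u2 + b * v2"
    "Theta2 u = c * u1 + d * u2" "Theta2 v = c * u2 + d * v2"
    by (simp_all add: F_def u_def v_def u1_def u2_def v2_def a_def b_def c_def d_def Theta_E theta_y_theta_x)
  have cst: "Theta1 a = 0" "Theta1 b = 0" "Theta1 c = 0" "Theta1 d = 0"
    "Theta2 a = 0" "Theta2 b = 0" "Theta2 c = 0" "Theta2 d = 0"
    by (simp_all add: a_def b_def c_def d_def Theta_of_int)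
  have F0: "F \<noteq> 0" using assms by (simp add: F_def E_eq_0_iff)
  have "mu_ratfun F = F * ((a * (a * u1 + b * u2) + b * (a * u2 + b * v2)) * (c * (c * u1 + d * u2) + d * (c * u2 + d * v2))
      - (c * (a * u1 + b * u2) + d * (a * u2 + b * v2)) * (a * (c * u1 + d * u2) + b * (c * u2 + d * v2)))
    - ((a * (a * u1 + b * u2) + b * (a * u2 + b * v2)) * (c * u + d * v)\<^sup>2
      + (c * (c * u1 + d * u2) + d * (c * u2 + d * v2)) * (a * u + b * v)\<^sup>2
      - ((c * (a * u1 + b * u2) + d * (a * u2 + b * v2)) + (a * (c * u1 + d * u2) + b * (c * u2 + d * v2)))
        * (a * u + b * v) * (c * u + d * v))"
    unfolding mu_ratfun_expand[OF F0] T derivation_add[OF Theta1_derivation] derivation_mult[OF Theta1_derivation]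
      derivation_add[OF Theta2_derivation] derivation_mult[OF Theta2_derivation] cst by simp
  also have "\<dots> = (a * d - b * c)\<^sup>2 * (F * (u1 * v2 - u2\<^sup>2) - (u1 * v\<^sup>2 + v2 * u\<^sup>2 - 2 * u2 * u * v))"
    by algebra
  also have "\<dots> = E (mu_poly P)"
  proof -
    have two: "E 2 = 2" using ratfun_eval_add[of X Y 1 1] by simp
    show ?thesis unfolding det1 mu_poly_def bordered_hess_def F_def u_def v_def u1_def u2_def v2_def
      by (simp add: ratfun_eval_add ratfun_eval_mult ratfun_eval_diff ratfun_eval_power two)
  qed
  finally show ?thesis by (simp add: F_def)
qed

lemma laurent_representation:
  assumes "\<And>a. a \<in> Poly_Mapping.keys h \<Longrightarrow> \<exists>s t :: nat. a = e + pt (int s) (int t)"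
  obtains H where "ratfun_of h = mon e * E H"
    "\<And>s t. coeff (coeff H t) s = Poly_Mapping.lookup h (e + pt (int s) (int t))"
proof -
  let ?K = "Poly_Mapping.keys h" and ?c = "Poly_Mapping.lookup h"
  obtain S T :: "int \<times> int \<Rightarrow> nat" where ST: "a = e + pt (int (S a)) (int (T a))" if "a \<in> ?K" for a
    using assms by metis
  define H where "H = (\<Sum>a\<in>?K. Polynomial.monom (Polynomial.monom (?c a) (S a)) (T a))"
  have "ratfun_of h = (\<Sum>a\<in>?K. ratC (?c a) * mon a)"
    by (subst ratfun_of_superset[of ?K]) (simp_all add: ratmon_eq[of _ "?c _"])
  also have "\<dots> = (\<Sum>a\<in>?K. mon e * (ratC (?c a) * X ^ S a * Y ^ T a))"
  proof (intro sum.cong refl)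
    fix a assume "a \<in> ?K"
    have "mon a = mon e * mon (pt (int (S a)) (int (T a)))"
      unfolding mon_add[symmetric, of e] using ST[OF \<open>a \<in> ?K\<close>] by simp
    also have "mon (pt (int (S a)) (int (T a))) = X ^ S a * Y ^ T a" by (simp add: mon_pt)
    finally show "ratC (?c a) * mon a = mon e * (ratC (?c a) * X ^ S a * Y ^ T a)" by (simp add: mult_ac)
  qed
  also have "\<dots> = mon e * E H" by (simp add: H_def ratfun_eval_sum ratfun_eval_monom sum_distrib_left)
  finally have 1: "ratfun_of h = mon e * E H" .
  have 2: "coeff (coeff H t) s = ?c (e + pt (int s) (int t))" for s t
  proof -
    let ?a = "e + pt (int s) (int t)"
    have "coeff (coeff H t) s = (\<Sum>b\<in>?K. if b = ?a then ?c b else 0)"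
      unfolding H_def coeff_sum
    proof (intro sum.cong refl)
      fix b assume b: "b \<in> ?K"
      have "b = ?a \<longleftrightarrow> pt (int (S b)) (int (T b)) = pt (int s) (int t)"
        by (subst ST[OF b]) simp
      then have "b = ?a \<longleftrightarrow> S b = s \<and> T b = t" unfolding pt_inject by simp
      then show "coeff (coeff (Polynomial.monom (Polynomial.monom (?c b) (S b)) (T b)) t) s = (if b = ?a then ?c b else 0)"
        by auto
    qed
    then show ?thesis by (simp add: in_keys_iff)
  qed
  show ?thesis using that[OF 1 2] .
qed

lemma laurent_shifted_representation: obtains i j H where "ratfun_of h * X ^ i * Y ^ j = E H"
proof -
  let ?K = "Poly_Mapping.keys h"
  define S T where "S = (\<lambda>a. lattice_det w1 w2 * lattice_det a w2)"
    and "T = (\<lambda>a. lattice_det w1 w2 * lattice_det w1 a)"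
  have ST: "a = pt (S a) (T a)" for a unfolding S_def T_def pt_eq ..
  define M where "M = nat (\<Sum>a\<in>?K. \<bar>S a\<bar> + \<bar>T a\<bar>)"
  have M: "S a + int M \<ge> 0" "T a + int M \<ge> 0" if "a \<in> ?K" for a
  proof -
    have "\<bar>S a\<bar> + \<bar>T a\<bar> \<le> (\<Sum>a\<in>?K. \<bar>S a\<bar> + \<bar>T a\<bar>)"
      using that by (intro member_le_sum) auto
    then have "\<bar>S a\<bar> + \<bar>T a\<bar> \<le> int M" unfolding M_def by linarith
    then show "S a + int M \<ge> 0" "T a + int M \<ge> 0" by linarith+
  qed
  have "\<exists>s t :: nat. a = pt (- int M) (- int M) + pt (int s) (int t)" if "a \<in> ?K" for a
  proof (intro exI)
    have "a = pt (S a) (T a)" by (rule ST)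
    also have "\<dots> = pt (- int M) (- int M) + pt (int (nat (S a + int M))) (int (nat (T a + int M)))"
      using M[OF that] by (simp add: zscale_def algebra_simps)
    finally show "a = pt (- int M) (- int M) + pt (int (nat (S a + int M))) (int (nat (T a + int M)))" .
  qed
  then obtain H where H: "ratfun_of h = mon (pt (- int M) (- int M)) * E H"
    by (rule laurent_representation)
  have "ratfun_of h * X ^ M * Y ^ M = E H"
    unfolding H mon_pt by (simp add: power_int_minus field_simps)
  then show ?thesis by (rule that)
qed

text \<open>Monomials are units among Laurent polynomials but not among polynomials; this is the
  source of the powers of x and y.\<close>

lemma mu_poly_dvd:
  assumes p: "ratfun_of p = mon v * E P" and P: "P \<noteq> 0" and dvd: "mu m0 p dvd p ^ N"
  obtains i j where "mu_poly P dvd P ^ N * [:[:0, 1:]:] ^ i * [:0, 1:] ^ j"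
proof -
  from dvd obtain h where h: "p ^ N = mu m0 p * h" ..
  have E0: "E P \<noteq> 0" using P by (simp add: E_eq_0_iff)
  have "ratfun_of (mu m0 p) = mu_ratfun (mon (v - m0) * E P)"
    unfolding ratfun_of_mu ratfun_of_mult ratfun_of_chi p by (simp flip: mon_add mult.assoc)
  also have "\<dots> = mon (v - m0) ^ 3 * E (mu_poly P)"
    by (simp add: mu_ratfun_mon_mult[OF E0] mu_ratfun_E[OF P])
  finally have mu: "ratfun_of (mu m0 p) = mon (v - m0) ^ 3 * E (mu_poly P)" .
  have "\<exists>s t. mon u = X powi s * Y powi t" for u by (metis mon_pt pt_eq)
  then obtain a b a' b' where mv: "mon v = X powi a * Y powi b" "mon (v - m0) = X powi a' * Y powi b'"
    by meson
  obtain i j H where H: "ratfun_of h * X ^ i * Y ^ j = E H" by (rule laurent_shifted_representation)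
  have "ratfun_of (p ^ N) = ratfun_of (mu m0 p) * ratfun_of h" unfolding h ratfun_of_mult ..
  then have "mon v ^ N * E P ^ N * (X ^ i * Y ^ j) = mon (v - m0) ^ 3 * E (mu_poly P) * ratfun_of h * (X ^ i * Y ^ j)"
    unfolding mu ratfun_of_power p power_mult_distrib by (rule arg_cong)
  also have "\<dots> = mon (v - m0) ^ 3 * E (mu_poly P) * E H" unfolding H[symmetric] by (simp only: mult_ac)
  finally have eq: "(X powi a) ^ N * (Y powi b) ^ N * E P ^ N * (X ^ i * Y ^ j) =
      (X powi a') ^ 3 * (Y powi b') ^ 3 * E (mu_poly P) * E H"
    by (simp only: mv power_mult_distrib)
  \<comment> \<open>The monomial discrepancy of the two sides. These exponents may be negative,
    which the factors with exponents |A| and |B| repair below.\<close>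
  define A B where "A = a * int N + int i - a' * 3" and "B = b * int N + int j - b' * 3"
  have "X powi A = (X powi a) ^ N * X ^ i / (X powi a') ^ 3" "Y powi B = (Y powi b) ^ N * Y ^ j / (Y powi b') ^ 3"
    by (simp_all add: A_def B_def power_int_diff power_int_add power_int_mult)
  moreover have "e * ((x * k / x') * (y * l / y')) = m * h"
    if "x * y * e * (k * l) = x' * y' * m * h" "x' \<noteq> 0" "y' \<noteq> 0" for e x k x' y l y' m h :: ratfun
    using that by (simp add: field_simps)
  ultimately have main: "E P ^ N * (X powi A * Y powi B) = E (mu_poly P) * E H"
    using eq by simp
  have pos: "X powi A * X powi \<bar>A\<bar> = X ^ nat (A + \<bar>A\<bar>)" "Y powi B * Y powi \<bar>B\<bar> = Y ^ nat (B + \<bar>B\<bar>)"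
    "X powi \<bar>A\<bar> = X ^ nat \<bar>A\<bar>" "Y powi \<bar>B\<bar> = Y ^ nat \<bar>B\<bar>"
    unfolding power_int_add[symmetric, OF disjI1[OF XY_nonzero(1)]] power_int_add[symmetric, OF disjI1[OF XY_nonzero(2)]]
    by (simp_all add: power_int_def)
  have "E P ^ N * (X powi A * X powi \<bar>A\<bar>) * (Y powi B * Y powi \<bar>B\<bar>)
      = E P ^ N * (X powi A * Y powi B) * (X powi \<bar>A\<bar> * Y powi \<bar>B\<bar>)" by (simp only: mult_ac)
  also have "\<dots> = E (mu_poly P) * (E H * X powi \<bar>A\<bar> * Y powi \<bar>B\<bar>)" unfolding main by (simp only: mult_ac)
  finally have "E P ^ N * X ^ nat (A + \<bar>A\<bar>) * Y ^ nat (B + \<bar>B\<bar>) = E (mu_poly P) * (E H * X ^ nat \<bar>A\<bar> * Y ^ nat \<bar>B\<bar>)"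
    unfolding pos(1,2) unfolding pos(3,4) .
  then have "E (P ^ N * [:[:0, 1:]:] ^ nat (A + \<bar>A\<bar>) * [:0, 1:] ^ nat (B + \<bar>B\<bar>)) =
      E (mu_poly P * (H * [:[:0, 1:]:] ^ nat \<bar>A\<bar> * [:0, 1:] ^ nat \<bar>B\<bar>))"
    by (simp only: ratfun_eval_mult ratfun_eval_power ratfun_eval_X ratfun_eval_Y)
  then have "P ^ N * [:[:0, 1:]:] ^ nat (A + \<bar>A\<bar>) * [:0, 1:] ^ nat (B + \<bar>B\<bar>) =
      mu_poly P * (H * [:[:0, 1:]:] ^ nat \<bar>A\<bar> * [:0, 1:] ^ nat \<bar>B\<bar>)"
    unfolding E_inject .
  then show ?thesis by (rule that[OF dvdI])
qed

text \<open>The logarithmic gradient in x, y arises from the one in X, Y by an integer matrix of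
  determinant 1 or -1 and a translation by v. Both are invertible over the constants, so generation
  can be tested in the new coordinates.\<close>

lemma ml_degree_eq_1:
  assumes p: "ratfun_of p = mon v * E P" and P: "P \<noteq> 0" "mu_poly P \<noteq> 0"
    and gen: "\<And>S. is_subfield S \<Longrightarrow> E (theta_x P) / E P \<in> S \<Longrightarrow> E (theta_y P) / E P \<in> S \<Longrightarrow> X \<in> S \<and> Y \<in> S"
  shows "ml_degree p = 1"
  unfolding ml_degree_def
proof (rule rational_map_degree_eq_1)
  let ?L1 = "Theta1 (ratfun_of p) / ratfun_of p" and ?L2 = "Theta2 (ratfun_of p) / ratfun_of p"
  have E0: "E P \<noteq> 0" using P by (simp add: E_eq_0_iff)
  have "mu_ratfun (ratfun_of p) \<noteq> 0"
    using P by (simp add: p mu_ratfun_mon_mult[OF E0] mu_ratfun_E E_eq_0_iff)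
  then show "jacobian ?L1 ?L2 \<noteq> 0" unfolding mu_ratfun_jacobian by auto
  define A B where "A = E (theta_x P) / E P" and "B = E (theta_y P) / E P"
  define a b c d :: ratfun where "a = of_int (fst w1)" and "b = of_int (fst w2)"
    and "c = of_int (snd w1)" and "d = of_int (snd w2)"
  define l1 l2 where "l1 = ?L1 - of_int (fst v)" and "l2 = ?L2 - of_int (snd v)"
  have l: "l1 = a * A + b * B" "l2 = c * A + d * B"
    unfolding l1_def l2_def p Theta_mon_mult_quotient[OF E0] Theta_E
    by (simp_all add: a_def b_def c_def d_def A_def B_def add_divide_distrib)
  have det1: "(a * d - b * c)\<^sup>2 = 1"
    using arg_cong[OF det, of "of_int :: int \<Rightarrow> ratfun"] by (simp add: a_def b_def c_def d_def lattice_det_def)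
  have AB: "A = (a * d - b * c) * (d * l1 - b * l2)" "B = (a * d - b * c) * (a * l2 - c * l1)"
    unfolding l using det1 by algebra+
  fix S assume S: "is_subfield S" and L: "?L1 \<in> S" "?L2 \<in> S"
  note cl = is_subfieldD[OF S]
  have "l1 \<in> S" "l2 \<in> S" "a \<in> S" "b \<in> S" "c \<in> S" "d \<in> S"
    using L cl by (simp_all add: l1_def l2_def a_def b_def c_def d_def)
  then have "A \<in> S" "B \<in> S" unfolding AB using cl by simp_all
  then have XY: "X \<in> S" "Y \<in> S" using gen[OF S] by (simp_all add: A_def B_def)
  have "mon u \<in> S" for u
  proof -
    obtain s t where "u = pt s t" using pt_eq by metis
    then show ?thesis using XY cl by (simp add: mon_pt)
  qed
  then show "ratX \<in> S \<and> ratY \<in> S" unfolding ratX_ratY_eq_mon by simp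
qed

end

section \<open>Vertices of unimodular supports\<close>

lemma inner_real_pt: "n \<bullet> real_pt u = fst n * of_int (fst u) + snd n * of_int (snd u)"
  by (simp add: real_pt_def inner_prod_def)

lemma real_pt_diff: "real_pt (a - b) = real_pt a - real_pt b"
  by (simp add: real_pt_def)

lemma inj_real_pt: "inj real_pt"
  by (auto simp: inj_def real_pt_def prod_eq_iff)

lemma Z_basis_det:
  assumes B: "is_Z_basis B" and uw: "u \<in> B" "w \<in> B" and det: "lattice_det u w \<noteq> 0"
  shows "B = {u, w}" "(lattice_det u w)\<^sup>2 = 1"
proof -
  have uw': "u \<noteq> w" using det by (auto simp: lattice_det_def)
  have "x = u \<or> x = w" if x: "x \<in> B" for x
  proof (rule ccontr)
    assume n: "\<not> (x = u \<or> x = w)"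
    \<comment> \<open>The relation det(w, x) u + det(x, u) w + det(u, w) x = 0, valid for any three
      vectors of the plane.\<close>
    define k where "k = (\<lambda>y. if y = u then lattice_det w x else if y = w then lattice_det x u else lattice_det u w)"
    have kv: "k u = lattice_det w x" "k w = lattice_det x u" "k x = lattice_det u w"
      using n uw' by (simp_all add: k_def)
    have "(\<Sum>y\<in>{u, w, x}. zscale (k y) y) = zscale (k u) u + (zscale (k w) w + zscale (k x) x)"
      by (subst sum.insert, simp, use n uw' in force, subst sum.insert, simp, use n in force) simp
    also have "\<dots> = 0"
      unfolding kv by (simp add: zscale_def lattice_det_def algebra_simps zero_prod_def)
    finally have "(\<Sum>y\<in>{u, w, x}. zscale (k y) y) = 0" .
    moreover have "k x \<noteq> 0" using n det by (simp add: k_def)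
    ultimately have "Zmod.dependent B"
      unfolding Zmod.dependent_explicit using uw x
      by (intro exI[of _ "{u, w, x}"] exI[of _ k]) auto
    then show False using B by (simp add: is_Z_basis_def)
  qed
  then show B2: "B = {u, w}" using uw by blast
  have "\<exists>k l. x = zscale k u + zscale l w" for x
  proof -
    have "x \<in> Zmod.span {u, w}" using B unfolding B2 is_Z_basis_def by simp
    then obtain k l where "x - zscale k u = zscale l w"
      unfolding Zmod.span_breakdown_eq[of x u] Zmod.span_singleton by auto
    then have "x = zscale k u + zscale l w" by (simp add: algebra_simps)
    then show ?thesis by blast
  qed
  then obtain i j k l where e: "(1, 0) = zscale i u + zscale j w" "(0, 1) = zscale k u + zscale l w" by meson
  \<comment> \<open>The standard basis has determinant 1, and by multiplicativity det(u, w) divides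
    it.\<close>
  have "lattice_det (zscale i u + zscale j w) (zscale k u + zscale l w) = (i * l - j * k) * lattice_det u w"
    by (simp add: lattice_det_def zscale_def algebra_simps)
  then have "(i * l - j * k) * lattice_det u w = 1"
    unfolding e[symmetric] by (simp add: lattice_det_def)
  then have "lattice_det u w dvd 1" by (metis dvd_triv_right)
  then show "(lattice_det u w)\<^sup>2 = 1" by (auto simp: zdvd1_eq power2_eq_square abs_if split: if_splits)
qed

lemma is_Z_basis_pair:
  assumes "(lattice_det u w)\<^sup>2 = 1"
  shows "is_Z_basis {u, w}"
proof -
  interpret lattice_basis u w by standard (rule assms)
  have "u \<noteq> w" using assms by (auto simp: lattice_det_def)
  have "x \<in> Zmod.span {u, w}" for x
  proof -
    have "zscale s u + zscale t w \<in> Zmod.span {u, w}" for s t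
      by (intro Zmod.span_add Zmod.span_scale Zmod.span_base) auto
    then show ?thesis by (metis pt_eq)
  qed
  moreover have "\<not> Zmod.dependent {u, w}"
  proof
    assume "Zmod.dependent {u, w}"
    then obtain k where "(\<exists>x\<in>{u, w}. k x \<noteq> 0)" "(\<Sum>x\<in>{u, w}. zscale (k x) x) = 0"
      using Zmod.dependent_finite[of "{u, w}"] by auto
    then have "pt (k u) (k w) = 0" "k u \<noteq> 0 \<or> k w \<noteq> 0"
      using \<open>u \<noteq> w\<close> by simp_all
    moreover have "pt 0 0 = 0" by (simp add: zscale_def zero_prod_def)
    ultimately show False using pt_inject[of "k u" "k w" 0 0] by simp
  qed
  ultimately show ?thesis by (auto simp: is_Z_basis_def)
qed

text \<open>The line through v and a supports the hull, and the sign of k records on which side. It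
  cuts out a face that lies in a line and contains two points, hence an edge.\<close>

lemma edge_exists:
  assumes A: "finite A" "v \<in> A" "a \<in> A" "a \<noteq> v" and k: "k \<noteq> 0"
    and side: "\<And>b. b \<in> A \<Longrightarrow> 0 \<le> k * lattice_det (a - v) (b - v)"
  obtains e where "e edge_of (convex hull (real_pt ` A))" "real_pt v \<in> e"
    "\<And>b. b \<in> A \<Longrightarrow> real_pt b \<in> e \<longleftrightarrow> lattice_det (a - v) (b - v) = 0"
proof -
  let ?P = "convex hull (real_pt ` A)"
  define n :: "real \<times> real" where "n = of_int k *\<^sub>R (- of_int (snd (a - v)), of_int (fst (a - v)))"
  have nb: "n \<bullet> real_pt b = n \<bullet> real_pt v + of_int (k * lattice_det (a - v) (b - v))" for b
    by (simp add: inner_real_pt n_def lattice_det_def algebra_simps)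
  have n0: "n \<noteq> 0" using A(4) k by (auto simp: n_def prod_eq_iff)
  define e where "e = ?P \<inter> {x. n \<bullet> x = n \<bullet> real_pt v}"
  have "?P \<subseteq> {x. n \<bullet> x \<ge> n \<bullet> real_pt v}"
  proof (rule hull_minimal)
    show "real_pt ` A \<subseteq> {x. n \<bullet> x \<ge> n \<bullet> real_pt v}"
    proof (rule image_subsetI)
      fix b assume "b \<in> A"
      then have "(0 :: real) \<le> of_int (k * lattice_det (a - v) (b - v))" using side by (simp only: of_int_0_le_iff)
      then show "real_pt b \<in> {x. n \<bullet> x \<ge> n \<bullet> real_pt v}" using nb[of b] by simp
    qed
  qed (rule convex_halfspace_ge)
  then have face: "e face_of ?P"
    unfolding e_def by (intro face_of_Int_supporting_hyperplane_ge convex_convex_hull) auto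
  have mem: "real_pt b \<in> e \<longleftrightarrow> lattice_det (a - v) (b - v) = 0" if "b \<in> A" for b
  proof -
    have "real_pt b \<in> ?P" using that by (simp add: hull_inc)
    then show ?thesis using nb[of b] k by (simp add: e_def)
  qed
  have va: "real_pt v \<in> e" "real_pt a \<in> e" using mem A by (simp_all add: lattice_det_def)
  have "aff_dim e \<le> aff_dim {x. n \<bullet> x = n \<bullet> real_pt v}" unfolding e_def by (rule aff_dim_subset) auto
  also have "\<dots> = 1" using n0 by simp
  finally have "aff_dim e \<le> 1" .
  moreover have "aff_dim {real_pt v, real_pt a} \<le> aff_dim e" using va by (intro aff_dim_subset) auto
  moreover have "real_pt v \<noteq> real_pt a" using A(4) inj_real_pt by (auto dest: injD)
  ultimately have "aff_dim e = 1" by simp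
  then show ?thesis using that face va(1) mem unfolding edge_of_def by blast
qed

lemma nearest_on_edge_exists:
  assumes "finite A" "a \<in> A" "a \<noteq> v" "real_pt a \<in> e"
  obtains a' where "nearest_on_edge A e v a'"
proof -
  define S where "S = {b \<in> A. b \<noteq> v \<and> real_pt b \<in> e}"
  have "a \<in> S" "finite S" using assms by (simp_all add: S_def)
  then have "finite S" "S \<noteq> {}" by blast+
  then obtain a' where "is_arg_min (\<lambda>b. dist (real_pt v) (real_pt b)) (\<lambda>b. b \<in> S) a'"
    using ex_is_arg_min_if_finite by blast
  then have "nearest_on_edge A e v a'"
    by (auto simp: nearest_on_edge_def is_arg_min_linorder S_def)
  then show ?thesis by (rule that)
qed

text \<open>A line strictly separating v from the other support points allows them to be sorted by
  slope as seen from v. The two extreme slopes are edges at v, unimodularity turns their nearest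
  points into a basis, and extremality puts all of A in the cone of this basis.\<close>

lemma vertex_basis:
  assumes A: "finite A" "v \<in> A" and ext: "real_pt v extreme_point_of (convex hull (real_pt ` A))"
    and basis: "is_Z_basis {a - v | a e. e edge_of (convex hull (real_pt ` A)) \<and> real_pt v \<in> e \<and> nearest_on_edge A e v a}"
    and rank: "b0 \<in> A" "b0' \<in> A" "lattice_det (b0 - v) (b0' - v) \<noteq> 0"
  obtains w1 w2 where "(lattice_det w1 w2)\<^sup>2 = 1" "v + w1 \<in> A" "v + w2 \<in> A"
    "\<And>a. a \<in> A \<Longrightarrow> \<exists>s t :: nat. a = v + (zscale (int s) w1 + zscale (int t) w2)"
proof -
  let ?P = "convex hull (real_pt ` A)"
  define A' where "A' = A - {v}"
  have A': "finite A'" "A' \<noteq> {}" using A rank by (auto simp: A'_def lattice_det_def)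
  have "convex hull (real_pt ` A') \<subseteq> ?P - {real_pt v}"
  proof (rule hull_minimal)
    show "real_pt ` A' \<subseteq> ?P - {real_pt v}"
      using inj_real_pt by (auto simp: A'_def hull_inc dest: injD)
    show "convex (?P - {real_pt v})"
      using ext by (simp add: extreme_point_of_stillconvex)
  qed
  moreover have "closed (convex hull (real_pt ` A'))"
    using A' by (simp add: finite_imp_compact compact_convex_hull compact_imp_closed)
  ultimately obtain n r where nr: "n \<bullet> real_pt v < r" "\<And>x. x \<in> convex hull (real_pt ` A') \<Longrightarrow> r < n \<bullet> x"
    using separating_hyperplane_closed_point[OF convex_convex_hull, of "real_pt ` A'" "real_pt v"] by blast
  obtain n1 n2 where n: "n = (n1, n2)" by (cases n)
  \<comment> \<open>Coordinates along the normal n and perpendicular to it. As c is positive on the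
    differences, the slope m / c orders them by orientation.\<close>
  define c where "c = (\<lambda>u :: int \<times> int. n1 * of_int (fst u) + n2 * of_int (snd u))"
  define m where "m = (\<lambda>u :: int \<times> int. n1 * of_int (snd u) - n2 * of_int (fst u))"
  have cpos: "c (b - v) > 0" if "b \<in> A'" for b
  proof -
    have "n \<bullet> real_pt v < n \<bullet> real_pt b" using nr(1) nr(2)[of "real_pt b"] that by (simp add: hull_inc)
    then show ?thesis by (simp add: c_def inner_real_pt n algebra_simps)
  qed
  have "n1 \<noteq> 0 \<or> n2 \<noteq> 0" using cpos A' by (force simp: c_def)
  then have N: "n1\<^sup>2 + n2\<^sup>2 > 0" by (simp add: sum_power2_gt_zero_iff)
  define \<rho> where "\<rho> = (\<lambda>b. m (b - v) / c (b - v))"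
  have \<rho>: "\<rho> b \<le> \<rho> b' \<longleftrightarrow> 0 \<le> lattice_det (b - v) (b' - v)" if "b \<in> A'" "b' \<in> A'" for b b'
  proof -
    have "(n1\<^sup>2 + n2\<^sup>2) * of_int (lattice_det x y) = c x * m y - m x * c y" for x y
      unfolding c_def m_def lattice_det_def by (simp add: algebra_simps power2_eq_square)
    then have "0 \<le> c (b - v) * m (b' - v) - m (b - v) * c (b' - v) \<longleftrightarrow>
        0 \<le> (n1\<^sup>2 + n2\<^sup>2) * of_int (lattice_det (b - v) (b' - v))" by simp
    also have "\<dots> \<longleftrightarrow> 0 \<le> lattice_det (b - v) (b' - v)" using N by (simp add: zero_le_mult_iff)
    finally show ?thesis using cpos[OF that(1)] cpos[OF that(2)]
      by (simp add: \<rho>_def divide_le_eq le_divide_eq field_simps)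
  qed
  have anti: "lattice_det x y = - lattice_det y x" for x y by (simp add: lattice_det_def)
  obtain b1 where b1: "b1 \<in> A'" "\<And>b. b \<in> A' \<Longrightarrow> \<rho> b1 \<le> \<rho> b"
    using ex_is_arg_min_if_finite[OF A', of \<rho>] by (auto simp: is_arg_min_linorder)
  obtain b2 where b2: "b2 \<in> A'" "\<And>b. b \<in> A' \<Longrightarrow> \<rho> b \<le> \<rho> b2"
    using ex_is_arg_min_if_finite[OF A', of "\<lambda>b. - \<rho> b"] by (auto simp: is_arg_min_linorder)
  define S where "S = {a - v | a e. e edge_of ?P \<and> real_pt v \<in> e \<and> nearest_on_edge A e v a}"
  have side: "\<exists>a. a - v \<in> S \<and> a \<in> A' \<and> \<rho> a = \<rho> b"
    if b: "b \<in> A'" and k: "k \<noteq> 0" "\<And>x. x \<in> A' \<Longrightarrow> 0 \<le> k * lattice_det (b - v) (x - v)" for b k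
  proof -
    have "0 \<le> k * lattice_det (b - v) (x - v)" if "x \<in> A" for x
      using k(2)[of x] that by (cases "x = v") (auto simp: A'_def lattice_det_def)
    then obtain e where e: "e edge_of ?P" "real_pt v \<in> e"
      "\<And>x. x \<in> A \<Longrightarrow> real_pt x \<in> e \<longleftrightarrow> lattice_det (b - v) (x - v) = 0"
      using edge_exists[OF A(1,2), of b k] b k(1) by (auto simp: A'_def)
    have "real_pt b \<in> e" using e(3) b by (simp add: A'_def lattice_det_def)
    then obtain a where a: "nearest_on_edge A e v a"
      using nearest_on_edge_exists[OF A(1), of b v e] b by (auto simp: A'_def)
    then have "a \<in> A" "a \<noteq> v" "real_pt a \<in> e" by (simp_all add: nearest_on_edge_def)
    then have aA: "a \<in> A'" and "lattice_det (b - v) (a - v) = 0"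
      using e(3)[of a] by (simp_all add: A'_def)
    then have "\<rho> a = \<rho> b" using \<rho>[OF aA b] \<rho>[OF b aA] anti[of "a - v"] by simp
    moreover have "a - v \<in> S" using a e(1,2) unfolding S_def by blast
    ultimately show ?thesis using aA by blast
  qed
  obtain a1 where a1: "a1 - v \<in> S" "a1 \<in> A'" "\<rho> a1 = \<rho> b1"
  proof -
    have h: "0 \<le> 1 * lattice_det (b1 - v) (x - v)" if "x \<in> A'" for x
      using \<rho>[OF b1(1) that] b1(2)[OF that] by simp
    from side[OF b1(1) one_neq_zero h] show ?thesis using that by blast
  qed
  obtain a2 where a2: "a2 - v \<in> S" "a2 \<in> A'" "\<rho> a2 = \<rho> b2"
  proof -
    have h: "0 \<le> (- 1) * lattice_det (b2 - v) (x - v)" if "x \<in> A'" for x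
      using \<rho>[OF that b2(1)] b2(2)[OF that] anti[of "b2 - v"] by simp
    have "- 1 \<noteq> (0 :: int)" by simp
    from side[OF b2(1) this h] show ?thesis using that by blast
  qed
  have "lattice_det (a1 - v) (a2 - v) \<noteq> 0"
  proof
    assume z: "lattice_det (a1 - v) (a2 - v) = 0"
    then have "lattice_det (a2 - v) (a1 - v) = 0" using anti[of "a2 - v"] by simp
    then have "\<rho> a1 = \<rho> a2" using z \<rho>[OF a1(2) a2(2)] \<rho>[OF a2(2) a1(2)] by simp
    then have eq: "\<rho> b = \<rho> b'" if "b \<in> A'" "b' \<in> A'" for b b'
      using b1(2)[OF that(1)] b1(2)[OF that(2)] b2(2)[OF that(1)] b2(2)[OF that(2)] a1(3) a2(3) by linarith
    have "b0 \<noteq> v" "b0' \<noteq> v" using rank by (auto simp: lattice_det_def)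
    then have in': "b0 \<in> A'" "b0' \<in> A'" using rank by (auto simp: A'_def)
    then show False using \<rho>[OF in'] \<rho>[OF in'(2,1)] eq[OF in'] anti[of "b0 - v"] rank(3) by simp
  qed
  then have det: "(lattice_det (a1 - v) (a2 - v))\<^sup>2 = 1" by (rule Z_basis_det(2)[OF basis[folded S_def] a1(1) a2(1)])
  interpret lattice_basis "a1 - v" "a2 - v" by standard (rule det)
  have "lattice_det (a1 - v) (a2 - v) \<ge> 0" using \<rho>[OF a1(2) a2(2)] b1(2)[OF a2(2)] a1(3) by simp
  \<comment> \<open>\<open>a1\<close> has the smaller slope, so the determinant is nonnegative; of
    the two units only 1 remains.\<close>
  then have det1: "lattice_det (a1 - v) (a2 - v) = 1"
    using det by (metis abs_of_nonneg power2_eq_1_iff abs_minus_cancel abs_one)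
  show ?thesis
  proof (rule that[OF det])
    show "v + (a1 - v) \<in> A" "v + (a2 - v) \<in> A" using a1 a2 by (simp_all add: A'_def)
    fix a assume a: "a \<in> A"
    define s t where "s = lattice_det (a - v) (a2 - v)" and "t = lattice_det (a1 - v) (a - v)"
    have "s \<ge> 0 \<and> t \<ge> 0"
    proof (cases "a = v")
      case False
      then have aA: "a \<in> A'" using a by (simp add: A'_def)
      show ?thesis using \<rho>[OF aA a2(2)] \<rho>[OF a1(2) aA] b1(2)[OF aA] b2(2)[OF aA] a1(3) a2(3)
        by (simp add: s_def t_def)
    qed (simp add: s_def t_def lattice_det_def)
    then have "pt (int (nat s)) (int (nat t)) = a - v" using pt_eq[of "a - v"] by (simp add: det1 s_def t_def)
    then have "a = v + pt (int (nat s)) (int (nat t))" by simp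
    then show "\<exists>s t :: nat. a = v + pt (int s) (int t)" by blast
  qed
qed

text \<open>Otherwise all differences from v lie on a line, and a normal vector of it is orthogonal
  to the whole span.\<close>

lemma effective_rank_two_det:
  assumes "effective_rank_two p"
  shows "\<exists>b\<in>Poly_Mapping.keys p. \<exists>b'\<in>Poly_Mapping.keys p. lattice_det (b - v) (b' - v) \<noteq> 0"
proof (rule ccontr)
  let ?A = "Poly_Mapping.keys p"
  assume "\<not> ?thesis"
  then have z: "lattice_det (b - v) (b' - v) = 0" if "b \<in> ?A" "b' \<in> ?A" for b b' using that by blast
  have "\<exists>n :: real \<times> real. n \<noteq> 0 \<and> (\<forall>b\<in>?A. n \<bullet> real_pt (b - v) = 0)"
  proof (cases "\<exists>b\<in>?A. b \<noteq> v")
    case True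
    then obtain b where b: "b \<in> ?A" "b \<noteq> v" by blast
    let ?n = "(- of_int (snd (b - v)), of_int (fst (b - v))) :: real \<times> real"
    have "?n \<bullet> real_pt (b' - v) = of_int (lattice_det (b - v) (b' - v))" for b'
      by (simp add: inner_real_pt lattice_det_def algebra_simps)
    then have "\<forall>b'\<in>?A. ?n \<bullet> real_pt (b' - v) = 0" using z b by simp
    moreover have "?n \<noteq> 0" using b(2) by (auto simp: prod_eq_iff)
    ultimately show ?thesis by blast
  next
    case False
    then show ?thesis by (intro exI[of _ "(1, 0)"]) (auto simp: real_pt_def inner_prod_def zero_prod_def)
  qed
  then obtain n :: "real \<times> real" where n: "n \<noteq> 0" "\<And>b. b \<in> ?A \<Longrightarrow> n \<bullet> real_pt (b - v) = 0" by blast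
  have "span {real_pt (a - b) | a b. a \<in> ?A \<and> b \<in> ?A} \<subseteq> {x. n \<bullet> x = 0}"
  proof (rule span_minimal)
    show "{real_pt (a - b) | a b. a \<in> ?A \<and> b \<in> ?A} \<subseteq> {x. n \<bullet> x = 0}"
    proof
      fix x assume "x \<in> {real_pt (a - b) | a b. a \<in> ?A \<and> b \<in> ?A}"
      then obtain a b where x: "x = real_pt (a - b)" and "a \<in> ?A" "b \<in> ?A" by blast
      moreover have "n \<bullet> real_pt (a - b) = n \<bullet> real_pt (a - v) - n \<bullet> real_pt (b - v)"
        by (simp add: real_pt_diff inner_diff_right)
      ultimately show "x \<in> {x. n \<bullet> x = 0}" using n(2) by simp
    qed
  qed (rule subspace_hyperplane)
  moreover have "n \<in> span {real_pt (a - b) | a b. a \<in> ?A \<and> b \<in> ?A}"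
    using assms unfolding effective_rank_two_def by (simp only: UNIV_I)
  ultimately have "n \<bullet> n = 0" by blast
  then show False using n(1) by simp
qed


section \<open>The vertex at the far end of an edge\<close>

context lattice_basis begin

lemma pt_add: "pt s t + pt s' t' = pt (s + s') (t + t')"
  and zscale_pt: "zscale k (pt s t) = pt (k * s) (k * t)"
  and pt_0: "pt 0 0 = 0"
  by (simp_all add: zscale_def algebra_simps zero_prod_def)

text \<open>For large K the functional s - K t has its strict maximum at this point: a row with t at
  least 1 loses at least K, and within the row t = 0 the point is the last one.\<close>

lemma neighbour_vertex_extreme:
  assumes A: "finite A" and cone: "\<And>a. a \<in> A \<Longrightarrow> \<exists>s t :: nat. a = v + pt (int s) (int t)"
    and l: "v + pt l 0 \<in> A" and max: "\<And>s. v + pt s 0 \<in> A \<Longrightarrow> s \<le> l"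
  shows "real_pt (v + pt l 0) extreme_point_of (convex hull (real_pt ` A))"
proof -
  define w where "w = v + pt l 0"
  let ?d = "lattice_det w1 w2"
  define f where "f = (\<lambda>u. ?d * lattice_det u w2)"
  define g where "g = (\<lambda>u. ?d * lattice_det w1 u)"
  have fg: "f (pt s t) = s" "g (pt s t) = t" for s t
  proof -
    have "pt (f (pt s t)) (g (pt s t)) = pt s t" unfolding f_def g_def by (rule pt_eq)
    then show "f (pt s t) = s" "g (pt s t) = t" unfolding pt_inject by simp_all
  qed
  have fin: "finite ((\<lambda>a. f (a - w)) ` A)" using A by simp
  define K where "K = Max (insert 0 ((\<lambda>a. f (a - w)) ` A)) + 1"
  have K: "f (a - w) < K" if "a \<in> A" for a
  proof -
    have "f (a - w) \<le> Max (insert 0 ((\<lambda>a. f (a - w)) ` A))" using fin that by (intro Max_ge) auto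
    then show ?thesis by (simp add: K_def)
  qed
  have "0 \<le> Max (insert 0 ((\<lambda>a. f (a - w)) ` A))" using fin by (intro Max_ge) auto
  then have K0: "K > 0" by (simp add: K_def)
  \<comment> \<open>The vector representing s - K t in the original coordinates, by Cramer's
    rule.\<close>
  define n :: "real \<times> real" where "n = (of_int (?d * (snd w2 + K * snd w1)), of_int (?d * (- fst w2 - K * fst w1)))"
  have nf: "n \<bullet> real_pt u = of_int (f u - K * g u)" for u
    by (simp add: inner_real_pt n_def f_def g_def lattice_det_def algebra_simps)
  have neg: "n \<bullet> real_pt a < n \<bullet> real_pt w" if a: "a \<in> A - {w}" for a
  proof -
    obtain s t :: nat where st: "a = v + pt (int s) (int t)" using cone a by blast
    have aw: "a - w = pt (int s - l) (int t)" by (simp add: st w_def zscale_def algebra_simps)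
    have "int s - l - K * int t < 0"
    proof (cases "t = 0")
      case True
      then have "int s \<le> l" using max[of "int s"] a st by simp
      moreover have "int s \<noteq> l" using a st True by (auto simp: w_def)
      ultimately show ?thesis using True by simp
    next
      case False
      have "int s - l < K" using K[of a] a by (simp add: aw fg)
      moreover have "K * 1 \<le> K * int t" using False K0 by (intro mult_left_mono) auto
      ultimately show ?thesis by simp
    qed
    then have "n \<bullet> real_pt (a - w) < 0" unfolding nf aw fg by (simp only: of_int_less_0_iff)
    then show ?thesis by (simp add: real_pt_diff inner_diff_right)
  qed
  have "convex hull (real_pt ` (A - {w})) \<subseteq> {x. n \<bullet> x < n \<bullet> real_pt w}"
    by (rule hull_minimal) (use neg in \<open>auto simp: convex_halfspace_lt\<close>)
  then have "real_pt w \<notin> convex hull (real_pt ` (A - {w}))" by auto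
  then have "real_pt w extreme_point_of (convex hull (insert (real_pt w) (real_pt ` (A - {w}))))"
    using A by (intro extreme_point_of_convex_hull_insert) auto
  also have "insert (real_pt w) (real_pt ` (A - {w})) = real_pt ` A" using l by (auto simp: w_def)
  finally show ?thesis by (simp add: w_def)
qed

text \<open>\<open>vertex_basis\<close> is applied once more, at the far end w of the edge. One
  basis vector points back along the edge and is (-1, 0) in coordinates; unimodularity gives the
  other the form (-d, 1), and the cone condition at w is the asserted inequality.\<close>

lemma neighbour_edge:
  assumes uni: "unimodular_support p" and rank: "effective_rank_two p"
    and cone: "\<And>a. a \<in> Poly_Mapping.keys p \<Longrightarrow> \<exists>s t :: nat. a = v + pt (int s) (int t)"
    and l: "l > 0" "v + pt l 0 \<in> Poly_Mapping.keys p" "\<And>s. v + pt s 0 \<in> Poly_Mapping.keys p \<Longrightarrow> s \<le> l"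
    and v: "v \<in> Poly_Mapping.keys p"
  obtains d where "v + pt (l - d) 1 \<in> Poly_Mapping.keys p"
    "\<And>s t. v + pt s t \<in> Poly_Mapping.keys p \<Longrightarrow> s + d * t \<le> l"
proof -
  let ?A = "Poly_Mapping.keys p"
  define w where "w = v + pt l 0"
  have ext: "real_pt w extreme_point_of (convex hull (real_pt ` ?A))"
    unfolding w_def by (rule neighbour_vertex_extreme[OF _ cone l(2,3)]) auto
  have wA: "w \<in> ?A" using l by (simp add: w_def)
  obtain b b' where b: "b \<in> ?A" "b' \<in> ?A" "lattice_det (b - w) (b' - w) \<noteq> 0"
    using effective_rank_two_det[OF rank, of w] by blast
  have basis: "is_Z_basis {a - w | a e. e edge_of (convex hull (real_pt ` ?A)) \<and> real_pt w \<in> e \<and> nearest_on_edge ?A e w a}"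
    using uni wA ext unfolding unimodular_support_def Let_def by blast
  obtain u1 u2 where det': "(lattice_det u1 u2)\<^sup>2 = 1" and u: "w + u1 \<in> ?A" "w + u2 \<in> ?A"
    and cone': "\<And>a. a \<in> ?A \<Longrightarrow> \<exists>s t :: nat. a = w + (zscale (int s) u1 + zscale (int t) u2)"
    by (rule vertex_basis[OF finite_keys wA ext basis b]) (rule that)
  note result = that
  have main: thesis if u: "w + u1 \<in> ?A" "w + u2 \<in> ?A" and det': "(lattice_det u1 u2)\<^sup>2 = 1"
    and cone': "\<And>a. a \<in> ?A \<Longrightarrow> \<exists>s t :: nat. a = w + (zscale (int s) u1 + zscale (int t) u2)"
    and pos: "s0 > 0" "v = w + (zscale (int s0) u1 + zscale (int t0) u2)" 
    and zero: "u1 = pt x1 0" and y2: "u2 = pt x2 y2" "y2 \<ge> 0" for u1 u2 s0 t0 x1 x2 y2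
  proof -
    have det2: "lattice_det u1 u2 = x1 * y2 * lattice_det w1 w2"
      unfolding zero y2 by (simp add: lattice_det_def zscale_def algebra_simps)
    have "(x1 * y2)\<^sup>2 = 1" using det' det unfolding det2 power_mult_distrib by simp
    then have "(x1 * y2) * (x1 * y2) = 1" by (simp add: power2_eq_square)
    then have "y2 dvd 1" "x1 dvd 1" by (metis dvd_mult2 dvd_triv_left dvd_triv_right)+
    then have "y2 = 1" and x1: "x1 = 1 \<or> x1 = -1" using y2 by (auto simp: zdvd1_eq abs_if split: if_splits)
    \<comment> \<open>The value 1 would yield a support point beyond the end of the edge.\<close>
    have "x1 = -1"
    proof (rule ccontr)
      assume "x1 \<noteq> -1"
      then have "x1 = 1" using x1 by simp
      then have "w + u1 = v + pt (l + 1) 0" by (simp add: zero w_def zscale_def prod_eq_iff algebra_simps)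
      then have "v + pt (l + 1) 0 \<in> ?A" using u(1) by simp
      then show False using l(3) by fastforce
    qed
    show thesis
    proof (rule result[of "- x2"])
      show "v + pt (l - - x2) 1 \<in> ?A" using u(2) by (simp add: y2 \<open>y2 = 1\<close> w_def zscale_def algebra_simps)
      fix s t assume "v + pt s t \<in> ?A"
      then obtain a b :: nat where "v + pt s t = w + (zscale (int a) u1 + zscale (int b) u2)" using cone' by blast
      also have "\<dots> = v + pt (l - int a + x2 * int b) (int b)"
        by (simp add: zero y2 \<open>y2 = 1\<close> \<open>x1 = -1\<close> w_def zscale_def algebra_simps)
      finally have "s = l - int a + x2 * int b" "t = int b" unfolding add_left_cancel pt_inject by simp_all
      then show "s + - x2 * t \<le> l" by simp
    qed
  qed
  have co: "\<exists>x y. y \<ge> 0 \<and> u = pt x y" if "w + u \<in> ?A" for u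
  proof -
    from cone[OF that] obtain s t :: nat where "w + u = v + pt (int s) (int t)" by blast
    then have "u = pt (int s - l) (int t)" by (simp add: w_def zscale_def algebra_simps prod_eq_iff)
    then show ?thesis by (intro exI[of _ "int s - l"] exI[of _ "int t"]) simp
  qed
  obtain x1 y1 where u1: "u1 = pt x1 y1" "y1 \<ge> 0" using co u by blast
  obtain x2 y2 where u2: "u2 = pt x2 y2" "y2 \<ge> 0" using co u by blast
  obtain s t :: nat where st: "v = w + (zscale (int s) u1 + zscale (int t) u2)" using cone'[OF v] by blast
  also have "\<dots> = v + pt (l + (int s * x1 + int t * x2)) (0 + (int s * y1 + int t * y2))"
    unfolding u1(1) u2(1) w_def zscale_pt pt_add unfolding add.assoc[of v "pt l 0"] pt_add ..
  finally have "pt (l + (int s * x1 + int t * x2)) (0 + (int s * y1 + int t * y2)) = pt 0 0"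
    unfolding pt_0 by (metis add_cancel_left_right)
  then have e: "l + int s * x1 + int t * x2 = 0" "int s * y1 + int t * y2 = 0" unfolding pt_inject by simp_all
  have "int s * y1 \<ge> 0" "int t * y2 \<ge> 0" using u1 u2 by simp_all
  \<comment> \<open>The vertex v lies at height 0 from w and both basis vectors have nonnegative
    height, so a vector that occurs in the expansion of v runs along the edge.\<close>
  then have z: "int s * y1 = 0" "int t * y2 = 0" using e(2) by linarith+
  show thesis
  proof (cases "s = 0")
    case False
    then have "y1 = 0" using z by simp
    then show thesis using main[OF u det' cone' _ st, of x1 x2 y2] False u1 u2 by simp
  next
    case True
    then have "t > 0" using e(1) l(1) by (cases t) auto
    then have "y2 = 0" using z by simp
    moreover have "(lattice_det u2 u1)\<^sup>2 = 1" using det' by (simp add: lattice_det_def power2_eq_square algebra_simps)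
    moreover have "\<exists>s t :: nat. a = w + (zscale (int s) u2 + zscale (int t) u1)" if "a \<in> ?A" for a
      using cone'[OF that] by (metis add.commute)
    moreover have "v = w + (zscale (int t) u2 + zscale (int s) u1)" using st by (simp only: add.commute)
    ultimately show thesis using main[OF u(2,1), of t s x2 x1 y1] \<open>t > 0\<close> u1 u2 by simp
  qed
qed

end

section \<open>Maximum-likelihood degree one\<close>

lemma theta_xy_power: "theta_x (f ^ n) * f = of_nat n * f ^ n * theta_x f" "theta_y (f ^ n) * f = of_nat n * f ^ n * theta_y f"
  by (induction n) (simp_all add: theta_x_mult theta_y_mult algebra_simps)

lemma ratC_eq_0_iff [simp]: "ratC c = 0 \<longleftrightarrow> c = 0"
  by (simp add: ratC_def)

lemma of_nat_ratfun: "of_nat n = ratC (of_nat n)"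
  using of_int_ratfun[of "int n"] by simp

lemma ratfun_eval_of_nat: "ratfun_eval X Y (of_nat n) = of_nat n"
  by (induction n) (simp_all add: ratfun_eval_add ratfun_eval_pCons(2))

context lattice_basis begin

text \<open>With F the linear form, the components A and B are n times its two linear terms divided
  by F, so n - A - B = n alpha / F recovers F, and then A F and B F recover X and Y.\<close>

lemma ml_degree_simplex_power:
  assumes p: "ratfun_of p = mon v * E P" and P: "P = [:[:c:]:] * [:[:\<alpha>, \<beta>:], [:\<gamma>:]:] ^ n"
    and nz: "\<alpha> \<noteq> 0" "\<beta> \<noteq> 0" "\<gamma> \<noteq> 0" "c \<noteq> 0" "n > 0" and mu: "mu_poly P \<noteq> 0"
  shows "ml_degree p = 1"
proof (rule ml_degree_eq_1[OF p _ mu])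
  define f where "f = [:[:\<alpha>, \<beta>:], [:\<gamma>:]:]"
  show P0: "P \<noteq> 0" using nz by (simp add: P)
  have f0: "f \<noteq> 0" using nz by (simp add: f_def)
  define F where "F = E f"
  have F: "F = ratC \<alpha> + ratC \<beta> * X + ratC \<gamma> * Y"
    by (simp add: F_def f_def ratfun_eval_pCons map_poly_pCons ratC_hom algebra_simps)
  have F0: "F \<noteq> 0" using f0 by (simp add: F_def E_eq_0_iff)
  have tf: "E (theta_x f) = ratC \<beta> * X" "E (theta_y f) = ratC \<gamma> * Y"
    by (simp_all add: f_def theta_x_def theta_y_def map_poly_pCons pderiv_pCons ratfun_eval_pCons ratC_hom)
  have "theta_x P * f = of_nat n * P * theta_x f" "theta_y P * f = of_nat n * P * theta_y f"
  proof -
    have "theta_x P = [:[:c:]:] * theta_x (f ^ n)" "theta_y P = [:[:c:]:] * theta_y (f ^ n)"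
      unfolding P f_def[symmetric] theta_x_mult theta_y_mult by (simp_all add: pderiv_pCons)
    then have "theta_x P * f = [:[:c:]:] * (theta_x (f ^ n) * f)" "theta_y P * f = [:[:c:]:] * (theta_y (f ^ n) * f)"
      by (simp_all only: mult.assoc)
    then show "theta_x P * f = of_nat n * P * theta_x f" "theta_y P * f = of_nat n * P * theta_y f"
      unfolding theta_xy_power P f_def[symmetric] by (simp_all only: mult_ac)
  qed
  then have "E (theta_x P * f) = E (of_nat n * P * theta_x f)" "E (theta_y P * f) = E (of_nat n * P * theta_y f)"
    by (simp_all only:)
  then have "E (theta_x P) * F = of_nat n * E P * E (theta_x f)" "E (theta_y P) * F = of_nat n * E P * E (theta_y f)"
    unfolding F_def by (simp_all only: ratfun_eval_mult ratfun_eval_of_nat)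
  then have AB: "E (theta_x P) / E P = of_nat n * ratC \<beta> * X / F" "E (theta_y P) / E P = of_nat n * ratC \<gamma> * Y / F"
    using F0 P0 by (simp_all add: tf field_simps E_eq_0_iff)
  fix S assume S: "is_subfield S" and A: "E (theta_x P) / E P \<in> S" and B: "E (theta_y P) / E P \<in> S"
  note cl = is_subfieldD[OF S]
  define k where "k = ratC (of_nat n)"
  have k: "of_nat n = k" "k \<noteq> 0" using nz by (simp_all add: k_def of_nat_ratfun)
  have kS: "k \<in> S" unfolding k_def by (rule cl)
  have "k - E (theta_x P) / E P - E (theta_y P) / E P = k * ratC \<alpha> / F"
  proof -
    have "k * F - k * ratC \<beta> * X - k * ratC \<gamma> * Y = k * ratC \<alpha>" by (simp add: F algebra_simps)
    then have "(k * F - k * ratC \<beta> * X - k * ratC \<gamma> * Y) / F = k * ratC \<alpha> / F" by (rule arg_cong)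
    then show ?thesis unfolding AB k using F0 by (simp add: diff_divide_distrib)
  qed
  then have "k * ratC \<alpha> / F \<in> S" using cl(5)[OF cl(5)[OF kS A] B] by simp
  then have "k * ratC \<alpha> / (k * ratC \<alpha> / F) \<in> S" by (rule cl(6)[OF cl(2)[OF kS cl(4)]])
  then have FS: "F \<in> S" using k nz by simp
  have "X = E (theta_x P) / E P * F / (k * ratC \<beta>)" "Y = E (theta_y P) / E P * F / (k * ratC \<gamma>)"
    unfolding AB k using k nz F0 by simp_all
  moreover have "E (theta_x P) / E P * F / (k * ratC \<beta>) \<in> S" "E (theta_y P) / E P * F / (k * ratC \<gamma>) \<in> S"
    by (rule cl(6)[OF cl(2)[OF A FS] cl(2)[OF kS cl(4)]], rule cl(6)[OF cl(2)[OF B FS] cl(2)[OF kS cl(4)]])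
  ultimately show "X \<in> S \<and> Y \<in> S" by (simp only: simp_thms)
qed

text \<open>The variables separate, and each component is a Moebius transformation of one
  coordinate.\<close>

lemma ml_degree_box_power:
  assumes p: "ratfun_of p = mon v * E P" and P: "P = [:[:c:]:] * (xlin z ^ k * ylin z' ^ l)"
    and nz: "z \<noteq> 0" "z' \<noteq> 0" "c \<noteq> 0" "k > 0" "l > 0" and mu: "mu_poly P \<noteq> 0"
  shows "ml_degree p = 1"
proof (rule ml_degree_eq_1[OF p _ mu])
  show P0: "P \<noteq> 0" using nz by (simp add: P)
  have lin: "E (xlin a) = X - ratC a" "E (ylin a) = Y - ratC a" for a
  proof -
    have "ratC (- a) = - ratC a" using ratC_hom(1)[of a "- a"] by (simp add: ratC_hom eq_neg_iff_add_eq_0 add.commute)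
    then show "E (xlin a) = X - ratC a" "E (ylin a) = Y - ratC a"
      by (simp_all add: ratfun_eval_pCons map_poly_pCons ratC_hom)
  qed
  have tl: "theta_x (xlin z) = [:[:0, 1:]:]" "theta_y (xlin z) = 0" "theta_x (ylin z') = 0" "theta_y (ylin z') = [:0, 1:]"
    by (simp_all add: theta_x_def theta_y_def map_poly_pCons pderiv_pCons)
  have z0: "theta_y (xlin z ^ k) = 0" "theta_x (ylin z' ^ l) = 0"
    using theta_xy_power(2)[of "xlin z" k] theta_xy_power(1)[of "ylin z'" l]
    by (simp_all add: tl del: mult_pCons_left mult_pCons_right)
  have "theta_x P * xlin z = of_nat k * P * [:[:0, 1:]:]" 
  proof -
    have "theta_x P * xlin z = [:[:c:]:] * ylin z' ^ l * (theta_x (xlin z ^ k) * xlin z)"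
      by (simp add: P theta_x_mult z0 pderiv_pCons mult_ac del: mult_pCons_left mult_pCons_right)
    then show ?thesis unfolding theta_xy_power tl P by (simp only: mult_ac)
  qed
  then have "E (theta_x P * xlin z) = E (of_nat k * P * [:[:0, 1:]:])" by (rule arg_cong)
  then have 1: "E (theta_x P) * (X - ratC z) = of_nat k * E P * X"
    by (simp only: ratfun_eval_mult lin ratfun_eval_of_nat ratfun_eval_X)
  have "theta_y P * ylin z' = of_nat l * P * [:0, 1:]" 
  proof -
    have "theta_y P * ylin z' = [:[:c:]:] * xlin z ^ k * (theta_y (ylin z' ^ l) * ylin z')"
      by (simp add: P theta_y_mult z0 mult_ac del: mult_pCons_left mult_pCons_right)
    then show ?thesis unfolding theta_xy_power tl P by (simp only: mult_ac)
  qed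
  then have "E (theta_y P * ylin z') = E (of_nat l * P * [:0, 1:])" by (rule arg_cong)
  then have 2: "E (theta_y P) * (Y - ratC z') = of_nat l * E P * Y"
    by (simp only: ratfun_eval_mult lin ratfun_eval_of_nat ratfun_eval_Y)
  have nz': "X - ratC z \<noteq> 0" "Y - ratC z' \<noteq> 0" "E P \<noteq> 0"
    using P0 by (simp_all add: E_eq_0_iff flip: lin)
  fix S assume S: "is_subfield S" and A: "E (theta_x P) / E P \<in> S" and B: "E (theta_y P) / E P \<in> S"
  note cl = is_subfieldD[OF S]
  have solve: "U \<in> S" if "a \<in> S" and eq: "a * (U - ratC b) = of_nat m * U" and b: "b \<noteq> 0" and m: "m > 0" for a U b m
  proof -
    define r where "r = ratC (of_nat m)"
    have r: "of_nat m = r" "r \<noteq> 0" "r \<in> S" using m cl(4) by (simp_all add: r_def of_nat_ratfun)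
    have e: "(a - r) * U = a * ratC b" using eq unfolding r by (simp add: algebra_simps)
    have "a - r \<noteq> 0"
    proof
      assume "a - r = 0"
      then show False using e r b by simp
    qed
    then have "U = a * ratC b / (a - r)" using e by (simp add: field_simps)
    moreover have "a * ratC b / (a - r) \<in> S"
      by (rule cl(6)[OF cl(2)[OF that(1) cl(4)] cl(5)[OF that(1) r(3)]])
    ultimately show ?thesis by (simp only:)
  qed
  show "X \<in> S \<and> Y \<in> S"
  proof
    show "X \<in> S" by (rule solve[OF A _ nz(1,4)]) (use 1 nz' in \<open>simp add: field_simps\<close>)
    show "Y \<in> S" by (rule solve[OF B _ nz(2,5)]) (use 2 nz' in \<open>simp add: field_simps\<close>)
  qed
qed

text \<open>The number d of \<open>neighbour_edge\<close> is the degree difference in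
  \<open>edge_bound\<close>: its point at height 1 bounds \<open>degree (coeff P 1)\<close> from
  below, and its inequality bounds it from above.\<close>

lemma edge_bound_of_support:
  assumes uni: "unimodular_support p" and rank: "effective_rank_two p"
    and cone: "\<And>a. a \<in> Poly_Mapping.keys p \<Longrightarrow> \<exists>s t :: nat. a = v + pt (int s) (int t)"
    and v: "v \<in> Poly_Mapping.keys p" and w1: "v + w1 \<in> Poly_Mapping.keys p"
    and co: "\<And>s t. coeff (coeff P t) s = Poly_Mapping.lookup p (v + pt (int s) (int t))"
  shows "edge_bound P"
proof -
  let ?A = "Poly_Mapping.keys p"
  have key: "coeff (coeff P t) s \<noteq> 0 \<longleftrightarrow> v + pt (int s) (int t) \<in> ?A" for s t
    by (simp add: co in_keys_iff)
  have keyZ: "\<exists>s' t'. s = int s' \<and> t = int t'" if st: "v + pt s t \<in> ?A" for s t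
  proof -
    obtain s' t' :: nat where "v + pt s t = v + pt (int s') (int t')" using cone[OF st] by blast
    then have "s = int s' \<and> t = int t'" unfolding add_left_cancel pt_inject .
    then show ?thesis by blast
  qed
  define l where "l = degree (coeff P 0)"
  have "pt 1 0 = w1" by (simp add: zscale_def prod_eq_iff)
  then have "coeff (coeff P 0) 1 \<noteq> 0" using w1 key[of 0 1] by simp
  then have l0: "l > 0" and top: "coeff (coeff P 0) l \<noteq> 0"
    using le_degree[of "coeff P 0" 1] by (auto simp: l_def)
  have "s \<le> int l" if "v + pt s 0 \<in> ?A" for s
  proof -
    from keyZ[OF that] obtain s' t' where "s = int s'" "(0::int) = int t'" by blast
    then have "coeff (coeff P 0) s' \<noteq> 0" using that key[of 0 s'] by simp
    then show ?thesis using \<open>s = int s'\<close> le_degree by (simp add: l_def)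
  qed
  then obtain d where d: "v + pt (int l - d) 1 \<in> ?A" "\<And>s t. v + pt s t \<in> ?A \<Longrightarrow> s + d * t \<le> int l"
    using neighbour_edge[OF uni rank cone _ _ _ v, of "int l"] l0 top[unfolded key] by auto
  obtain m t' where m: "int l - d = int m" "(1::int) = int t'" using keyZ[OF d(1)] by blast
  then have "coeff (coeff P 1) m \<noteq> 0" using d(1) key[of 1 m] by simp
  then have "degree (coeff P 1) \<ge> m" and "coeff P 1 \<noteq> 0" by (auto intro: le_degree)
  moreover have "int (degree (coeff P 1)) + d * 1 \<le> int l"
    using d(2)[of "int (degree (coeff P 1))" 1] key[of 1 "degree (coeff P 1)"] \<open>coeff P 1 \<noteq> 0\<close> by simp
  ultimately have "int l - int (degree (coeff P 1)) = d" using m by linarith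
  then show ?thesis unfolding edge_bound_def l_def[symmetric] key using d(2) by simp
qed

end

theorem ml_degree_eq_1_if_mu_dvd:
  assumes rank: "effective_rank_two p" and uni: "unimodular_support p" and dvd: "mu m0 p dvd p ^ N"
  shows "ml_degree p = 1"
proof -
  let ?A = "Poly_Mapping.keys p" and ?P = "convex hull (real_pt ` Poly_Mapping.keys p)"
  have "?A \<noteq> {}" using effective_rank_two_det[OF rank] by auto
  then obtain x where x: "x extreme_point_of ?P"
    using extreme_point_exists_convex[of ?P] by (auto simp: finite_imp_compact compact_convex_hull)
  then obtain v where v: "v \<in> ?A" and "x = real_pt v" using extreme_point_of_convex_hull by blast
  with x have ext: "real_pt v extreme_point_of ?P" by simp
  obtain b b' where b: "b \<in> ?A" "b' \<in> ?A" "lattice_det (b - v) (b' - v) \<noteq> 0"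
    using effective_rank_two_det[OF rank, of v] by blast
  have basis: "is_Z_basis {a - v | a e. e edge_of ?P \<and> real_pt v \<in> e \<and> nearest_on_edge ?A e v a}"
    using uni v ext unfolding unimodular_support_def Let_def by blast
  obtain w1 w2 where det: "(lattice_det w1 w2)\<^sup>2 = 1" and w: "v + w1 \<in> ?A" "v + w2 \<in> ?A"
    and cone: "\<And>a. a \<in> ?A \<Longrightarrow> \<exists>s t :: nat. a = v + (zscale (int s) w1 + zscale (int t) w2)"
    by (rule vertex_basis[OF finite_keys v ext basis b]) (rule that)
  interpret B: lattice_basis w1 w2 by standard (rule det)
  \<comment> \<open>The same vertex with its edges exchanged, as needed for
    \<open>swap_vars P\<close>.\<close>
  interpret C: lattice_basis w2 w1
    by standard (use det in \<open>simp add: lattice_det_def power2_eq_square algebra_simps\<close>)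
  obtain P where P: "ratfun_of p = mon v * B.E P"
    and co: "\<And>s t. coeff (coeff P t) s = Poly_Mapping.lookup p (v + B.pt (int s) (int t))"
    by (rule B.laurent_representation[where h = p and e = v, OF cone]) (assumption, rule that)
  have cs: "coeff (coeff P 0) 0 \<noteq> 0" "coeff (coeff P 0) 1 \<noteq> 0" "coeff (coeff P 1) 0 \<noteq> 0"
    unfolding co using v w by (simp_all add: zscale_def in_keys_iff flip: zero_prod_def)
  then have P0: "P \<noteq> 0" by auto
  obtain i j where mu: "mu_poly P dvd P ^ N * [:[:0, 1:]:] ^ i * [:0, 1:] ^ j"
    by (rule B.mu_poly_dvd[OF P P0 dvd]) (rule that)
  \<comment> \<open>A divisor of a nonzero polynomial is nonzero; this is what makes the logarithmic
    gradient dominant.\<close>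
  have mu0: "mu_poly P \<noteq> 0" using mu P0 by auto
  have eb1: "edge_bound P" by (rule B.edge_bound_of_support[OF uni rank cone v w(1) co])
  have eb2: "edge_bound (swap_vars P)"
  proof (rule C.edge_bound_of_support[OF uni rank _ v w(2)])
    show "\<exists>s t :: nat. a = v + C.pt (int s) (int t)" if "a \<in> ?A" for a
      using cone[OF that] by (metis add.commute)
    show "coeff (coeff (swap_vars P) t) s = Poly_Mapping.lookup p (v + C.pt (int s) (int t))" for s t
      unfolding coeff_swap_vars co by (simp only: add.commute)
  qed
  from mu_poly_dvd_power_classification[OF cs mu eb1 eb2] show ?thesis
  proof (elim disjE exE conjE)
    fix \<alpha> \<beta> \<gamma> c n
    assume nz: "\<beta> \<noteq> 0" "\<gamma> \<noteq> 0" "c \<noteq> 0" "n > 0" and Peq: "P = [:[:c:]:] * [:[:\<alpha>, \<beta>:], [:\<gamma>:]:] ^ n"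
    have "coeff (coeff P 0) 0 = c * \<alpha> ^ n" unfolding Peq by (simp add: coeff_0_power coeff_01_mult)
    then have "\<alpha> \<noteq> 0" using cs(1) nz(4) by auto
    then show ?thesis by (rule B.ml_degree_simplex_power[OF P Peq _ nz mu0])
  next
    fix z z' c k l
    assume nz: "z \<noteq> 0" "z' \<noteq> 0" "c \<noteq> 0" "k > 0" "l > 0" and Peq: "P = [:[:c:]:] * (xlin z ^ k * ylin z' ^ l)"
    show ?thesis by (rule B.ml_degree_box_power[OF P Peq nz mu0])
  qed
qed

section \<open>Edges at a unimodular vertex\<close>

lemma zscale_01: "zscale 0 w = 0" "zscale 1 w = w"
  by (simp_all add: zscale_def zero_prod_def)

context lattice_basis begin

text \<open>Real coordinates with respect to w1 and w2, by Cramer's rule.\<close>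

definition cfun :: "real \<times> real \<Rightarrow> real \<times> real" where
  "cfun x = (of_int (lattice_det w1 w2) * (fst x * of_int (snd w2) - of_int (fst w2) * snd x),
    of_int (lattice_det w1 w2) * (of_int (fst w1) * snd x - fst x * of_int (snd w1)))"

lemma cfun_linear: "cfun (x + y) = cfun x + cfun y" "cfun (x - y) = cfun x - cfun y" "cfun (r *\<^sub>R x) = r *\<^sub>R cfun x"
  by (simp_all add: cfun_def algebra_simps)

lemma cfun_expand: "x = fst (cfun x) *\<^sub>R real_pt w1 + snd (cfun x) *\<^sub>R real_pt w2"
proof -
  obtain a b c d where w: "w1 = (a, c)" "w2 = (b, d)" by (metis surj_pair)
  obtain x1 x2 where x: "x = (x1, x2)" by (cases x)
  define a' b' c' d' where "a' = real_of_int a" and "b' = real_of_int b" and "c' = real_of_int c" and "d' = real_of_int d"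
  have "real_of_int ((a * d - b * c)\<^sup>2) = 1" using det by (simp add: w lattice_det_def)
  then have D: "(a' * d' - b' * c')\<^sup>2 = 1" by (simp add: a'_def b'_def c'_def d'_def)
  have "x1 = (a' * d' - b' * c') * (x1 * d' - b' * x2) * a' + (a' * d' - b' * c') * (a' * x2 - x1 * c') * b'"
    "x2 = (a' * d' - b' * c') * (x1 * d' - b' * x2) * c' + (a' * d' - b' * c') * (a' * x2 - x1 * c') * d'"
    using D by algebra+
  then show ?thesis unfolding cfun_def by (simp add: w x real_pt_def lattice_det_def a'_def b'_def c'_def d'_def)
qed

lemma cfun_pt: "cfun (real_pt (pt s t)) = (of_int s, of_int t)"
proof -
  define u where "u = pt s t"
  have "pt (lattice_det w1 w2 * lattice_det u w2) (lattice_det w1 w2 * lattice_det w1 u) = pt s t"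
    unfolding pt_eq u_def ..
  then have "lattice_det w1 w2 * lattice_det u w2 = s" "lattice_det w1 w2 * lattice_det w1 u = t"
    unfolding pt_inject by simp_all
  moreover have "cfun (real_pt u) = (of_int (lattice_det w1 w2 * lattice_det u w2), of_int (lattice_det w1 w2 * lattice_det w1 u))"
    by (simp add: cfun_def real_pt_def lattice_det_def algebra_simps)
  ultimately show ?thesis by (simp add: u_def)
qed

lemma cfun_w: "cfun (real_pt w1) = (1, 0)" "cfun (real_pt w2) = (0, 1)"
  using cfun_pt[of 1 0] cfun_pt[of 0 1] by (simp_all add: zscale_01)

lemma real_pt_add: "real_pt (a + b) = real_pt a + real_pt b"
  by (simp add: real_pt_def)

lemma cone_hull:
  assumes cone: "\<And>a. a \<in> A \<Longrightarrow> \<exists>s t :: nat. a = v + pt (int s) (int t)"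
    and x: "x \<in> convex hull (real_pt ` A)"
  shows "fst (cfun (x - real_pt v)) \<ge> 0" "snd (cfun (x - real_pt v)) \<ge> 0"
proof -
  define S where "S = {x. fst (cfun (x - real_pt v)) \<ge> 0 \<and> snd (cfun (x - real_pt v)) \<ge> 0}"
  have "convex S"
  proof (rule convexI)
    fix y z and u r :: real
    assume y: "y \<in> S" "z \<in> S" and u: "0 \<le> u" "0 \<le> r" "u + r = 1"
    have "u *\<^sub>R y + r *\<^sub>R z - (u + r) *\<^sub>R real_pt v = u *\<^sub>R (y - real_pt v) + r *\<^sub>R (z - real_pt v)"
      by (simp add: algebra_simps)
    then have "cfun (u *\<^sub>R y + r *\<^sub>R z - real_pt v) = u *\<^sub>R cfun (y - real_pt v) + r *\<^sub>R cfun (z - real_pt v)"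
      using u(3) by (simp add: cfun_linear)
    then show "u *\<^sub>R y + r *\<^sub>R z \<in> S" using y u by (simp add: S_def)
  qed
  moreover have "real_pt ` A \<subseteq> S"
  proof (rule image_subsetI)
    fix a assume "a \<in> A"
    from cone[OF this] obtain s t :: nat where "a = v + pt (int s) (int t)" by blast
    then have "real_pt a - real_pt v = real_pt (pt (int s) (int t))" by (simp only: real_pt_add) simp
    then show "real_pt a \<in> S" by (simp add: S_def cfun_pt)
  qed
  ultimately have "x \<in> S" using x hull_minimal[of "real_pt ` A" S convex] by blast
  then show "fst (cfun (x - real_pt v)) \<ge> 0" "snd (cfun (x - real_pt v)) \<ge> 0" by (simp_all add: S_def)
qed

text \<open>An edge through the vertex that contained an interior direction of the cone would contain
  points on both rays of the cone.\<close>
lemma edge_at_vertex: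
  assumes cone: "\<And>a. a \<in> A \<Longrightarrow> \<exists>s t :: nat. a = v + pt (int s) (int t)"
    and A: "v \<in> A" "v + w1 \<in> A" "v + w2 \<in> A"
    and e: "e edge_of (convex hull (real_pt ` A))" "real_pt v \<in> e" and y: "y \<in> e"
  shows "fst (cfun (y - real_pt v)) = 0 \<or> snd (cfun (y - real_pt v)) = 0"
proof (rule ccontr)
  let ?P = "convex hull (real_pt ` A)"
  define V W1 W2 where "V = real_pt v" and "W1 = real_pt w1" and "W2 = real_pt w2"
  define \<sigma> \<tau> where "\<sigma> = fst (cfun (y - V))" and "\<tau> = snd (cfun (y - V))"
  have face: "e face_of ?P" and dim: "aff_dim e = 1" using e by (simp_all add: edge_of_def)
  have yP: "y \<in> ?P" using y face_of_imp_subset[OF face] by blast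
  have "\<sigma> \<ge> 0" "\<tau> \<ge> 0"
    unfolding \<sigma>_def \<tau>_def V_def by (rule cone_hull[OF cone yP], assumption)+
  moreover assume "\<not> (fst (cfun (y - real_pt v)) = 0 \<or> snd (cfun (y - real_pt v)) = 0)"
  ultimately have st: "\<sigma> > 0" "\<tau> > 0" by (simp_all add: \<sigma>_def \<tau>_def V_def)
  have yexp: "y - V = \<sigma> *\<^sub>R W1 + \<tau> *\<^sub>R W2" unfolding \<sigma>_def \<tau>_def W1_def W2_def by (rule cfun_expand)
  \<comment> \<open>The bound by 1 keeps the two points on the rays inside the hull, and the bound
    by the coordinate sum keeps z between the vertex and y. Rescaled to coordinate sum epsilon, z
    lies on the open segment joining those two points, so both belong to the face.\<close>
  define \<epsilon> where "\<epsilon> = min 1 (\<sigma> + \<tau>)"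
  have eps: "\<epsilon> > 0" "\<epsilon> \<le> 1" "\<epsilon> \<le> \<sigma> + \<tau>" using st by (simp_all add: \<epsilon>_def)
  have VP: "V \<in> ?P" "V + W1 \<in> ?P" "V + W2 \<in> ?P"
    unfolding V_def W1_def W2_def real_pt_add[symmetric] using A by (simp_all add: hull_inc)
  have seg: "V + r *\<^sub>R u \<in> C" if "convex C" "V \<in> C" "V + u \<in> C" "0 \<le> r" "r \<le> 1" for r u and C :: "(real \<times> real) set"
  proof -
    have "(1 - r) *\<^sub>R V + r *\<^sub>R (V + u) \<in> C" using that by (simp add: convexD)
    moreover have "(1 - r) *\<^sub>R V + r *\<^sub>R (V + u) = V + r *\<^sub>R u" by (simp add: algebra_simps)
    ultimately show ?thesis by simp
  qed
  have E12: "V + \<epsilon> *\<^sub>R W1 \<in> ?P" "V + \<epsilon> *\<^sub>R W2 \<in> ?P"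
    using seg[OF convex_convex_hull VP(1) VP(2)] seg[OF convex_convex_hull VP(1) VP(3)] eps by simp_all
  define z where "z = V + (\<epsilon> / (\<sigma> + \<tau>)) *\<^sub>R (y - V)"
  have "z \<in> e" unfolding z_def
    by (rule seg[OF face_of_imp_convex[OF face]]) (use e(2) y eps st in \<open>simp_all add: V_def\<close>)
  moreover have "z \<in> open_segment (V + \<epsilon> *\<^sub>R W1) (V + \<epsilon> *\<^sub>R W2)"
    unfolding in_segment(2)
  proof (intro conjI exI[of _ "\<tau> / (\<sigma> + \<tau>)"])
    show "V + \<epsilon> *\<^sub>R W1 \<noteq> V + \<epsilon> *\<^sub>R W2"
    proof
      assume "V + \<epsilon> *\<^sub>R W1 = V + \<epsilon> *\<^sub>R W2"
      then have "W1 = W2" using eps by simp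
      then have "cfun W1 = cfun W2" by simp
      then show False unfolding W1_def W2_def cfun_w by simp
    qed
    have one: "1 - \<tau> / (\<sigma> + \<tau>) = \<sigma> / (\<sigma> + \<tau>)" using st by (simp add: field_simps)
    have sumV: "(\<sigma> / (\<sigma> + \<tau>)) *\<^sub>R V + (\<tau> / (\<sigma> + \<tau>)) *\<^sub>R V = V"
      using st by (simp flip: scaleR_add_left add_divide_distrib)
    have "(1 - \<tau> / (\<sigma> + \<tau>)) *\<^sub>R (V + \<epsilon> *\<^sub>R W1) + (\<tau> / (\<sigma> + \<tau>)) *\<^sub>R (V + \<epsilon> *\<^sub>R W2) =
      ((\<sigma> / (\<sigma> + \<tau>)) *\<^sub>R V + (\<tau> / (\<sigma> + \<tau>)) *\<^sub>R V) + (\<epsilon> * \<sigma> / (\<sigma> + \<tau>)) *\<^sub>R W1 + (\<epsilon> * \<tau> / (\<sigma> + \<tau>)) *\<^sub>R W2"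
      unfolding one by (simp add: scaleR_add_right mult.commute)
    also have "\<dots> = z" unfolding sumV z_def yexp by (simp add: scaleR_add_right)
    finally show "z = (1 - \<tau> / (\<sigma> + \<tau>)) *\<^sub>R (V + \<epsilon> *\<^sub>R W1) + (\<tau> / (\<sigma> + \<tau>)) *\<^sub>R (V + \<epsilon> *\<^sub>R W2)" by simp
  qed (use st in simp_all)
  ultimately have "V + \<epsilon> *\<^sub>R W1 \<in> e" "V + \<epsilon> *\<^sub>R W2 \<in> e" using face E12 unfolding face_of_def by blast+
  moreover have "collinear e" using dim by (simp add: collinear_aff_dim)
  then obtain u where u: "\<And>x y. x \<in> e \<Longrightarrow> y \<in> e \<Longrightarrow> \<exists>c. x - y = c *\<^sub>R u" unfolding collinear_def by blast
  moreover have "V \<in> e" using e by (simp add: V_def)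
  ultimately obtain c1 c2 where c: "\<epsilon> *\<^sub>R W1 = c1 *\<^sub>R u" "\<epsilon> *\<^sub>R W2 = c2 *\<^sub>R u"
    using u[of "V + \<epsilon> *\<^sub>R W1" V] u[of "V + \<epsilon> *\<^sub>R W2" V] by auto
  \<comment> \<open>A one-dimensional edge cannot contain independent directions.\<close>
  have "cfun (\<epsilon> *\<^sub>R W1) = cfun (c1 *\<^sub>R u)" "cfun (\<epsilon> *\<^sub>R W2) = cfun (c2 *\<^sub>R u)" using c by simp_all
  then have "(\<epsilon>, 0) = c1 *\<^sub>R cfun u" "(0, \<epsilon>) = c2 *\<^sub>R cfun u"
    by (simp_all add: cfun_linear W1_def W2_def cfun_w)
  then show False using eps(1) by (cases "cfun u") auto
qed

lemma edges_at_vertex_exist: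
  assumes cone: "\<And>a. a \<in> A \<Longrightarrow> \<exists>s t :: nat. a = v + pt (int s) (int t)"
    and A: "finite A" "v \<in> A" "v + w1 \<in> A" "v + w2 \<in> A" and w: "w = w1 \<or> w = w2"
  obtains e where "e edge_of (convex hull (real_pt ` A))" "real_pt v \<in> e"
    "\<And>b. b \<in> A \<Longrightarrow> real_pt b \<in> e \<longleftrightarrow> lattice_det w (b - v) = 0"
proof -
  have w0: "w1 \<noteq> 0" "w2 \<noteq> 0" using det by (auto simp: lattice_det_def)
  have d0: "lattice_det w1 w2 \<noteq> 0" using det by auto
  have dd: "lattice_det w1 w2 * lattice_det w1 w2 = 1" using det by (simp add: power2_eq_square)
  have l: "lattice_det w1 (pt s t) = t * lattice_det w1 w2" "lattice_det w2 (pt s t) = - (s * lattice_det w1 w2)" for s t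
    by (simp_all add: lattice_det_def zscale_def algebra_simps)
  from w show ?thesis
  proof
    assume w: "w = w1"
    have nn: "0 \<le> lattice_det w1 w2 * lattice_det (v + w1 - v) (b - v)" if b: "b \<in> A" for b
    proof -
      from cone[OF b] obtain s t :: nat where "b - v = pt (int s) (int t)" by (auto simp: algebra_simps)
      then show ?thesis using dd by (simp add: l mult.left_commute)
    qed
    have "v + w1 \<noteq> v" using w0 by simp
    then obtain e where e: "e edge_of (convex hull (real_pt ` A))" "real_pt v \<in> e"
      "\<And>b. b \<in> A \<Longrightarrow> real_pt b \<in> e \<longleftrightarrow> lattice_det (v + w1 - v) (b - v) = 0"
      by (rule edge_exists[OF A(1,2,3) _ d0 nn]) (assumption, rule that)
    show ?thesis by (rule that[OF e(1,2)]) (simp add: e(3) w)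
  next
    assume w: "w = w2"
    have nn: "0 \<le> - lattice_det w1 w2 * lattice_det (v + w2 - v) (b - v)" if b: "b \<in> A" for b
    proof -
      from cone[OF b] obtain s t :: nat where "b - v = pt (int s) (int t)" by (auto simp: algebra_simps)
      then show ?thesis using dd by (simp add: l mult.left_commute)
    qed
    have "v + w2 \<noteq> v" "- lattice_det w1 w2 \<noteq> 0" using w0 d0 by simp_all
    then obtain e where e: "e edge_of (convex hull (real_pt ` A))" "real_pt v \<in> e"
      "\<And>b. b \<in> A \<Longrightarrow> real_pt b \<in> e \<longleftrightarrow> lattice_det (v + w2 - v) (b - v) = 0"
      by (rule edge_exists[OF A(1,2,4) _ _ nn]) (assumption, rule that)
    show ?thesis by (rule that[OF e(1,2)]) (simp add: e(3) w)
  qed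
qed

text \<open>A converse to \<open>vertex_basis\<close>: every edge at v runs along a ray of the cone,
  and the first support point on each ray is v + w1 or v + w2.\<close>

lemma nearest_at_vertex:
  assumes cone: "\<And>a. a \<in> A \<Longrightarrow> \<exists>s t :: nat. a = v + pt (int s) (int t)"
    and A: "finite A" "v \<in> A" "v + w1 \<in> A" "v + w2 \<in> A"
  shows "{a - v | a e. e edge_of (convex hull (real_pt ` A)) \<and> real_pt v \<in> e \<and> nearest_on_edge A e v a} = {w1, w2}"
    (is "?S = _")
proof -
  let ?P = "convex hull (real_pt ` A)"
  have w0: "w1 \<noteq> 0" "w2 \<noteq> 0" using det by (auto simp: lattice_det_def)
  have near: "a = v + w1 \<or> a = v + w2"
    if e: "e edge_of ?P" "real_pt v \<in> e" and a: "nearest_on_edge A e v a" for a e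
  proof -
    have aA: "a \<in> A" "a \<noteq> v" "real_pt a \<in> e"
      and min: "\<And>b. b \<in> A \<Longrightarrow> b \<noteq> v \<Longrightarrow> real_pt b \<in> e \<Longrightarrow> dist (real_pt v) (real_pt a) \<le> dist (real_pt v) (real_pt b)"
      using a by (auto simp: nearest_on_edge_def)
    from cone[OF aA(1)] obtain s t :: nat where st: "a = v + pt (int s) (int t)" by blast
    have "real_pt a - real_pt v = real_pt (pt (int s) (int t))"
      by (simp only: st real_pt_add[of v] add_diff_cancel_left')
    then have "cfun (real_pt a - real_pt v) = (of_nat s, of_nat t)" by (simp only: cfun_pt) simp
    then have z: "s = 0 \<or> t = 0" using edge_at_vertex[OF cone A(2-4) e aA(3)] by simp
    have conv: "convex e" using e face_of_imp_convex by (auto simp: edge_of_def)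
    \<comment> \<open>The point v + w lies on the segment from v to v + m w, hence on the edge, so a
      nearest point has m = 1.\<close>
    have key: "a = v + w" if "a = v + zscale (int m) w" "m > 0" "v + w \<in> A" "w \<noteq> 0" for m w
    proof -
      have ra: "real_pt a = real_pt v + of_nat m *\<^sub>R real_pt w"
        using that(1) by (simp add: real_pt_def zscale_def)
      have "(1 - 1 / of_nat m) *\<^sub>R real_pt v + (1 / of_nat m) *\<^sub>R real_pt a \<in> e"
        using conv e(2) aA(3) that(2) by (intro convexD) auto
      moreover have "(1 - 1 / of_nat m) *\<^sub>R real_pt v + (1 / of_nat m) *\<^sub>R real_pt a = real_pt (v + w)"
        unfolding ra real_pt_add using that(2) by (simp add: algebra_simps)
      ultimately have "real_pt (v + w) \<in> e" by simp
      then have "dist (real_pt v) (real_pt a) \<le> dist (real_pt v) (real_pt (v + w))"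
        using min[OF that(3)] that(4) by simp
      then have "of_nat m * norm (real_pt w) \<le> 1 * norm (real_pt w)"
        unfolding ra real_pt_add dist_norm by simp
      moreover have "real_pt w \<noteq> 0" using that(4) by (auto simp: real_pt_def prod_eq_iff)
      ultimately have "of_nat m \<le> (1 :: real)" by (simp add: mult_le_cancel_right)
      then have "m = 1" using that(2) by simp
      then show ?thesis using that(1) by (simp add: zscale_01)
    qed
    show ?thesis
    proof (cases "t = 0")
      case True
      then have "a = v + zscale (int s) w1" using st by (simp add: zscale_01)
      moreover from this have "s > 0" using aA(2) by (cases s) (auto simp: zscale_01)
      ultimately show ?thesis using key A w0 by blast
    next
      case False
      then have "a = v + zscale (int t) w2" using st z by (simp add: zscale_01)
      then show ?thesis using key[of t w2] False A w0 by blast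
    qed
  qed
  have ex: "w \<in> ?S" if w: "w = w1 \<or> w = w2" for w
  proof -
    obtain e where e: "e edge_of ?P" "real_pt v \<in> e" "\<And>b. b \<in> A \<Longrightarrow> real_pt b \<in> e \<longleftrightarrow> lattice_det w (b - v) = 0"
      by (rule edges_at_vertex_exist[OF cone A w]) (assumption, rule that)
    have vw: "v + w \<in> A" "v + w \<noteq> v" using A w w0 by auto
    have "real_pt (v + w) \<in> e" using e(3)[OF vw(1)] by (simp add: lattice_det_def)
    then obtain a where a: "nearest_on_edge A e v a" using nearest_on_edge_exists[OF A(1) vw] by blast
    then have "lattice_det w (a - v) = 0" using e(3)[of a] by (simp add: nearest_on_edge_def)
    moreover have "lattice_det w1 w2 \<noteq> 0" "lattice_det w2 w1 \<noteq> 0"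
      using det by (auto simp: lattice_det_def)
    ultimately have "a - v = w" using near[OF e(1,2) a] w by auto
    then show ?thesis using e(1,2) a by blast
  qed
  show ?thesis
  proof
    show "?S \<subseteq> {w1, w2}"
    proof
      fix x assume "x \<in> ?S"
      then obtain a e where "x = a - v" "e edge_of ?P" "real_pt v \<in> e" "nearest_on_edge A e v a" by blast
      then show "x \<in> {w1, w2}" using near[of e a] by auto
    qed
    show "{w1, w2} \<subseteq> ?S" using ex by blast
  qed
qed

text \<open>An edge direction is a nonnegative multiple of w1 or w2, and primitivity makes the
  multiple 1.\<close>

lemma primitive_at_vertex:
  assumes cone: "\<And>a. a \<in> A \<Longrightarrow> \<exists>s t :: nat. a = v + pt (int s) (int t)"
    and A: "finite A" "v \<in> A" "v + w1 \<in> A" "v + w2 \<in> A"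
  shows "primitive_edge_directions (convex hull (real_pt ` A)) (real_pt v) = {w1, w2}" (is "?S = _")
proof
  let ?P = "convex hull (real_pt ` A)"
  show "?S \<subseteq> {w1, w2}"
  proof
    fix u assume "u \<in> ?S"
    then obtain e r where u: "coprime (fst u) (snd u)" and e: "e edge_of ?P" "real_pt v \<in> e"
      and r: "r > 0" "real_pt v + r *\<^sub>R real_pt u \<in> e"
      unfolding primitive_edge_directions_def by blast
    obtain s t where st: "u = pt s t" using pt_eq by metis
    have c: "cfun (real_pt v + r *\<^sub>R real_pt u - real_pt v) = (r * of_int s, r * of_int t)"
      by (simp add: st cfun_linear cfun_pt)
    have "e \<subseteq> ?P" using e(1) by (simp add: edge_of_def face_of_imp_subset)
    then have uP: "real_pt v + r *\<^sub>R real_pt u \<in> ?P" using r(2) by blast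
    have "fst (r * of_int s, r * of_int t) \<ge> 0" "snd (r * of_int s, r * of_int t) \<ge> 0"
      unfolding c[symmetric] by (rule cone_hull[OF cone uP], assumption)+
    then have pos: "s \<ge> 0" "t \<ge> 0" using r(1) by (simp_all add: zero_le_mult_iff)
    have z: "s = 0 \<or> t = 0" using edge_at_vertex[OF cone A(2-4) e r(2)] unfolding c using r(1) by simp
    have one: "k = 1" if "u = zscale k w" "k \<ge> 0" for k w
    proof -
      have "k dvd fst u" "k dvd snd u" using that by (simp_all add: zscale_def)
      then have "k dvd 1" using u coprime_common_divisor by blast
      then show ?thesis using that by simp
    qed
    show "u \<in> {w1, w2}"
    proof (cases "t = 0")
      case True
      then have "u = zscale s w1" by (simp add: st zscale_01)
      moreover from this have "s = 1" using one pos by blast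
      ultimately show ?thesis by (simp add: zscale_01)
    next
      case False
      then have "u = zscale t w2" using z by (simp add: st zscale_01)
      moreover from this have "t = 1" using one pos by blast
      ultimately show ?thesis by (simp add: zscale_01)
    qed
  qed
  show "{w1, w2} \<subseteq> ?S"
  proof
    fix w assume "w \<in> {w1, w2}"
    then have w: "w = w1 \<or> w = w2" by simp
    obtain e where e: "e edge_of ?P" "real_pt v \<in> e" "\<And>b. b \<in> A \<Longrightarrow> real_pt b \<in> e \<longleftrightarrow> lattice_det w (b - v) = 0"
      by (rule edges_at_vertex_exist[OF cone A w]) (assumption, rule that)
    have "v + w \<in> A" using A w by auto
    then have "real_pt (v + w) \<in> e" using e(3)[of "v + w"] by (simp add: lattice_det_def)
    then have "real_pt v + 1 *\<^sub>R real_pt w \<in> e" by (simp add: real_pt_add)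
    moreover have "coprime (fst w) (snd w)"
    proof (rule coprimeI)
      fix k assume k: "k dvd fst w" "k dvd snd w"
      then have "k dvd lattice_det w1 w2" using w by (auto simp: lattice_det_def)
      then have "k dvd (lattice_det w1 w2)\<^sup>2" by (simp add: power2_eq_square)
      then show "k dvd 1" by (simp add: det)
    qed
    ultimately show "w \<in> ?S" unfolding primitive_edge_directions_def using e(1,2) zero_less_one by blast
  qed
qed

end

section \<open>The trapezoid\<close>

definition trapezoid :: laurent where
  "trapezoid = Poly_Mapping.single (0, 0) 1 + Poly_Mapping.single (1, 0) 2 + Poly_Mapping.single (2, 0) 1
     + Poly_Mapping.single (0, 1) 1 + Poly_Mapping.single (1, 1) 1"

lemma lookup_trapezoid: "Poly_Mapping.lookup trapezoid a =
    (if a = (1, 0) then 2 else if a \<in> {(0, 0), (2, 0), (0, 1), (1, 1)} then 1 else 0)"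
  by (auto simp: trapezoid_def lookup_add lookup_single when_def)

lemma keys_trapezoid: "Poly_Mapping.keys trapezoid = {(0, 0), (1, 0), (2, 0), (0, 1), (1, 1)}"
proof (rule set_eqI)
  fix a show "a \<in> Poly_Mapping.keys trapezoid \<longleftrightarrow> a \<in> {(0, 0), (1, 0), (2, 0), (0, 1), (1, 1)}"
    unfolding in_keys_iff lookup_trapezoid by auto
qed

lemma lattice_basis_standard: "lattice_basis (1, 0) (0, 1)"
  by standard (simp add: lattice_det_def)

definition trapezoid_poly :: bipoly where
  "trapezoid_poly = [:[:1, 2, 1:], [:1, 1:]:]"

lemma ratfun_of_trapezoid:
  "ratfun_of trapezoid = mon 0 * ratfun_eval (lattice_basis.X (1, 0)) (lattice_basis.Y (0, 1)) trapezoid_poly"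
proof -
  interpret lattice_basis "(1, 0)" "(0, 1)" by (rule lattice_basis_standard)
  have XY: "X = ratX" "Y = ratY" by (simp_all add: X_def Y_def ratX_ratY_eq_mon)
  have two: "ratC 2 = 2" using of_int_ratfun[of 2] by simp
  have "ratfun_of trapezoid = 1 + 2 * ratX + ratX\<^sup>2 + ratY + ratX * ratY"
    by (simp add: trapezoid_def ratfun_of_add ratfun_of_single ratmon_def ratC_hom two)
  moreover have "E trapezoid_poly = 1 + 2 * ratX + ratX\<^sup>2 + ratY + ratX * ratY"
    by (simp add: trapezoid_poly_def ratfun_eval_pCons map_poly_pCons ratC_hom XY two power2_eq_square algebra_simps)
  moreover have "mon 0 = 1" by (simp add: ratmon_def ratC_hom)
  ultimately show ?thesis by simp
qed

text \<open>The polynomial is x y (1 + x)^2 (2 + 2x + y). The point (1, -4) is a torus point on its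
  last factor, and the value 20 at (1, 1) shows that it is not zero.\<close>

lemma mu_trapezoid_poly:
  "poly (poly (mu_poly trapezoid_poly) [:-4:]) 1 = 0" "mu_poly trapezoid_poly \<noteq> 0"
proof -
  have t: "theta_x trapezoid_poly = [:[:0, 2, 2:], [:0, 1:]:]" "theta_y trapezoid_poly = [:0, [:1, 1:]:]"
    "theta_x [:[:0, 2, 2:], [:0, 1:]:] = [:[:0, 2, 4:], [:0, 1:]:]"
    "theta_x [:0, [:1, 1:]:] = [:0, [:0, 1:]:]" "theta_y [:0, [:1, 1:]:] = [:0, [:1, 1:]:]"
    by (simp_all add: trapezoid_poly_def theta_x_def theta_y_def map_poly_pCons pderiv_pCons)
  have mu: "mu_poly trapezoid_poly = trapezoid_poly * ([:[:0, 2, 4:], [:0, 1:]:] * [:0, [:1, 1:]:] - [:0, [:0, 1:]:]\<^sup>2)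
      - ([:[:0, 2, 4:], [:0, 1:]:] * [:0, [:1, 1:]:]\<^sup>2 + [:0, [:1, 1:]:] * [:[:0, 2, 2:], [:0, 1:]:]\<^sup>2
        - 2 * [:0, [:0, 1:]:] * [:[:0, 2, 2:], [:0, 1:]:] * [:0, [:1, 1:]:])"
    by (simp only: mu_poly_def bordered_hess_def t)
  show "poly (poly (mu_poly trapezoid_poly) [:-4:]) 1 = 0"
    unfolding mu unfolding trapezoid_poly_def poly_diff poly_add poly_mult poly_power by simp
  have "poly (poly (mu_poly trapezoid_poly) [:1:]) 1 = 20"
    unfolding mu unfolding trapezoid_poly_def poly_diff poly_add poly_mult poly_power by simp
  then show "mu_poly trapezoid_poly \<noteq> 0" by auto
qed

lemma trapezoid_poly_nonzero: "trapezoid_poly \<noteq> 0"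
  by (simp add: trapezoid_poly_def)

lemma mu_trapezoid_not_dvd: "\<not> mu m0 trapezoid dvd trapezoid ^ N"
proof
  interpret lattice_basis "(1, 0)" "(0, 1)" by (rule lattice_basis_standard)
  assume "mu m0 trapezoid dvd trapezoid ^ N"
  then obtain i j where "mu_poly trapezoid_poly dvd trapezoid_poly ^ N * [:[:0, 1:]:] ^ i * [:0, 1:] ^ j"
    by (rule mu_poly_dvd[OF ratfun_of_trapezoid trapezoid_poly_nonzero]) (rule that)
  then obtain k where "trapezoid_poly ^ N * [:[:0, 1:]:] ^ i * [:0, 1:] ^ j = mu_poly trapezoid_poly * k" ..
  then have "poly (poly (trapezoid_poly ^ N * [:[:0, 1:]:] ^ i * [:0, 1:] ^ j) [:-4:]) 1 =
      poly (poly (mu_poly trapezoid_poly * k) [:-4:]) 1" by (rule arg_cong)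
  also have "\<dots> = 0" by (simp only: poly_mult mu_trapezoid_poly mult_zero_left)
  finally have "poly (poly trapezoid_poly [:-4:]) 1 = 0"
    unfolding poly_mult poly_power by simp
  then show False by (simp add: trapezoid_poly_def)
qed

text \<open>Writing D1 = 1 + X and D2 = 1 + X + Y, the components are A = X / D1 + X / D2 and B = Y
  / D2. Since 2 - B = (D1 + D2) / D2, the quotient A / (2 - B) is X / D1, which determines X; then Y
  = B D1 / (1 - B).\<close>

lemma ml_degree_trapezoid: "ml_degree trapezoid = 1"
proof -
  interpret lattice_basis "(1, 0)" "(0, 1)" by (rule lattice_basis_standard)
  show ?thesis
  proof (rule ml_degree_eq_1[OF ratfun_of_trapezoid trapezoid_poly_nonzero mu_trapezoid_poly(2)])
    define D1 D2 where "D1 = 1 + X" and "D2 = 1 + X + Y"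
    have two: "ratC 2 = 2" using of_int_ratfun[of 2] by simp
    have ev: "E [:[:1, 1:]:] = D1" "E [:[:1, 1:], [:1:]:] = D2" "E [:[:2, 2:], [:1:]:] = 2 * D1 + Y"
      "E trapezoid_poly = D1 * D2" "E (theta_x trapezoid_poly) = X * D2 + X * D1" "E (theta_y trapezoid_poly) = Y * D1"
      by (simp_all add: D1_def D2_def trapezoid_poly_def theta_x_def theta_y_def map_poly_pCons pderiv_pCons ratfun_eval_pCons
          ratC_hom two algebra_simps)
    have "E [:[:1, 1:]:] \<noteq> 0" "E [:[:1, 1:], [:1:]:] \<noteq> 0" "E [:[:2, 2:], [:1:]:] \<noteq> 0"
      unfolding E_eq_0_iff by simp_all
    then have nz: "D1 \<noteq> 0" "D2 \<noteq> 0" "2 * D1 + Y \<noteq> 0" unfolding ev .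
    fix S assume S: "is_subfield S" and AS: "E (theta_x trapezoid_poly) / E trapezoid_poly \<in> S"
      and BS: "E (theta_y trapezoid_poly) / E trapezoid_poly \<in> S"
    note cl = is_subfieldD[OF S]
    define A B where "A = E (theta_x trapezoid_poly) / E trapezoid_poly" and "B = E (theta_y trapezoid_poly) / E trapezoid_poly"
    have AB: "A \<in> S" "B \<in> S" using AS BS by (simp_all add: A_def B_def)
    have B: "B = Y / D2" unfolding B_def ev using nz by simp
    have A: "A = X / D1 + X / D2" unfolding A_def ev using nz by (simp add: field_simps)
    have D2: "D2 = D1 + Y" by (simp add: D1_def D2_def)
    have B2: "2 - B = (2 * D1 + Y) / D2" unfolding B using nz(2) by (simp add: field_simps D2)
    have B1: "1 - B = D1 / D2" unfolding B using nz(2) by (simp add: field_simps D2)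
    have "A = X / D1 * (2 - B)" unfolding A B2 using nz by (simp add: field_simps D2)
    then have Q: "A / (2 - B) = X / D1" using nz B2 by simp
    have "2 \<in> S" using cl(7)[of 2] by simp
    then have "A / (2 - B) \<in> S" by (intro cl(6) cl(5) AB)
    then have "1 - X / D1 \<in> S" unfolding Q by (intro cl(5) cl(9))
    moreover have "1 - X / D1 = 1 / D1" using nz by (simp add: field_simps D1_def)
    ultimately have "1 / (1 / D1) \<in> S" using cl(6)[OF cl(9), of "1 / D1"] by simp
    then have D1S: "D1 \<in> S" by simp
    then have "D1 - 1 \<in> S" by (intro cl(5) cl(9))
    then have XS: "X \<in> S" by (simp add: D1_def)
    have "B * D1 / (1 - B) \<in> S" by (intro cl(6) cl(2) cl(5) cl(9) AB D1S)
    moreover have "B * D1 / (1 - B) = Y" unfolding B1 unfolding B using nz by simp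
    ultimately show "X \<in> S \<and> Y \<in> S" using XS by simp
  qed
qed

abbreviation "trapezoid_hull \<equiv> convex hull (real_pt ` Poly_Mapping.keys trapezoid)"

text \<open>The witnesses are the primitive edge directions at the four corners. The support point
  (1, 0) is the midpoint of the bottom edge and hence not a vertex.\<close>

lemma trapezoid_vertex:
  assumes "v \<in> Poly_Mapping.keys trapezoid" "real_pt v extreme_point_of trapezoid_hull"
  obtains w1 w2 where "(lattice_det w1 w2)\<^sup>2 = 1" "v + w1 \<in> Poly_Mapping.keys trapezoid" "v + w2 \<in> Poly_Mapping.keys trapezoid"
    "\<And>a. a \<in> Poly_Mapping.keys trapezoid \<Longrightarrow> \<exists>s t :: nat. a = v + (zscale (int s) w1 + zscale (int t) w2)"
proof -
  let ?A = "Poly_Mapping.keys trapezoid"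
  have cone: "\<exists>s t :: nat. a = v + (zscale (int s) w1 + zscale (int t) w2)"
    if det: "(lattice_det w1 w2)\<^sup>2 = 1" and pos: "lattice_det w1 w2 * lattice_det (a - v) w2 \<ge> 0"
      "lattice_det w1 w2 * lattice_det w1 (a - v) \<ge> 0" for a w1 w2
  proof -
    interpret lattice_basis w1 w2 by standard (rule det)
    have "a = v + pt (int (nat (lattice_det w1 w2 * lattice_det (a - v) w2))) (int (nat (lattice_det w1 w2 * lattice_det w1 (a - v))))"
      using pos pt_eq[of "a - v"] by simp
    then show ?thesis by blast
  qed
  have "v \<noteq> (1, 0)"
  proof
    assume v: "v = (1, 0)"
    have "real_pt (0, 0) \<in> trapezoid_hull" "real_pt (2, 0) \<in> trapezoid_hull"
      by (simp_all add: hull_inc keys_trapezoid)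
    moreover have "real_pt v \<in> open_segment (real_pt (0, 0)) (real_pt (2, 0))"
      unfolding in_segment(2) by (intro conjI exI[of _ "1 / 2"]) (simp_all add: v real_pt_def)
    ultimately show False using assms(2) unfolding extreme_point_of_def by blast
  qed
  then consider "v = (0, 0)" | "v = (2, 0)" | "v = (0, 1)" | "v = (1, 1)"
    using assms(1) unfolding keys_trapezoid by auto
  then show ?thesis
  proof cases
    case 1
    show ?thesis
      by (rule that[of "(1, 0)" "(0, 1)"], simp_all add: lattice_det_def 1 keys_trapezoid)
        (rule cone[unfolded 1], auto simp: lattice_det_def keys_trapezoid)
  next
    case 2
    show ?thesis
      by (rule that[of "(-1, 0)" "(-1, 1)"], simp_all add: lattice_det_def 2 keys_trapezoid)
        (rule cone[unfolded 2], auto simp: lattice_det_def keys_trapezoid)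
  next
    case 3
    show ?thesis
      by (rule that[of "(1, 0)" "(0, -1)"], simp_all add: lattice_det_def 3 keys_trapezoid)
        (rule cone[unfolded 3], auto simp: lattice_det_def keys_trapezoid)
  next
    case 4
    show ?thesis
      by (rule that[of "(-1, 0)" "(1, -1)"], simp_all add: lattice_det_def 4 keys_trapezoid)
        (rule cone[unfolded 4], auto simp: lattice_det_def keys_trapezoid)
  qed
qed

lemma unimodular_trapezoid: "unimodular_support trapezoid"
  unfolding unimodular_support_def Let_def
proof (intro ballI impI)
  fix v assume v: "v \<in> Poly_Mapping.keys trapezoid" and ext: "real_pt v extreme_point_of trapezoid_hull"
  obtain w1 w2 where det: "(lattice_det w1 w2)\<^sup>2 = 1"
    and w: "v + w1 \<in> Poly_Mapping.keys trapezoid" "v + w2 \<in> Poly_Mapping.keys trapezoid"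
    and cone: "\<And>a. a \<in> Poly_Mapping.keys trapezoid \<Longrightarrow> \<exists>s t :: nat. a = v + (zscale (int s) w1 + zscale (int t) w2)"
    by (rule trapezoid_vertex[OF v ext]) (rule that)
  interpret lattice_basis w1 w2 by standard (rule det)
  have "{a - v | a e. e edge_of trapezoid_hull \<and> real_pt v \<in> e \<and> nearest_on_edge (Poly_Mapping.keys trapezoid) e v a} = {w1, w2}"
    by (rule nearest_at_vertex[OF cone finite_keys v w])
  then show "is_Z_basis {a - v | a e. e edge_of trapezoid_hull \<and> real_pt v \<in> e \<and> nearest_on_edge (Poly_Mapping.keys trapezoid) e v a}"
    using is_Z_basis_pair[OF det] by simp
qed

lemma smooth_trapezoid: "smooth_polygon trapezoid_hull"
  unfolding smooth_polygon_def lattice_polygon_def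
proof (intro conjI allI impI)
  show "\<exists>V. finite V \<and> trapezoid_hull = convex hull (real_pt ` V)" by (rule exI[of _ "Poly_Mapping.keys trapezoid"]) simp
  have "\<not> aff_dim trapezoid_hull \<le> 1"
  proof
    assume "aff_dim trapezoid_hull \<le> 1"
    then have "collinear trapezoid_hull" by (simp add: collinear_aff_dim)
    then obtain u where u: "\<And>x y. x \<in> trapezoid_hull \<Longrightarrow> y \<in> trapezoid_hull \<Longrightarrow> \<exists>c. x - y = c *\<^sub>R u"
      unfolding collinear_def by blast
    have "real_pt (0, 0) \<in> trapezoid_hull" "real_pt (1, 0) \<in> trapezoid_hull" "real_pt (0, 1) \<in> trapezoid_hull"
      by (simp_all add: hull_inc keys_trapezoid)
    then obtain c1 c2 where "real_pt (1, 0) - real_pt (0, 0) = c1 *\<^sub>R u" "real_pt (0, 1) - real_pt (0, 0) = c2 *\<^sub>R u"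
      using u by meson
    then show False by (cases u) (auto simp: real_pt_def)
  qed
  moreover have "aff_dim trapezoid_hull \<le> 2" using aff_dim_le_DIM[of trapezoid_hull] by simp
  ultimately show "aff_dim trapezoid_hull = 2" by simp
next
  fix x assume x: "x extreme_point_of trapezoid_hull"
  then obtain v where v: "v \<in> Poly_Mapping.keys trapezoid" and xv: "x = real_pt v"
    using extreme_point_of_convex_hull by blast
  obtain w1 w2 where det: "(lattice_det w1 w2)\<^sup>2 = 1"
    and w: "v + w1 \<in> Poly_Mapping.keys trapezoid" "v + w2 \<in> Poly_Mapping.keys trapezoid"
    and cone: "\<And>a. a \<in> Poly_Mapping.keys trapezoid \<Longrightarrow> \<exists>s t :: nat. a = v + (zscale (int s) w1 + zscale (int t) w2)"
    by (rule trapezoid_vertex[OF v x[unfolded xv]]) (rule that)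
  interpret lattice_basis w1 w2 by standard (rule det)
  have "primitive_edge_directions trapezoid_hull (real_pt v) = {w1, w2}"
    by (rule primitive_at_vertex[OF cone finite_keys v w])
  then show "is_Z_basis (primitive_edge_directions trapezoid_hull x)"
    unfolding xv using is_Z_basis_pair[OF det] by simp
qed

lemma lattice_points_trapezoid: "Poly_Mapping.keys trapezoid = {a. real_pt a \<in> trapezoid_hull}"
proof
  show "Poly_Mapping.keys trapezoid \<subseteq> {a. real_pt a \<in> trapezoid_hull}" by (auto simp: hull_inc)
  \<comment> \<open>The polygon through its edge inequalities 0 <= y <= 1, 0 <= x and x + y <= 2; on
    integers these leave just the five support points.\<close>
  define H :: "(real \<times> real) set" where
    "H = {x. (0, 1) \<bullet> x \<ge> 0} \<inter> {x. (0, 1) \<bullet> x \<le> 1} \<inter> {x. (1, 0) \<bullet> x \<ge> 0} \<inter> {x. (1, 1) \<bullet> x \<le> 2}"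
  have "convex H" unfolding H_def by (intro convex_Int convex_halfspace_ge convex_halfspace_le)
  moreover have "real_pt ` Poly_Mapping.keys trapezoid \<subseteq> H"
    unfolding keys_trapezoid by (auto simp: H_def real_pt_def inner_prod_def)
  ultimately have sub: "trapezoid_hull \<subseteq> H" by (intro hull_minimal)
  show "{a. real_pt a \<in> trapezoid_hull} \<subseteq> Poly_Mapping.keys trapezoid"
  proof
    fix a assume "a \<in> {a. real_pt a \<in> trapezoid_hull}"
    then have "real_pt a \<in> H" using sub by blast
    then have "snd a \<ge> 0" "snd a \<le> 1" "fst a \<ge> 0" "fst a + snd a \<le> 2"
      by (simp_all add: H_def real_pt_def inner_prod_def flip: of_int_add)
    moreover from this have "snd a = 0 \<or> snd a = 1" "fst a = 0 \<or> fst a = 1 \<or> fst a = 2" by linarith+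
    ultimately show "a \<in> Poly_Mapping.keys trapezoid" unfolding keys_trapezoid by (cases a) auto
  qed
qed

lemma effective_rank_two_trapezoid: "effective_rank_two trapezoid"
  unfolding effective_rank_two_def
proof (rule set_eqI, simp only: UNIV_I iff_conv_conj_imp simp_thms)
  let ?A = "Poly_Mapping.keys trapezoid"
  let ?S = "{real_pt (a - b) | a b. a \<in> ?A \<and> b \<in> ?A}"
  fix x :: "real \<times> real"
  have "(1, 0) - (0, 0) = (1 :: int, 0 :: int)" "(0, 1) - (0, 0) = (0 :: int, 1 :: int)" by simp_all
  moreover have "(1, 0) \<in> ?A" "(0, 1) \<in> ?A" "(0, 0) \<in> ?A" by (simp_all add: keys_trapezoid)
  ultimately have "real_pt (1, 0) \<in> ?S" "real_pt (0, 1) \<in> ?S" by (metis (mono_tags, lifting) mem_Collect_eq)+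
  then have "fst x *\<^sub>R real_pt (1, 0) + snd x *\<^sub>R real_pt (0, 1) \<in> span ?S"
    by (intro span_add span_scale span_base)
  then show "x \<in> span ?S" by (simp add: real_pt_def)
qed

theorem proposition9p1:
  shows "(\<forall>p :: laurent. \<forall>m0 \<in> Poly_Mapping.keys p. \<forall>N :: nat.
            effective_rank_two p \<longrightarrow> unimodular_support p \<longrightarrow> N > 0 \<longrightarrow> mu m0 p dvd p ^ N \<longrightarrow>
            ml_degree p = 1) \<and>
         (\<exists>(p :: laurent) P.
            effective_rank_two p \<and> unimodular_support p \<and>
            positive_coefficients p \<and>
            smooth_polygon P \<and> Poly_Mapping.keys p = {a. real_pt a \<in> P} \<and>
            ml_degree p = 1 \<and>
            (\<forall>m0 \<in> Poly_Mapping.keys p. \<forall>N :: nat. N > 0 \<longrightarrow> \<not> mu m0 p dvd p ^ N))"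
proof (rule conjI)
  have "positive_coefficients trapezoid"
    by (auto simp: positive_coefficients_def keys_trapezoid lookup_trapezoid)
  then have "effective_rank_two trapezoid \<and> unimodular_support trapezoid \<and> positive_coefficients trapezoid \<and>
      smooth_polygon trapezoid_hull \<and> Poly_Mapping.keys trapezoid = {a. real_pt a \<in> trapezoid_hull} \<and>
      ml_degree trapezoid = 1 \<and>
      (\<forall>m0 \<in> Poly_Mapping.keys trapezoid. \<forall>N :: nat. N > 0 \<longrightarrow> \<not> mu m0 trapezoid dvd trapezoid ^ N)"
    using effective_rank_two_trapezoid unimodular_trapezoid smooth_trapezoid lattice_points_trapezoid
      ml_degree_trapezoid mu_trapezoid_not_dvd by blast
  then show "\<exists>(p :: laurent) P.
            effective_rank_two p \<and> unimodular_support p \<and>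
            positive_coefficients p \<and>
            smooth_polygon P \<and> Poly_Mapping.keys p = {a. real_pt a \<in> P} \<and>
            ml_degree p = 1 \<and>
            (\<forall>m0 \<in> Poly_Mapping.keys p. \<forall>N :: nat. N > 0 \<longrightarrow> \<not> mu m0 p dvd p ^ N)" by blast
qed (use ml_degree_eq_1_if_mu_dvd in blast)

end
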